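(* For positive integers $n,L$ let $R_{n,L}=[-nL,nL+1]\times[0,2n+1]$, regarded as a union of unit lattice squares. Let $R^{(1)}_{n,L}$ (resp. $R^{(2)}_{n,L}$) be the polyomino obtained from $R_{n,L}$ by removing the unit square at the corner $(-nL,0)$ (resp. at the corner $(nL+1,0)$). Take independent uniformly random domino tilings of $R^{(1)}_{n,L}$ and $R^{(2)}_{n,L}$, superpose them, and let $\gamma$ be the resulting random path going from the corner $(-nL,0)$ to the corner $(nL+1,0)$. Let $w$ be a point of the strip $\{z\in\mathbb{C}:0<\Im z<1\}$, and let $w_n$ be an integral (lattice point) approximation of $2nw$ in $R_{n,L}$. Then $$\lim_{L\to\infty}\ \lim_{n\to\infty}\ \mathbb{P}_{R_{n,L}}\big(w_n\text{ lies above }\gamma\big)=\Im w.$$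
   Context: A domino is a union of two adjacent unit lattice squares; a domino tiling of a polyomino is a partition of it into dominos, equivalently a perfect matching of the adjacency graph of its unit squares. Superposing a tiling of $R^{(1)}_{n,L}$ and a tiling of $R^{(2)}_{n,L}$ (as a union of two matchings on the unit squares of $R_{n,L}$): each unit square other than the two removed corner squares belongs to one domino of each tiling, and each of the two corner squares belongs to a domino of exactly one tiling. Hence the union decomposes into doubled dominos, disjoint closed cycles, and exactly one simple path $\gamma$ (through centers of adjacent squares) joining the removed corner square at $(-nL,0)$ to the removed corner square at $(nL+1,0)$. A lattice point lies above $\gamma$ if it is separated by $\gamma$ from the bottom side of $R_{n,L}$ (with $\gamma$ extended to the two bottom corners of $R_{n,L}$). "Integral approximation of $2nw$" means a lattice point $w_n\in\mathbb{Z}^2$ at bounded distance from $2nw$ (for $L$ fixed large enough, and $n$ large, it lies inside $R_{n,L}$). $\mathbb{P}_{R_{n,L}}$ is the law of the pair of tilings. *)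

theory Defs
  imports "HOL-Probability.Probability" "HOL-Library.Disjoint_Sets"
begin

(* A unit lattice square is represented by its lower left corner, a polyomino by its set of
   squares. *)
type_synonym cell = "int \<times> int"

definition lattice_point :: "int \<times> int \<Rightarrow> complex" where
  "lattice_point p = Complex (of_int (fst p)) (of_int (snd p))"

definition unit_square :: "cell \<Rightarrow> complex set" where
  "unit_square c = cbox (lattice_point c) (lattice_point c + Complex 1 1)"

definition cell_centre :: "cell \<Rightarrow> complex" where
  "cell_centre c = lattice_point c + Complex (1/2) (1/2)"

definition cell_adjacent :: "cell \<Rightarrow> cell \<Rightarrow> bool" where
  "cell_adjacent c d \<longleftrightarrow> \<bar>fst c - fst d\<bar> + \<bar>snd c - snd d\<bar> = 1"

definition is_domino :: "cell set \<Rightarrow> bool" where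
  "is_domino D \<longleftrightarrow> (\<exists>c d. cell_adjacent c d \<and> D = {c, d})"

definition domino_tilings :: "cell set \<Rightarrow> cell set set set" where
  "domino_tilings S = {T. partition_on S T \<and> (\<forall>D\<in>T. is_domino D)}"

definition bottom_left :: "nat \<Rightarrow> nat \<Rightarrow> int \<times> int" where
  "bottom_left n L = (- int (n * L), 0)"

definition bottom_right :: "nat \<Rightarrow> nat \<Rightarrow> int \<times> int" where
  "bottom_right n L = (int (n * L) + 1, 0)"

definition rect :: "nat \<Rightarrow> nat \<Rightarrow> complex set" where
  "rect n L = cbox (Complex (- real (n * L)) 0) (Complex (real (n * L) + 1) (2 * real n + 1))"

definition bottom_side :: "nat \<Rightarrow> nat \<Rightarrow> complex set" where
  "bottom_side n L =
     closed_segment (lattice_point (bottom_left n L)) (lattice_point (bottom_right n L))"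

definition rect_cells :: "nat \<Rightarrow> nat \<Rightarrow> cell set" where
  "rect_cells n L = {c. unit_square c \<subseteq> rect n L}"

lemma rect_cells_eq: "rect_cells n L = {- int (n * L)..int (n * L)} \<times> {0..2 * int n}"
proof -
  have "unit_square c \<subseteq> rect n L \<longleftrightarrow>
      - int (n * L) \<le> fst c \<and> fst c \<le> int (n * L) \<and> 0 \<le> snd c \<and> snd c \<le> 2 * int n" for c
  proof -
    have "unit_square c \<subseteq> rect n L \<longleftrightarrow>
        - real (n * L) \<le> of_int (fst c) \<and> of_int (fst c) \<le> real (n * L) \<and>
        0 \<le> real_of_int (snd c) \<and> of_int (snd c) \<le> 2 * real n"
      unfolding unit_square_def rect_def lattice_point_def subset_box(1)
      by (simp add: Basis_complex_def inner_complex_def del: of_nat_mult)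
    also have "\<dots> \<longleftrightarrow>
        - int (n * L) \<le> fst c \<and> fst c \<le> int (n * L) \<and> 0 \<le> snd c \<and> snd c \<le> 2 * int n"
      by linarith
    finally show ?thesis .
  qed
  then show ?thesis
    unfolding rect_cells_def by auto
qed

(* The square at the bottom right corner (nL + 1, 0) has lower left corner (nL, 0). *)
definition left_cell :: "nat \<Rightarrow> nat \<Rightarrow> cell" where
  "left_cell n L = (- int (n * L), 0)"

definition right_cell :: "nat \<Rightarrow> nat \<Rightarrow> cell" where
  "right_cell n L = (int (n * L), 0)"

definition R1 :: "nat \<Rightarrow> nat \<Rightarrow> cell set" where
  "R1 n L = rect_cells n L - {left_cell n L}"

definition R2 :: "nat \<Rightarrow> nat \<Rightarrow> cell set" where
  "R2 n L = rect_cells n L - {right_cell n L}"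

definition tiling_pair_law :: "nat \<Rightarrow> nat \<Rightarrow> (cell set set \<times> cell set set) pmf" where
  "tiling_pair_law n L =
     pair_pmf (pmf_of_set (domino_tilings (R1 n L))) (pmf_of_set (domino_tilings (R2 n L)))"

(* The graph T1 \<union> T2 has maximal degree 2 and its only vertices of degree 1 are the two
   corner squares, so the simple path joining them exists and is unique. *)
definition gamma_path :: "nat \<Rightarrow> nat \<Rightarrow> cell set set \<Rightarrow> cell set set \<Rightarrow> cell list" where
  "gamma_path n L T1 T2 =
     (THE xs. xs \<noteq> [] \<and> distinct xs \<and> hd xs = left_cell n L \<and> last xs = right_cell n L \<and>
        successively (\<lambda>c d. {c, d} \<in> T1 \<union> T2) xs)"

definition polyline :: "complex list \<Rightarrow> complex set" where
  "polyline ps = (\<Union>i\<in>{i. Suc i < length ps}. closed_segment (ps ! i) (ps ! Suc i))"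

definition gamma_curve :: "nat \<Rightarrow> nat \<Rightarrow> cell list \<Rightarrow> complex set" where
  "gamma_curve n L xs =
     polyline ([lattice_point (bottom_left n L)] @ map cell_centre xs
               @ [lattice_point (bottom_right n L)])"

definition lies_above :: "nat \<Rightarrow> nat \<Rightarrow> int \<times> int \<Rightarrow> cell list \<Rightarrow> bool" where
  "lies_above n L p xs \<longleftrightarrow>
     lattice_point p \<in> rect n L - gamma_curve n L xs \<and>
     (\<forall>q \<in> bottom_side n L - gamma_curve n L xs.
        \<not> connected_component (rect n L - gamma_curve n L xs) (lattice_point p) q)"

definition integral_approximation :: "(nat \<Rightarrow> int \<times> int) \<Rightarrow> complex \<Rightarrow> bool" where
  "integral_approximation v w \<longleftrightarrow> (\<exists>C. \<forall>n. dist (lattice_point (v n)) (2 * of_nat n * w) \<le> C)"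

end

theory Submission
  imports Defs "Jordan_Normal_Form.Determinant" "HOL-Real_Asymp.Real_Asymp"
begin

text \<open>
  Direct the dominos of the superposition so that it becomes a unit flow from the left to the
  right corner plus a flow around each closed cycle. The flow along the path through the vertical
  segment below a lattice point is \<open>1\<close> or \<open>0\<close> according as the point is above
  the path or not. Exchanging the two tilings off the path reverses the cycles, so the probability
  of lying above the path is the mean flow through that segment, a sum of differences of edge
  probabilities of the two tilings.

  These are read off the inverse Kasteleyn matrices of the two polyominoes. Both matrices are
  submatrices of one for the whole rectangle, whose kernel is spanned by the indicator of the
  cells with both coordinates even (relative to the left corner). Hence the mean flow lives on
  the grid formed by these cells, and it is divergence free and curl free: it is the unit electric
  current between the two corners. Its stream function is discrete harmonic with boundary values
  \<open>0\<close> at the bottom and \<open>1\<close> on the other three sides. Expanding it in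
  sine modes, the limit \<open>n \<longrightarrow> \<infinity>\<close> is taken term by term; all terms but
  the linear function of the height decay exponentially in \<open>L\<close>.
\<close>

section \<open>Signs of permutations\<close>

text \<open>Lying above the path depends on the whole superposition, while Kasteleyn's method gives
  single edge probabilities; only because the 0/1 height is a sum of edge variables can the two be
  combined. Three points need an argument of their own. Signs: instead of orienting faces, dominos
  are drawn as arcs over the row-major line of cells. Comparing the order of the ends of any two
  arcs extracts the sign of the permutation and leaves the parity of the number of crossings, which
  in a region with holes only in the bottom row equals the parity of a sum of column numbers, hence
  a product of local weights. Topology: the rectangle is cut into closed unit boxes around the
  lattice points, and boxes of different height meet only on the curve, so plain connectedness is
  enough and no Jordan curve theorem is invoked. Limits: the Dirichlet solution is explicit for
  every mesh, and its modes have a geometric majorant independent of the mesh; the inner limit is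
  the harmonic function on a rectangle of height 1 and width \<open>L\<close>.\<close>

definition key_pairs :: "('a \<Rightarrow> 'k::linorder) \<Rightarrow> 'a set \<Rightarrow> ('a \<times> 'a) set" where
  "key_pairs k S = {(i, j). i \<in> S \<and> j \<in> S \<and> k i < k j}"

lemma finite_key_pairs: "finite S \<Longrightarrow> finite (key_pairs k S)"
  by (rule finite_subset[of _ "S \<times> S"]) (auto simp: key_pairs_def)

text \<open>An injective key picks exactly one ordered representative of every unordered pair, and a
  symmetric factor does not notice which one. Dominos can therefore be sorted later by any
  convenient endpoint.\<close>

lemma prod_key_pairs_cong_key:
  fixes t :: "'a \<Rightarrow> 'a \<Rightarrow> 'b::comm_monoid_mult"
  assumes "inj_on k S" "inj_on l S" "\<And>i j. t i j = t j i"
  shows "(\<Prod>(i, j)\<in>key_pairs k S. t i j) = (\<Prod>(i, j)\<in>key_pairs l S. t i j)"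
proof -
  have k: "k b < k a" if "l a < l b" "a \<in> S" "b \<in> S" "k b \<le> k a" for a b
    using that assms(1) by (metis inj_onD order.not_eq_order_implies_strict less_irrefl)
  have l: "l b < l a" if "k a < k b" "a \<in> S" "b \<in> S" "l b \<le> l a" for a b
    using that assms(2) by (metis inj_onD order.not_eq_order_implies_strict less_irrefl)
  show ?thesis
  proof (rule prod.reindex_bij_witness[where i = "\<lambda>(i, j). if k i < k j then (i, j) else (j, i)"
          and j = "\<lambda>(i, j). if l i < l j then (i, j) else (j, i)"])
  qed (auto simp: key_pairs_def assms(3) not_less split: if_splits dest: k l)
qed

text \<open>Relabelling by \<open>p\<close> only replaces the key \<open>k\<close> by
  \<open>k\<close> composed with the inverse of \<open>p\<close>.\<close>

lemma prod_key_pairs_permute: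
  fixes t :: "'a \<Rightarrow> 'a \<Rightarrow> 'b::comm_monoid_mult"
  assumes p: "bij_betw p S S" and k: "inj_on k S" and t: "\<And>i j. t i j = t j i"
  shows "(\<Prod>(i, j)\<in>key_pairs k S. t (p i) (p j)) = (\<Prod>(i, j)\<in>key_pairs k S. t i j)"
proof -
  define q where "q = inv_into S p"
  have q: "q x \<in> S" "p (q x) = x" if "x \<in> S" for x
    using p that unfolding q_def bij_betw_def by (auto simp: inv_into_into f_inv_into_f)
  have pS: "p x \<in> S" "q (p x) = x" if "x \<in> S" for x
    using p that unfolding q_def by (auto simp: bij_betw_def inv_into_f_f)
  have "(\<Prod>(i, j)\<in>key_pairs k S. t (p i) (p j)) = (\<Prod>(i, j)\<in>key_pairs (k \<circ> q) S. t i j)"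
    by (rule prod.reindex_bij_witness[where i = "map_prod q q" and j = "map_prod p p"])
       (auto simp: key_pairs_def q pS)
  also have "\<dots> = (\<Prod>(i, j)\<in>key_pairs k S. t i j)"
  proof (rule prod_key_pairs_cong_key[OF _ k t])
    show "inj_on (k \<circ> q) S"
      using k q by (auto simp: inj_on_def) metis
  qed
  finally show ?thesis .
qed

lemma prod_if_minus_one:
  assumes "finite S"
  shows "(\<Prod>x\<in>S. if P x then - 1 else 1 :: 'a::comm_ring_1) = (- 1) ^ card {x \<in> S. P x}"
proof -
  have "(\<Prod>x\<in>S. if P x then - 1 else 1 :: 'a) = (\<Prod>x\<in>{x \<in> S. P x}. - 1)"
    using assms by (intro prod.mono_neutral_cong_right) auto
  then show ?thesis by simp
qed

text \<open>Writing \<open>g\<close> as an orientation times a symmetric part leaves the number of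
  inversions of a transposition: the swapped pair itself and two for each index in between, an odd
  total.\<close>

lemma prod_key_pairs_transpose:
  fixes g :: "nat \<Rightarrow> nat \<Rightarrow> real"
  assumes ab: "a < b" "b < m" and g: "\<And>i j. g i j = - g j i"
  shows "(\<Prod>(i, j)\<in>key_pairs (\<lambda>i. i) {..<m}. g (Transposition.transpose a b i) (Transposition.transpose a b j))
       = - (\<Prod>(i, j)\<in>key_pairs (\<lambda>i. i) {..<m}. g i j)"
proof -
  let ?t = "Transposition.transpose a b" and ?P = "key_pairs (\<lambda>i::nat. i) {..<m}"
  define orient :: "nat \<Rightarrow> nat \<Rightarrow> real" where "orient i j = (if j < i then - 1 else 1)" for i j
  define s where "s i j = (if i = j then 1 else orient i j * g i j)" for i j
  have s_sym: "s i j = s j i" for i j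
    using g[of i j] by (auto simp: s_def orient_def)
  have t: "bij_betw ?t {..<m} {..<m}"
    using ab by (intro permutes_imp_bij permutes_swap_id) auto
  have transpose_inj: "i = j" if "?t i = ?t j" for i j
    using that by (metis transpose_involutory)
  have inj: "inj_on (\<lambda>i::nat. i) {..<m}" by simp
  have "(\<Prod>(i, j)\<in>?P. g (?t i) (?t j)) = (\<Prod>(i, j)\<in>?P. s (?t i) (?t j) * orient (?t i) (?t j))"
    by (rule prod.cong) (auto simp: key_pairs_def s_def orient_def dest: transpose_inj)
  also have "\<dots> = (\<Prod>(i, j)\<in>?P. s (?t i) (?t j)) * (\<Prod>(i, j)\<in>?P. orient (?t i) (?t j))"
    by (simp add: prod.distrib case_prod_beta)
  also have "(\<Prod>(i, j)\<in>?P. s (?t i) (?t j)) = (\<Prod>(i, j)\<in>?P. s i j)"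
    using prod_key_pairs_permute[OF t inj s_sym] .
  also have "\<dots> = (\<Prod>(i, j)\<in>?P. g i j)"
    by (rule prod.cong) (auto simp: key_pairs_def s_def orient_def)
  also have "(\<Prod>(i, j)\<in>?P. orient (?t i) (?t j)) = (- 1) ^ card {x \<in> ?P. ?t (snd x) < ?t (fst x)}"
    unfolding orient_def case_prod_beta by (intro prod_if_minus_one finite_key_pairs) simp
  also have "{x \<in> ?P. ?t (snd x) < ?t (fst x)}
      = insert (a, b) ((\<lambda>k. (a, k)) ` {a<..<b} \<union> (\<lambda>k. (k, b)) ` {a<..<b})" (is "_ = insert _ (?A \<union> ?B)")
    using ab by (auto simp: key_pairs_def Transposition.transpose_def image_iff split: if_splits)
  also have "card \<dots> = Suc (card (?A \<union> ?B))"
    by (subst card_insert_disjoint) auto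
  also have "card (?A \<union> ?B) = card ?A + card ?B"
    by (intro card_Un_disjoint) auto
  also have "\<dots> = 2 * card {a<..<b}"
    by (simp add: card_image inj_on_def)
  finally show ?thesis by simp
qed

text \<open>The factor that any antisymmetric product over pairs picks up, as for the Vandermonde
  product. The induction keeps \<open>g\<close> arbitrary because each transposition is absorbed
  into it.\<close>

lemma prod_key_pairs_sign:
  fixes g :: "nat \<Rightarrow> nat \<Rightarrow> real"
  assumes p: "p permutes {..<m}" and g: "\<And>i j. g i j = - g j i"
  shows "(\<Prod>(i, j)\<in>key_pairs (\<lambda>i. i) {..<m}. g (p i) (p j))
       = of_int (sign p) * (\<Prod>(i, j)\<in>key_pairs (\<lambda>i. i) {..<m}. g i j)"
  using p finite_lessThan g
proof (induction p arbitrary: g rule: permutes_induct)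
  case id
  show ?case by simp
next
  case (swap a b p)
  let ?t = "Transposition.transpose a b"
  have perm: "permutation ?t" "permutation p"
    using \<open>p permutes {..<m}\<close> permutation_permutes finite_lessThan
    by (blast intro: permutation_swap_id)+
  have "(\<Prod>(i, j)\<in>key_pairs (\<lambda>i. i) {..<m}. g ((?t \<circ> p) i) ((?t \<circ> p) j))
      = of_int (sign p) * (\<Prod>(i, j)\<in>key_pairs (\<lambda>i. i) {..<m}. g (?t i) (?t j))"
    using swap.IH[of "\<lambda>i j. g (?t i) (?t j)", OF swap.prems] by simp
  also have "(\<Prod>(i, j)\<in>key_pairs (\<lambda>i. i) {..<m}. g (?t i) (?t j))
      = of_int (sign ?t) * (\<Prod>(i, j)\<in>key_pairs (\<lambda>i. i) {..<m}. g i j)"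
  proof (cases "a < b")
    case True
    then show ?thesis
      using prod_key_pairs_transpose[OF True _ swap.prems] \<open>b \<in> {..<m}\<close> by (simp add: sign_swap_id)
  next
    case False
    with \<open>a \<noteq> b\<close> have "b < a" by simp
    then show ?thesis
      using prod_key_pairs_transpose[OF _ _ swap.prems, of b a] \<open>a \<in> {..<m}\<close>
      by (simp add: sign_swap_id transpose_commute)
  qed
  finally show ?case
    by (simp add: sign_compose[OF perm] del: comp_apply)
qed

section \<open>The discrete Dirichlet problem in a rectangle\<close>

definition harmonic_on_rect :: "int \<Rightarrow> int \<Rightarrow> int \<Rightarrow> int \<Rightarrow> (int \<Rightarrow> int \<Rightarrow> real) \<Rightarrow> bool" where
  "harmonic_on_rect a b c d f \<longleftrightarrow> (\<forall>i j. a < i \<and> i < b \<and> c < j \<and> j < d \<longrightarrow>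
     4 * f i j = f (i - 1) j + f (i + 1) j + f i (j - 1) + f i (j + 1))"

definition rect_boundary :: "int \<Rightarrow> int \<Rightarrow> int \<Rightarrow> int \<Rightarrow> (int \<times> int) set" where
  "rect_boundary a b c d = {(i, j). a \<le> i \<and> i \<le> b \<and> c \<le> j \<and> j \<le> d \<and> (i = a \<or> i = b \<or> j = c \<or> j = d)}"

text \<open>Maximum principle: at an interior maximum all four neighbours are maximal too, so a
  leftmost maximum lies on the boundary.\<close>

lemma harmonic_le_0:
  assumes f: "harmonic_on_rect a b c d f"
    and bd: "\<And>i j. (i, j) \<in> rect_boundary a b c d \<Longrightarrow> f i j = 0"
    and ij: "a \<le> i" "i \<le> b" "c \<le> j" "j \<le> d"
  shows "f i j \<le> 0"
proof -
  define B where "B = {a..b} \<times> {c..d}"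
  have B: "finite B" "(i, j) \<in> B" using ij by (auto simp: B_def)
  define m where "m = Max ((\<lambda>(i, j). f i j) ` B)"
  have le: "f x y \<le> m" if "(x, y) \<in> B" for x y
    unfolding m_def using that B by (intro Max_ge) (auto intro!: image_eqI[of _ _ "(x, y)"])
  define S where "S = {p \<in> B. f (fst p) (snd p) = m}"
  have "m \<in> (\<lambda>(i, j). f i j) ` B"
    unfolding m_def using B by (intro Max_in) auto
  then have "S \<noteq> {}" "finite S" using B by (auto simp: S_def)
  then obtain p where p: "p \<in> S" "\<And>q. q \<in> S \<Longrightarrow> fst p \<le> fst q"
    using ex_min_if_finite[of "fst ` S"] by (metis (no_types, lifting) empty_is_image finite_imageI imageE image_eqI linorder_not_less)
  obtain x y where xy: "p = (x, y)" by (cases p)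
  have xyB: "(x, y) \<in> B" "f x y = m" using p xy by (auto simp: S_def)
  have "(x, y) \<in> rect_boundary a b c d"
  proof (rule ccontr)
    assume "(x, y) \<notin> rect_boundary a b c d"
    with xyB have int: "a < x" "x < b" "c < y" "y < d"
      by (auto simp: rect_boundary_def B_def)
    then have "4 * f x y = f (x - 1) y + f (x + 1) y + f x (y - 1) + f x (y + 1)"
      using f by (auto simp: harmonic_on_rect_def)
    moreover have "f (x + 1) y \<le> m" "f x (y - 1) \<le> m" "f x (y + 1) \<le> m" "f (x - 1) y \<le> m"
      using int by (auto intro!: le simp: B_def)
    ultimately have "f (x - 1) y = m" using xyB by linarith
    then have "(x - 1, y) \<in> S" using int by (auto simp: S_def B_def)
    then show False using p(2) xy by force
  qed
  then have "m = 0" using bd xyB by auto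
  then show ?thesis using le[of i j] B by auto
qed

lemma harmonic_unique:
  assumes "harmonic_on_rect a b c d f" "harmonic_on_rect a b c d g"
    and bd: "\<And>i j. (i, j) \<in> rect_boundary a b c d \<Longrightarrow> f i j = g i j"
    and ij: "a \<le> i" "i \<le> b" "c \<le> j" "j \<le> d"
  shows "f i j = g i j"
proof -
  have "harmonic_on_rect a b c d (\<lambda>i j. f i j - g i j)" "harmonic_on_rect a b c d (\<lambda>i j. g i j - f i j)"
    using assms(1,2) unfolding harmonic_on_rect_def by (auto simp: algebra_simps)
  from harmonic_le_0[OF this(1) _ ij] harmonic_le_0[OF this(2) _ ij] bd
  show ?thesis by force
qed

text \<open>The sine coefficients of \<open>1 - y / M\<close> on \<open>0 < y < M\<close>.\<close>

definition sine_coeff :: "nat \<Rightarrow> nat \<Rightarrow> real" where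
  "sine_coeff M k = cot (pi * real k / (2 * real M)) / real M"

text \<open>Chosen such that \<open>cosh (decay_rate M k) + cos (pi * k / M) = 2\<close>.\<close>

definition decay_rate :: "nat \<Rightarrow> nat \<Rightarrow> real" where
  "decay_rate M k = 2 * arsinh (sin (pi * real k / (2 * real M)))"

section \<open>Finite sine expansion of a linear function\<close>

lemma sum_cos_multiples:
  assumes "0 < j" "j < 2 * M"
  shows "(\<Sum>k=1..<M. cos (real j * (pi * real k / real M))) = - (1 + (- 1) ^ j) / 2"
proof -
  define x where "x = real j * pi / real M"
  have M: "M > 0" using assms by auto
  have "0 < x / 2" "x / 2 < pi"
    using assms M by (auto simp: x_def field_simps)
  then have s: "sin (x / 2) > 0" by (intro sin_gt_zero) auto
  \<comment> \<open>The factor \<open>2 * sin (x / 2)\<close> makes the cosine sum telescope;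
    \<open>j < 2 * M\<close> keeps \<open>x / 2\<close> below \<open>pi\<close>, so that the factor
    can be cancelled at the end.\<close>
  have tele: "(\<Sum>k=1..<m. 2 * sin (x / 2) * cos (real k * x)) = sin ((real m - 1 / 2) * x) - sin (x / 2)"
    if "m > 0" for m
    using that
  proof (induction m rule: nat_induct_non_zero)
    case 1
    then show ?case by simp
  next
    case (Suc m)
    have "(\<Sum>k=1..<Suc m. 2 * sin (x / 2) * cos (real k * x))
        = sin ((real m - 1 / 2) * x) - sin (x / 2) + 2 * sin (x / 2) * cos (real m * x)"
      using Suc by (simp add: atLeastLessThanSuc)
    also have "2 * sin (x / 2) * cos (real m * x) = sin (real m * x + x / 2) - sin (real m * x - x / 2)"
      unfolding sin_add sin_diff by simp
    also have "real m * x - x / 2 = (real m - 1 / 2) * x" by (simp add: algebra_simps)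
    also have "real m * x + x / 2 = (real (Suc m) - 1 / 2) * x" by (simp add: algebra_simps)
    finally show ?case by simp
  qed
  have "(real M - 1 / 2) * x = real j * pi - x / 2"
    using M by (simp add: x_def field_simps)
  then have "sin ((real M - 1 / 2) * x) = - ((- 1) ^ j) * sin (x / 2)"
    by (simp add: sin_diff mult.commute[of _ pi])
  with tele[OF M] have "2 * sin (x / 2) * (\<Sum>k=1..<M. cos (real k * x)) = - (1 + (- 1) ^ j) * sin (x / 2)"
    by (simp add: sum_distrib_left algebra_simps)
  then have "sin (x / 2) * (2 * (\<Sum>k=1..<M. cos (real k * x)) + (1 + (- 1) ^ j)) = 0"
    by (simp add: algebra_simps)
  then have "(\<Sum>k=1..<M. cos (real k * x)) = - (1 + (- 1) ^ j) / 2"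
    using s by simp
  then show ?thesis by (simp add: x_def field_simps)
qed

lemma sine_coeff_mult_sin:
  assumes "0 < k" "k < M"
  shows "sine_coeff M k * sin (pi * real k / real M) = (1 + cos (pi * real k / real M)) / real M"
proof -
  define t where "t = pi * real k / (2 * real M)"
  have "0 < t" "t < pi" using assms by (auto simp: t_def field_simps)
  then have s: "sin t > 0" by (intro sin_gt_zero) auto
  have "pi * real k / real M = 2 * t" by (simp add: t_def)
  then have "sine_coeff M k * sin (pi * real k / real M) = cot t / real M * sin (2 * t)"
    by (simp add: sine_coeff_def t_def)
  also have "\<dots> = 2 * (cos t)\<^sup>2 / real M"
    using s unfolding sin_double cot_def by (simp add: power2_eq_square)
  also have "2 * (cos t)\<^sup>2 = 1 + cos (2 * t)"
    unfolding cos_double_cos by simp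
  finally show ?thesis by (simp add: t_def)
qed

text \<open>Differences of values two apart turn the cotangent coefficients into cosine sums that
  are known in closed form, so a recursion with step two proves the identity.\<close>

lemma sine_expansion:
  assumes "0 < j" "j < M"
  shows "(\<Sum>k=1..<M. sine_coeff M k * sin (real j * (pi * real k / real M))) = 1 - real j / real M"
proof -
  define S where "S j = (\<Sum>k=1..<M. sine_coeff M k * sin (real j * (pi * real k / real M)))" for j
  define C where "C j = (\<Sum>k=1..<M. cos (real j * (pi * real k / real M)))" for j :: nat
  have M: "M \<ge> 2" using assms by auto
  have C: "C j = - (1 + (- 1) ^ j) / 2" if "0 < j" "j < 2 * M" for j
    unfolding C_def by (rule sum_cos_multiples[OF that])
  have C0: "C 0 = real M - 1" using M by (simp add: C_def of_nat_diff)
  have step: "S (j + 2) = S j + (2 * C (j + 1) + C (j + 2) + C j) / real M" for j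
  proof -
    have "S (j + 2) - S j = (\<Sum>k=1..<M. 2 * cos (real (j + 1) * (pi * real k / real M))
        * (sine_coeff M k * sin (pi * real k / real M)))"
      unfolding S_def sum_subtractf[symmetric]
    proof (rule sum.cong)
      fix k
      define t where "t = pi * real k / real M"
      have "sin (real (j + 2) * t) - sin (real j * t) = 2 * cos (real (j + 1) * t) * sin t"
        using sin_add[of "real (j + 1) * t" t] sin_diff[of "real (j + 1) * t" t]
        by (simp add: algebra_simps)
      then show "sine_coeff M k * sin (real (j + 2) * (pi * real k / real M)) -
          sine_coeff M k * sin (real j * (pi * real k / real M)) =
          2 * cos (real (j + 1) * (pi * real k / real M)) * (sine_coeff M k * sin (pi * real k / real M))"
        unfolding t_def[symmetric] by (simp add: algebra_simps)
    qed simp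
    also have "\<dots> = (\<Sum>k=1..<M. (2 * cos (real (j + 1) * (pi * real k / real M))
        + cos (real (j + 2) * (pi * real k / real M)) + cos (real j * (pi * real k / real M))) / real M)"
    proof (rule sum.cong)
      fix k assume "k \<in> {1..<M}"
      then have k: "0 < k" "k < M" by auto
      define t where "t = pi * real k / real M"
      have "cos (real (j + 2) * t) + cos (real j * t) = 2 * cos (real (j + 1) * t) * cos t"
        using cos_add[of "real (j + 1) * t" t] cos_diff[of "real (j + 1) * t" t]
        by (simp add: algebra_simps)
      then show "2 * cos (real (j + 1) * (pi * real k / real M)) * (sine_coeff M k * sin (pi * real k / real M))
         = (2 * cos (real (j + 1) * (pi * real k / real M))
        + cos (real (j + 2) * (pi * real k / real M)) + cos (real j * (pi * real k / real M))) / real M"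
        unfolding t_def[symmetric] sine_coeff_mult_sin[OF k, folded t_def]
        by (simp add: field_simps)
    qed simp
    also have "\<dots> = (2 * C (j + 1) + C (j + 2) + C j) / real M"
      unfolding C_def by (simp add: sum_divide_distrib[symmetric] sum.distrib sum_distrib_left)
    finally show ?thesis by simp
  qed
  have S0: "S 0 = 0" by (simp add: S_def)
  have "S 1 = (\<Sum>k=1..<M. (1 + cos (real 1 * (pi * real k / real M))) / real M)"
    unfolding S_def by (rule sum.cong) (auto simp: sine_coeff_mult_sin)
  also have "\<dots> = (real M - 1 + C 1) / real M"
    using M unfolding C_def by (simp add: sum_divide_distrib[symmetric] sum.distrib of_nat_diff)
  finally have S1: "S 1 = 1 - 1 / real M"
    using C[of 1] M by (simp add: field_simps)
  have "S j = 1 - real j / real M" if "0 < j" "j < M" for j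
    using that
  proof (induction j rule: less_induct)
    case (less j)
    consider "j = 1" | "j = 2" | i where "j = i + 2" "0 < i"
      using less.prems by (metis One_nat_def Suc_1 add.commute add_2_eq_Suc gr0_conv_Suc not_gr_zero)
    then show ?case
    proof cases
      case 1
      then show ?thesis using S1 by simp
    next
      \<comment> \<open>The recursion starts from \<open>S 0 = 0\<close>, although
        \<open>1 - real j / real M\<close> is 1 at \<open>j = 0\<close>; the exceptional value
        \<open>C 0 = real M - 1\<close> makes up for the jump.\<close>
      case 2
      then show ?thesis using step[of 0] S0 C0 C[of 1] C[of 2] M by (simp add: field_simps numeral_2_eq_2)
    next
      case 3
      have "S i = 1 - real i / real M" using 3 less by simp
      moreover have "2 * C (i + 1) + C (i + 2) + C i = - 2"
        using C[of i] C[of "i + 1"] C[of "i + 2"] 3 less.prems by (simp add: field_simps)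
      ultimately show ?thesis using step[of i] 3 M by (simp add: field_simps)
    qed
  qed
  then show ?thesis using assms unfolding S_def by simp
qed

section \<open>The explicit solution of the discrete Dirichlet problem\<close>

definition sine_mode :: "nat \<Rightarrow> real \<Rightarrow> real \<Rightarrow> real \<Rightarrow> nat \<Rightarrow> real" where
  "sine_mode M r x y k = sine_coeff M k * sin (y * (pi * real k / real M)) *
     (cosh (decay_rate M k * x) / cosh (decay_rate M k * r))"

text \<open>The linear part is right at the bottom and at the top, where all modes vanish; on the
  two sides the modes add the missing \<open>1 - y / real M\<close>. The sides are
  \<open>x = - 1\<close> and \<open>x = real N\<close>, hence the centre
  \<open>(real N - 1) / 2\<close> and the half-width \<open>(real N + 1) / 2\<close>.\<close>

definition strip_solution :: "nat \<Rightarrow> nat \<Rightarrow> real \<Rightarrow> real \<Rightarrow> real" where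
  "strip_solution N M x y = y / real M + (\<Sum>k=1..<M. sine_mode M ((real N + 1) / 2) (x - (real N - 1) / 2) y k)"

lemma cosh_decay_rate: "cosh (decay_rate M k) = 2 - cos (pi * real k / real M)"
proof -
  define t where "t = pi * real k / (2 * real M)"
  have "cosh (decay_rate M k) = 1 + 2 * (sin t)\<^sup>2"
    using cosh_square_eq[of "arsinh (sin t)"]
    unfolding decay_rate_def t_def[symmetric] by (simp add: cosh_double)
  also have "\<dots> = 2 - cos (2 * t)" unfolding cos_double_sin by simp
  finally show ?thesis by (simp add: t_def)
qed

text \<open>The horizontal neighbours contribute a factor \<open>2 * cosh a\<close>, the vertical
  ones \<open>2 * cos t\<close>, and \<open>decay_rate\<close> is made for these to add up to
  4.\<close>

lemma sine_mode_harmonic: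
  "4 * sine_mode M r x y k =
     sine_mode M r (x - 1) y k + sine_mode M r (x + 1) y k + sine_mode M r x (y - 1) k + sine_mode M r x (y + 1) k"
proof -
  define t a c where "t = pi * real k / real M" and "a = decay_rate M k" and "c = sine_coeff M k / cosh (a * r)"
  have mode: "sine_mode M r x y k = c * (sin (y * t) * cosh (a * x))" for x y
    by (simp add: sine_mode_def t_def a_def c_def)
  have C: "cosh (a * (x - 1)) + cosh (a * (x + 1)) = 2 * cosh (a * x) * cosh a"
    by (simp add: ring_distribs cosh_add cosh_diff)
  have S: "sin ((y - 1) * t) + sin ((y + 1) * t) = 2 * sin (y * t) * cos t"
    by (simp add: ring_distribs sin_add sin_diff)
  have "sin (y * t) * cosh (a * (x - 1)) + sin (y * t) * cosh (a * (x + 1))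
      + sin ((y - 1) * t) * cosh (a * x) + sin ((y + 1) * t) * cosh (a * x)
      = sin (y * t) * (cosh (a * (x - 1)) + cosh (a * (x + 1)))
      + (sin ((y - 1) * t) + sin ((y + 1) * t)) * cosh (a * x)"
    by (simp only: distrib_left distrib_right)
  also have "\<dots> = sin (y * t) * (2 * cosh (a * x) * cosh a) + 2 * sin (y * t) * cos t * cosh (a * x)"
    unfolding C S ..
  also have "\<dots> = 4 * (sin (y * t) * cosh (a * x))"
    unfolding a_def t_def cosh_decay_rate by (simp add: algebra_simps)
  finally show ?thesis
    unfolding mode by (metis (no_types, opaque_lifting) distrib_left mult.left_commute)
qed

lemma strip_solution_harmonic:
  "harmonic_on_rect a b c d (\<lambda>i j. strip_solution N M (of_int i) (of_int j))"
  unfolding harmonic_on_rect_def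
proof (intro allI impI)
  fix i j :: int
  let ?r = "(real N + 1) / 2"
  let ?g = "\<lambda>x y. \<Sum>k=1..<M. sine_mode M ?r x y k"
  have g: "4 * ?g x y = ?g (x - 1) y + ?g (x + 1) y + ?g x (y - 1) + ?g x (y + 1)" for x y
    unfolding sum_distrib_left sum.distrib[symmetric] by (rule sum.cong) (auto intro: sine_mode_harmonic)
  show "4 * strip_solution N M (real_of_int i) (real_of_int j) =
       strip_solution N M (real_of_int (i - 1)) (real_of_int j) +
       strip_solution N M (real_of_int (i + 1)) (real_of_int j) +
       strip_solution N M (real_of_int i) (real_of_int (j - 1)) +
       strip_solution N M (real_of_int i) (real_of_int (j + 1))"
    using g[of "of_int i - (real N - 1) / 2" "of_int j"]
    unfolding strip_solution_def by (simp add: algebra_simps add_divide_distrib diff_divide_distrib)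
qed

lemma strip_solution_bottom: "strip_solution N M x 0 = 0"
  by (simp add: strip_solution_def sine_mode_def)

lemma strip_solution_top:
  assumes "M > 0"
  shows "strip_solution N M x (real M) = 1"
proof -
  have "real M * (pi * real k / real M) = pi * real k" for k using assms by simp
  then show ?thesis using assms
    by (simp add: strip_solution_def sine_mode_def)
qed

lemma strip_solution_side:
  assumes "0 < j" "j < M" "x = - 1 \<or> x = real N"
  shows "strip_solution N M x (real j) = 1"
proof -
  let ?r = "(real N + 1) / 2"
  have "x - (real N - 1) / 2 = ?r \<or> x - (real N - 1) / 2 = - ?r"
    using assms(3) by (auto simp: field_simps)
  then have "cosh (decay_rate M k * (x - (real N - 1) / 2)) = cosh (decay_rate M k * ?r)" for k
    by (elim disjE) (simp_all only: mult_minus_right cosh_minus)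
  then have "sine_mode M ?r (x - (real N - 1) / 2) (real j) k
      = sine_coeff M k * sin (real j * (pi * real k / real M))" for k
    unfolding sine_mode_def by (metis cosh_real_nonzero div_self mult.right_neutral)
  then show ?thesis using sine_expansion[OF assms(1,2)] by (simp add: strip_solution_def)
qed

section \<open>Bounds on the modes, uniform in the mesh\<close>

lemma mult_cos_le_sin:
  assumes "0 \<le> t" "t \<le> pi"
  shows "t * cos t \<le> sin t"
proof -
  have "(\<lambda>t. sin t - t * cos t) 0 \<le> (\<lambda>t. sin t - t * cos t) t"
  proof (rule DERIV_nonneg_imp_nondecreasing[OF assms(1)])
    fix x assume x: "0 \<le> x" "x \<le> t"
    have "((\<lambda>t. sin t - t * cos t) has_real_derivative x * sin x) (at x)"
      by (auto intro!: derivative_eq_intros)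
    moreover have "x * sin x \<ge> 0" using x assms by (intro mult_nonneg_nonneg sin_ge_zero) auto
    ultimately show "\<exists>y. ((\<lambda>t. sin t - t * cos t) has_real_derivative y) (at x) \<and> 0 \<le> y"
      by blast
  qed
  then show ?thesis by simp
qed

lemma cot_le_inverse:
  assumes "0 < t" "t < pi / 2"
  shows "0 \<le> cot t" "cot t \<le> 1 / t"
proof -
  have s: "sin t > 0" using assms by (intro sin_gt_zero) auto
  show "0 \<le> cot t" using cot_gt_zero[OF assms] by simp
  show "cot t \<le> 1 / t"
    using mult_cos_le_sin[of t] s assms unfolding cot_def by (simp add: field_simps)
qed

text \<open>The duplication formulas reduce this to \<open>mult_cos_le_sin\<close> at the half
  angle.\<close>

lemma sin_ge_half:
  assumes "0 \<le> t" "t \<le> pi / 2"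
  shows "t / 2 \<le> sin t"
proof -
  have c: "cos (t / 2) \<ge> 0" "cos t \<ge> 0" using assms by (auto intro!: cos_ge_zero)
  have "t / 2 \<le> t / 2 * (1 + cos t)"
    using assms c by (simp add: algebra_simps)
  also have "1 + cos t = 2 * (cos (t / 2))\<^sup>2"
    using cos_double_cos[of "t / 2"] by simp
  also have "t / 2 * (2 * (cos (t / 2))\<^sup>2) = 2 * (t / 2 * cos (t / 2)) * cos (t / 2)"
    by (simp add: power2_eq_square)
  also have "\<dots> \<le> 2 * sin (t / 2) * cos (t / 2)"
    using mult_cos_le_sin[of "t / 2"] assms c by (intro mult_right_mono) auto
  also have "\<dots> = sin t" using sin_double[of "t / 2"] by simp
  finally show ?thesis .
qed

text \<open>Follows from \<open>ln (1 + s)\<close> being at least \<open>s / (1 + s)\<close>; the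
  factor 1/2 comes from \<open>s \<le> 1\<close>.\<close>

lemma arsinh_ge_half:
  assumes "0 \<le> s" "s \<le> 1"
  shows "s / 2 \<le> arsinh (s :: real)"
proof -
  have "s / 2 \<le> s / (1 + s)" using assms by (intro divide_left_mono) auto
  also have "\<dots> = 1 - 1 / (1 + s)" using assms by (simp add: field_simps)
  also have "\<dots> \<le> ln (1 + s)"
    using ln_le_minus_one[of "1 / (1 + s)"] assms by (simp add: ln_div)
  also have "\<dots> \<le> ln (s + sqrt (s\<^sup>2 + 1))"
    using assms arsinh_real_aux[of s] by (subst ln_le_cancel_iff) auto
  also have "\<dots> = arsinh s" by (simp add: arsinh_real_def)
  finally show ?thesis .
qed

text \<open>The growth is linear in \<open>k\<close> with a constant that is exactly of order
  \<open>1 / M\<close>. Over distances proportional to \<open>M\<close> this gives decay in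
  \<open>k\<close> independent of the mesh.\<close>

lemma decay_rate_ge:
  assumes "0 < k" "k < M"
  shows "real k / (2 * real M) \<le> decay_rate M k"
proof -
  define t where "t = pi * real k / (2 * real M)"
  have t: "0 \<le> t" "t \<le> pi / 2" using assms by (auto simp: t_def field_simps)
  have "real k / (2 * real M) = 2 * real k / (4 * real M)" by simp
  also have "\<dots> \<le> pi * real k / (4 * real M)"
    using pi_ge_two by (intro divide_right_mono mult_right_mono) auto
  also have "\<dots> = t / 2" by (simp add: t_def)
  also have "\<dots> \<le> sin t" using sin_ge_half[OF t] .
  also have "\<dots> \<le> 2 * arsinh (sin t)"
    using arsinh_ge_half[of "sin t"] t sin_ge_zero[of t] by auto
  finally show ?thesis by (simp add: decay_rate_def t_def)
qed

lemma sine_coeff_bound: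
  assumes "0 < k" "k < M"
  shows "\<bar>sine_coeff M k\<bar> \<le> 1"
proof -
  define t where "t = pi * real k / (2 * real M)"
  have t: "0 < t" "t < pi / 2" using assms by (auto simp: t_def field_simps)
  have "\<bar>sine_coeff M k\<bar> = cot t / real M"
    using cot_le_inverse(1)[OF t] by (simp add: sine_coeff_def t_def)
  also have "\<dots> \<le> 1 / t / real M"
    using cot_le_inverse(2)[OF t] by (intro divide_right_mono) auto
  also have "\<dots> = 2 / (pi * real k)" using assms by (simp add: t_def)
  also have "\<dots> \<le> 1"
  proof -
    have "2 * 1 \<le> pi * real k" using assms pi_ge_two by (intro mult_mono) auto
    then show ?thesis using assms by (simp add: divide_le_eq)
  qed
  finally show ?thesis .
qed

lemma cosh_ratio_le:
  fixes x r :: real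
  shows "cosh x / cosh r \<le> 2 * exp (\<bar>x\<bar> - r)"
proof -
  have "cosh x = cosh \<bar>x\<bar>" by simp
  also have "\<dots> \<le> exp \<bar>x\<bar>" by (simp add: cosh_field_def)
  finally have x: "cosh x \<le> exp \<bar>x\<bar>" .
  have r: "exp r / 2 \<le> cosh r" by (simp add: cosh_field_def)
  have "cosh x / cosh r \<le> exp \<bar>x\<bar> / (exp r / 2)"
    using x r by (intro frac_le) auto
  then show ?thesis by (simp add: exp_diff mult.commute)
qed

text \<open>Here \<open>d\<close> is the distance to the sides relative to the height. The bound
  does not contain \<open>M\<close>, so one geometric series dominates the modes of all
  meshes.\<close>

lemma sine_mode_bound:
  assumes k: "0 < k" "k < M" and d: "\<bar>x\<bar> + d * real M \<le> r" "0 \<le> d"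
  shows "\<bar>sine_mode M r x y k\<bar> \<le> 2 * exp (- (d / 2) * real k)"
proof -
  let ?a = "decay_rate M k"
  have a: "real k / (2 * real M) \<le> ?a" by (rule decay_rate_ge[OF k])
  then have a0: "?a \<ge> 0" using k by (meson divide_nonneg_nonneg of_nat_0_le_iff order_trans mult_nonneg_nonneg zero_le_numeral)
  have "real k / 2 = real k / (2 * real M) * real M" using k by simp
  also have "\<dots> \<le> ?a * real M" by (intro mult_right_mono a) simp
  finally have "d * (real k / 2) \<le> d * (?a * real M)" using d by (intro mult_left_mono)
  moreover have "?a * (\<bar>x\<bar> + d * real M) \<le> ?a * r" using d a0 by (intro mult_left_mono)
  ultimately have e: "\<bar>?a * x\<bar> - ?a * r \<le> - (d / 2) * real k"
    using a0 by (simp add: abs_mult algebra_simps)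
  have "\<bar>sine_mode M r x y k\<bar> \<le> 1 * 1 * (cosh (?a * x) / cosh (?a * r))"
    unfolding sine_mode_def abs_mult using sine_coeff_bound[OF k]
    by (intro mult_mono) (auto simp: abs_mult)
  also have "\<dots> \<le> 2 * exp (\<bar>?a * x\<bar> - ?a * r)" using cosh_ratio_le by simp
  also have "\<dots> \<le> 2 * exp (- (d / 2) * real k)" using e by simp
  finally show ?thesis .
qed

section \<open>The limits in the mesh and in the width\<close>

text \<open>The modes of the continuous Dirichlet problem on the rectangle of height 1 and
  half-width \<open>r\<close>; the numbers \<open>2 / (pi * real k)\<close> are the sine
  coefficients of \<open>1 - y\<close> on the unit interval.\<close>

definition limit_mode :: "real \<Rightarrow> real \<Rightarrow> real \<Rightarrow> nat \<Rightarrow> real" where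
  "limit_mode r x y k = 2 / (pi * real k) * sin (y * (pi * real k)) *
     (cosh (pi * real k * x) / cosh (pi * real k * r))"

lemma sine_coeff_limit:
  assumes "0 < k"
  shows "(\<lambda>n. sine_coeff (Suc n) k) \<longlonglongrightarrow> 2 / (pi * real k)"
proof -
  define c where "c = real k"
  have "c > 0" using assms by (simp add: c_def)
  then have "(\<lambda>n::nat. cos (pi * c / (2 * real (Suc n))) / sin (pi * c / (2 * real (Suc n))) / real (Suc n))
      \<longlonglongrightarrow> 2 / (pi * c)"
    by real_asymp
  then show ?thesis by (simp add: sine_coeff_def cot_def c_def)
qed

lemma decay_rate_limit:
  shows "(\<lambda>n. decay_rate (Suc n) k * real (Suc n)) \<longlonglongrightarrow> pi * real k"
proof (cases "k = 0")
  case False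
  define c where "c = real k"
  have "c > 0" using False by (simp add: c_def)
  then have "(\<lambda>n::nat. 2 * ln (sin (pi * c / (2 * real (Suc n))) +
      sqrt ((sin (pi * c / (2 * real (Suc n))))\<^sup>2 + 1)) * real (Suc n)) \<longlonglongrightarrow> pi * c"
    by real_asymp
  then show ?thesis by (simp add: decay_rate_def arsinh_real_def c_def)
qed (simp add: decay_rate_def)

lemma sine_mode_limit:
  assumes "0 < k"
    and x: "(\<lambda>n. x n / real (Suc n)) \<longlonglongrightarrow> X"
    and r: "(\<lambda>n. r n / real (Suc n)) \<longlonglongrightarrow> R"
    and y: "(\<lambda>n. y n / real (Suc n)) \<longlonglongrightarrow> Y"
  shows "(\<lambda>n. sine_mode (Suc n) (r n) (x n) (y n) k) \<longlonglongrightarrow> limit_mode R X Y k"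
proof -
  have scale: "sine_mode (Suc n) (r n) (x n) (y n) k = sine_coeff (Suc n) k *
      sin (y n / real (Suc n) * (pi * real k)) *
      (cosh (decay_rate (Suc n) k * real (Suc n) * (x n / real (Suc n))) /
       cosh (decay_rate (Suc n) k * real (Suc n) * (r n / real (Suc n))))" for n
    by (simp add: sine_mode_def del: of_nat_Suc)
  show ?thesis
    unfolding scale limit_mode_def
    by (intro tendsto_intros sine_coeff_limit decay_rate_limit x r y assms) auto
qed

lemma limit_mode_bound:
  assumes "\<bar>x\<bar> \<le> r"
  shows "\<bar>limit_mode r x y k\<bar> \<le> 2 * exp (- (r - \<bar>x\<bar>) * real k)"
proof (cases "k = 0")
  case False
  have "1 \<le> pi" using pi_ge_two by linarith
  have "2 * 1 \<le> pi * real k" using False pi_ge_two by (intro mult_mono) auto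
  then have c: "\<bar>2 / (pi * real k)\<bar> \<le> 1" using False by (simp add: divide_le_eq)
  have "\<bar>limit_mode r x y k\<bar> \<le> 1 * 1 * (cosh (pi * real k * x) / cosh (pi * real k * r))"
    unfolding limit_mode_def abs_mult using c by (intro mult_mono) (auto simp: abs_mult)
  also have "\<dots> \<le> 2 * exp (\<bar>pi * real k * x\<bar> - pi * real k * r)" using cosh_ratio_le by simp
  also have "\<bar>pi * real k * x\<bar> - pi * real k * r = - (pi * (real k * (r - \<bar>x\<bar>)))"
    by (simp add: abs_mult algebra_simps)
  also have "\<dots> \<le> - (1 * (real k * (r - \<bar>x\<bar>)))"
    unfolding neg_le_iff_le using assms \<open>1 \<le> pi\<close> by (intro mult_right_mono) auto
  also have "- (1 * (real k * (r - \<bar>x\<bar>))) = - (r - \<bar>x\<bar>) * real k" by (simp add: algebra_simps)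
  finally show ?thesis by simp
qed (simp add: limit_mode_def)

lemma summable_exp_linear:
  assumes "0 < d"
  shows "summable (\<lambda>k. c * exp (- d * real k))"
proof -
  have "summable (\<lambda>k. exp (- d) ^ k)" using assms by (intro summable_geometric) simp
  then show ?thesis by (simp add: exp_of_nat_mult[symmetric] mult.commute summable_mult)
qed

text \<open>Dominated convergence for series. Eventually the point keeps half of its limiting
  relative distance from the sides, which is the \<open>d\<close> of the majorant.\<close>

lemma strip_solution_limit:
  assumes x: "(\<lambda>n. (x n - (real (N n) - 1) / 2) / real (Suc n)) \<longlonglongrightarrow> X"
    and r: "(\<lambda>n. (real (N n) + 1) / 2 / real (Suc n)) \<longlonglongrightarrow> R"
    and y: "(\<lambda>n. y n / real (Suc n)) \<longlonglongrightarrow> Y"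
    and XR: "\<bar>X\<bar> < R"
  shows "(\<lambda>n. strip_solution (N n) (Suc n) (x n) (y n)) \<longlonglongrightarrow> Y + (\<Sum>k. limit_mode R X Y k)"
proof -
  define mode where "mode n k = sine_mode (Suc n) ((real (N n) + 1) / 2) (x n - (real (N n) - 1) / 2) (y n) k"
    for n k
  \<comment> \<open>Padding by 0 turns the finite sums, whose length depends on \<open>n\<close>,
    into series over a fixed index set.\<close>
  define a where "a k n = (if 0 < k \<and> k < Suc n then mode n k else 0)" for k n
  define d where "d = (R - \<bar>X\<bar>) / 2"
  have d: "d > 0" using XR by (simp add: d_def)
  have "(\<lambda>n. (real (N n) + 1) / 2 / real (Suc n) - \<bar>(x n - (real (N n) - 1) / 2) / real (Suc n)\<bar>)
      \<longlonglongrightarrow> R - \<bar>X\<bar>"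
    by (intro tendsto_intros x r)
  moreover have "R - \<bar>X\<bar> > d" using XR by (simp add: d_def)
  ultimately have "\<forall>\<^sub>F n in sequentially.
      (real (N n) + 1) / 2 / real (Suc n) - \<bar>(x n - (real (N n) - 1) / 2) / real (Suc n)\<bar> > d"
    by (rule order_tendstoD)
  then have ev: "\<forall>\<^sub>F n in sequentially. \<forall>k. norm (a k n) \<le> 2 * exp (- (d / 2) * real k)"
  proof eventually_elim
    case (elim n)
    then have "d * real (Suc n) < ((real (N n) + 1) / 2 / real (Suc n)
        - \<bar>(x n - (real (N n) - 1) / 2) / real (Suc n)\<bar>) * real (Suc n)"
      by (intro mult_strict_right_mono) auto
    also have "\<dots> = (real (N n) + 1) / 2 - \<bar>x n - (real (N n) - 1) / 2\<bar>"
      by (simp add: left_diff_distrib abs_divide del: of_nat_Suc)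
    finally have "\<bar>x n - (real (N n) - 1) / 2\<bar> + d * real (Suc n) \<le> (real (N n) + 1) / 2"
      by linarith
    then show ?case
      using sine_mode_bound[of _ "Suc n"] d unfolding a_def mode_def by simp
  qed
  have lim: "(\<lambda>n. suminf (\<lambda>k. a k n)) \<longlonglongrightarrow> suminf (limit_mode R X Y)"
  proof -
    have "(\<lambda>n. a k n) \<longlonglongrightarrow> limit_mode R X Y k" for k
    proof (cases "k = 0")
      case False
      have "(\<lambda>n. mode n k) \<longlonglongrightarrow> limit_mode R X Y k"
        unfolding mode_def using False by (intro sine_mode_limit x r y) auto
      then show ?thesis
      proof (rule Lim_transform_eventually)
        show "\<forall>\<^sub>F n in sequentially. mode n k = a k n"
          using eventually_ge_at_top[of k] by eventually_elim (use False in \<open>auto simp: a_def\<close>)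
      qed
    qed (simp add: a_def limit_mode_def)
    moreover have "eventually (\<lambda>(k, n). norm (a k n) \<le> 2 * exp (- (d / 2) * real k)) (at_top \<times>\<^sub>F sequentially)"
      using eventually_compose_filterlim[OF ev filterlim_snd]
      by (rule eventually_mono) auto
    ultimately show ?thesis
      using tannerys_theorem[of a "limit_mode R X Y" sequentially "\<lambda>k. 2 * exp (- (d / 2) * real k)"]
        summable_exp_linear[of "d / 2" 2] d by simp
  qed
  have "suminf (\<lambda>k. a k n) = (\<Sum>k=1..<Suc n. mode n k)" for n
  proof -
    have "suminf (\<lambda>k. a k n) = (\<Sum>k\<in>{1..<Suc n}. a k n)"
      by (rule suminf_finite) (auto simp: a_def)
    then show ?thesis by (simp add: a_def)
  qed
  then have "strip_solution (N n) (Suc n) (x n) (y n) = y n / real (Suc n) + suminf (\<lambda>k. a k n)" for n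
    by (simp add: strip_solution_def mode_def)
  then show ?thesis using tendsto_add[OF y lim] by simp
qed

text \<open>Each mode decays exponentially in \<open>L\<close>. The threshold \<open>B\<close> makes
  \<open>real L / 2 - \<bar>X\<bar>\<close> at least 1, from where one geometric series dominates
  all modes.\<close>

lemma limit_mode_sum_tendsto_0: "(\<lambda>L. \<Sum>k. limit_mode (real L / 2) X Y k) \<longlonglongrightarrow> 0"
proof -
  define B where "B = 2 * (\<bar>X\<bar> + 1)"
  have ge: "\<bar>X\<bar> \<le> real L / 2" "1 \<le> real L / 2 - \<bar>X\<bar>" if "B \<le> real L" for L
    using that by (auto simp: B_def)
  have evB: "\<forall>\<^sub>F L in sequentially. B \<le> real L"
    by (rule eventually_sequentiallyI[of "nat \<lceil>B\<rceil>"]) linarith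
  have ev: "\<forall>\<^sub>F L in sequentially. \<forall>k. norm (limit_mode (real L / 2) X Y k) \<le> 2 * exp (- 1 * real k)"
    using evB
  proof eventually_elim
    case (elim L)
    have "exp (- (real L / 2 - \<bar>X\<bar>) * real k) \<le> exp (- 1 * real k)" for k
      unfolding exp_le_cancel_iff using ge(2)[OF elim] by (intro mult_right_mono) auto
    then show ?case
      using limit_mode_bound[OF ge(1)[OF elim], of Y] by (smt (verit) real_norm_def)
  qed
  have "(\<lambda>L. limit_mode (real L / 2) X Y k) \<longlonglongrightarrow> 0" for k
  proof (cases "k = 0")
    case False
    define c where "c = real k"
    have "c > 0" using False by (simp add: c_def)
    then have "(\<lambda>L::nat. 2 * exp (- (real L / 2 - \<bar>X\<bar>) * c)) \<longlonglongrightarrow> 0"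
      by real_asymp
    then show ?thesis
      by (rule Lim_null_comparison[rotated])
        (rule eventually_mono[OF evB], use limit_mode_bound[OF ge(1)] in \<open>auto simp: c_def\<close>)
  qed (simp add: limit_mode_def)
  moreover have "eventually (\<lambda>(k, L). norm (limit_mode (real L / 2) X Y k) \<le> 2 * exp (- 1 * real k))
      (at_top \<times>\<^sub>F sequentially)"
    using eventually_compose_filterlim[OF ev filterlim_snd] by (rule eventually_mono) auto
  ultimately show ?thesis
    using tannerys_theorem[of "\<lambda>k L. limit_mode (real L / 2) X Y k" "\<lambda>_. 0" sequentially "\<lambda>k. 2 * exp (- 1 * real k)"]
      summable_exp_linear[of 1 2] by simp
qed

section \<open>Domino tilings\<close>

lemma cell_adjacent_sym: "cell_adjacent c d \<longleftrightarrow> cell_adjacent d c"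
  by (auto simp: cell_adjacent_def abs_minus_commute)

lemma cell_adjacent_irrefl [simp]: "\<not> cell_adjacent c c"
  by (simp add: cell_adjacent_def)

lemma cell_adjacent_iff:
  "cell_adjacent (x, y) (u, v) \<longleftrightarrow>
     u = x + 1 \<and> v = y \<or> u = x - 1 \<and> v = y \<or> u = x \<and> v = y + 1 \<or> u = x \<and> v = y - 1"
    (is "_ \<longleftrightarrow> ?R")
proof
  assume "cell_adjacent (x, y) (u, v)"
  then have "\<bar>x - u\<bar> + \<bar>y - v\<bar> = 1" by (simp add: cell_adjacent_def)
  then show ?R by (auto simp: abs_if split: if_splits)
qed (auto simp: cell_adjacent_def)

lemma domino_tilingsD:
  assumes "T \<in> domino_tilings S"
  shows "\<Union> T = S" "disjoint T" "\<And>D. D \<in> T \<Longrightarrow> is_domino D"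
  using assms unfolding domino_tilings_def partition_on_def by blast+

lemma is_dominoE:
  assumes "is_domino D" "c \<in> D"
  obtains d where "D = {c, d}" "cell_adjacent c d"
proof -
  obtain a b where ab: "cell_adjacent a b" "D = {a, b}"
    using assms(1) unfolding is_domino_def by blast
  then have "c = a \<or> c = b" using assms(2) by blast
  then show thesis
  proof
    assume "c = a"
    then show thesis using that[of b] ab by simp
  next
    assume "c = b"
    then show thesis using that[of a] ab cell_adjacent_sym by (simp add: insert_commute)
  qed
qed

lemma tiling_edgeD:
  assumes "T \<in> domino_tilings S" "{c, d} \<in> T"
  shows "c \<in> S" "d \<in> S" "cell_adjacent c d"
proof -
  show "c \<in> S" "d \<in> S"
    using domino_tilingsD(1)[OF assms(1)] assms(2) by blast+
  obtain e where e: "{c, d} = {c, e}" "cell_adjacent c e"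
    using is_dominoE[OF domino_tilingsD(3)[OF assms], of c] by blast
  then have "d = e" by (auto simp: doubleton_eq_iff)
  then show "cell_adjacent c d" using e by simp
qed

definition partner :: "cell set set \<Rightarrow> cell \<Rightarrow> cell" where
  "partner T c = (THE d. {c, d} \<in> T)"

lemma partner_eqI:
  assumes T: "T \<in> domino_tilings S" and "{c, d} \<in> T"
  shows "partner T c = d"
  unfolding partner_def
proof (rule the_equality)
  fix e assume e: "{c, e} \<in> T"
  have "{c, e} = {c, d}" using disjointD[OF domino_tilingsD(2)[OF T] e assms(2)] by blast
  then show "e = d" by (auto simp: doubleton_eq_iff)
qed (fact assms)

lemma partner_edge:
  assumes T: "T \<in> domino_tilings S" and c: "c \<in> S"
  shows "{c, partner T c} \<in> T"
proof -
  obtain D where D: "D \<in> T" "c \<in> D"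
    using domino_tilingsD(1)[OF T] c by blast
  then obtain d where "D = {c, d}" using is_dominoE[OF domino_tilingsD(3)[OF T]] by blast
  then show ?thesis using partner_eqI[OF T, of c d] D(1) by simp
qed

lemma edge_iff_partner:
  assumes T: "T \<in> domino_tilings S"
  shows "{c, d} \<in> T \<longleftrightarrow> c \<in> S \<and> d = partner T c"
  using partner_edge[OF T] partner_eqI[OF T] tiling_edgeD(1)[OF T] by metis

lemma partner_props:
  assumes T: "T \<in> domino_tilings S" and c: "c \<in> S"
  shows "partner T c \<in> S" "cell_adjacent c (partner T c)" "partner T (partner T c) = c"
proof -
  note e = partner_edge[OF T c]
  show "partner T c \<in> S" "cell_adjacent c (partner T c)" using tiling_edgeD[OF T e] by simp_all
  have "{partner T c, c} \<in> T" using e by (simp add: insert_commute)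
  then show "partner T (partner T c) = c" by (rule partner_eqI[OF T])
qed

text \<open>Tilings correspond to involutions that move every cell to an adjacent one; this
  direction is used to build tilings.\<close>

lemma domino_tilingI:
  assumes f: "\<And>c. c \<in> S \<Longrightarrow> f c \<in> S \<and> f (f c) = c \<and> cell_adjacent c (f c)"
  shows "(\<lambda>c. {c, f c}) ` S \<in> domino_tilings S"
    and "c \<in> S \<Longrightarrow> partner ((\<lambda>c. {c, f c}) ` S) c = f c"
proof -
  have "partition_on S ((\<lambda>c. {c, f c}) ` S)"
    unfolding partition_on_def
  proof (intro conjI)
    show "\<Union> ((\<lambda>c. {c, f c}) ` S) = S" using f by blast
    show "disjoint ((\<lambda>c. {c, f c}) ` S)"
      unfolding disjoint_def pairwise_def disjnt_def
    proof (intro ballI impI)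
      fix D D' assume "D \<in> (\<lambda>c. {c, f c}) ` S" "D' \<in> (\<lambda>c. {c, f c}) ` S" "D \<noteq> D'"
      then obtain c d where cd: "c \<in> S" "d \<in> S" "D = {c, f c}" "D' = {d, f d}" by blast
      show "D \<inter> D' = {}"
      proof (rule ccontr)
        assume "D \<inter> D' \<noteq> {}"
        then consider "c = d" | "c = f d" | "f c = d" | "f c = f d" unfolding cd by blast
        then have "D = D'"
          unfolding cd using f[OF cd(1)] f[OF cd(2)] by cases (metis insert_commute)+
        with \<open>D \<noteq> D'\<close> show False ..
      qed
    qed
  qed auto
  moreover have "\<forall>D\<in>(\<lambda>c. {c, f c}) ` S. is_domino D"
    using f unfolding is_domino_def by blast
  ultimately show T: "(\<lambda>c. {c, f c}) ` S \<in> domino_tilings S" by (simp add: domino_tilings_def)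
  show "partner ((\<lambda>c. {c, f c}) ` S) c = f c" if "c \<in> S"
    using partner_eqI[OF T] that by blast
qed

lemma tiling_eq_partner:
  assumes T: "T \<in> domino_tilings S"
  shows "T = (\<lambda>c. {c, partner T c}) ` S"
proof (intro equalityI subsetI)
  fix D assume D: "D \<in> T"
  then obtain c d where cd: "D = {c, d}"
    using domino_tilingsD(3)[OF T] unfolding is_domino_def by blast
  then show "D \<in> (\<lambda>c. {c, partner T c}) ` S"
    using D edge_iff_partner[OF T, of c d] by blast
qed (use partner_edge[OF T] in blast)

lemma finite_domino_tilings: "finite S \<Longrightarrow> finite (domino_tilings S)"
  by (rule finite_subset[of _ "Pow (Pow S)"]) (auto simp: domino_tilings_def partition_on_def)

lemma even_card_involution:
  assumes "finite X" "\<And>x. x \<in> X \<Longrightarrow> f x \<in> X \<and> f (f x) = x \<and> f x \<noteq> x"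
  shows "even (card X)"
  using assms
proof (induction X rule: finite_psubset_induct)
  case (psubset X)
  show ?case
  proof (cases "X = {}")
    case False
    then obtain x where x: "x \<in> X" by blast
    have "even (card (X - {x, f x}))"
    proof (rule psubset.IH)
      show "X - {x, f x} \<subset> X" using x by auto
      fix y assume "y \<in> X - {x, f x}"
      then show "f y \<in> X - {x, f x} \<and> f (f y) = y \<and> f y \<noteq> y"
        using psubset.prems[of y] psubset.prems[of x] x by (metis DiffD1 DiffD2 DiffI insert_iff singletonD)
    qed
    moreover have two: "card {x, f x} = 2" "{x, f x} \<subseteq> X"
      using psubset.prems[OF x] x by (auto simp: card_insert_if)
    moreover have "card (X - {x, f x}) = card X - 2"
      using two psubset.hyps by (subst card_Diff_subset) (auto intro: finite_subset)
    moreover have "card X \<ge> 2" using two psubset.hyps by (metis card_mono)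
    ultimately show ?thesis by simp
  qed simp
qed

section \<open>Inverse Kasteleyn matrices\<close>

text \<open>If all nonzero terms of the Leibniz expansion agree, nothing cancels: the determinant is
  \<open>c\<close> times the number of terms, and an entry times its cofactor is \<open>c\<close>
  times the number of terms through that entry. The quotient is the probability that a uniformly
  chosen term uses the entry.\<close>

lemma matrix_inverse_weighted_permutations:
  fixes K :: "nat \<Rightarrow> nat \<Rightarrow> real" and c :: real and m :: nat
  defines "P \<equiv> {p. p permutes {..<m} \<and> (\<forall>i<m. K i (p i) \<noteq> 0)}"
  assumes c: "c \<noteq> 0" and P: "P \<noteq> {}"
    and sgn: "\<And>p. p \<in> P \<Longrightarrow> of_int (sign p) * (\<Prod>i<m. K i (p i)) = c"
  shows "\<exists>G :: nat \<Rightarrow> nat \<Rightarrow> real.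
    (\<forall>i<m. \<forall>i'<m. (\<Sum>j<m. K i j * G j i') = of_bool (i = i')) \<and>
    (\<forall>j<m. \<forall>j'<m. (\<Sum>i<m. G j i * K i j') = of_bool (j = j')) \<and>
    (\<forall>i<m. \<forall>j<m. K i j * G j i = real (card {p \<in> P. p i = j}) / real (card P))"
proof -
  define M where "M = mat m m (\<lambda>(i, j). K i j)"
  have M: "M \<in> carrier_mat m m" by (simp add: M_def)
  have fin: "finite {p. p permutes {..<m}}" by (simp add: finite_permutations)
  have finP: "finite P" unfolding P_def using fin by (rule rev_finite_subset) auto
  have zero: "(\<Prod>i<m. K i (p i)) = 0" if "p permutes {..<m}" "p \<notin> P" for p
    using that by (auto simp: P_def)
  have sum_perm: "(\<Sum>p\<in>{p. p permutes {..<m} \<and> Q p}. of_int (sign p) * (\<Prod>i<m. K i (p i)))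
      = c * real (card {p \<in> P. Q p})" for Q
  proof -
    have "(\<Sum>p\<in>{p. p permutes {..<m} \<and> Q p}. of_int (sign p) * (\<Prod>i<m. K i (p i)))
        = (\<Sum>p\<in>{p \<in> P. Q p}. of_int (sign p) * (\<Prod>i<m. K i (p i)))"
    proof (rule sum.mono_neutral_right)
      show "finite {p. p permutes {..<m} \<and> Q p}" using fin by (rule rev_finite_subset) auto
    qed (auto simp: P_def)
    also have "\<dots> = (\<Sum>p\<in>{p \<in> P. Q p}. c)" by (intro sum.cong sgn) auto
    finally show ?thesis by (simp add: mult.commute)
  qed
  have index: "M $$ (i, p i) = K i (p i)" if "p permutes {..<m}" "i < m" for p i
    using permutes_in_image[OF that(1), of i] that(2) by (simp add: M_def)
  have "det M = (\<Sum>p\<in>{p. p permutes {..<m}}. of_int (sign p) * (\<Prod>i<m. M $$ (i, p i)))"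
    by (simp add: det_def'[OF M] lessThan_atLeast0)
  also have "\<dots> = (\<Sum>p\<in>{p. p permutes {..<m} \<and> True}. of_int (sign p) * (\<Prod>i<m. K i (p i)))"
    by (intro sum.cong prod.cong arg_cong2[of _ _ _ _ "(*)"]) (auto simp: index)
  also have "\<dots> = c * real (card P)" using sum_perm[of "\<lambda>_. True"] by simp
  finally have det: "det M = c * real (card P)" .
  have nz: "det M \<noteq> 0" using c P finP by (simp add: det)
  have cof: "K i j * cofactor M i j = c * real (card {p \<in> P. p i = j})" if ij: "i < m" "j < m" for i j
  proof -
    \<comment> \<open>Row \<open>i\<close> is cleared except for its entry \<open>j\<close>. The
      cofactors along this row do not change, and exactly the terms with \<open>p i = j\<close>
      survive.\<close>
    define M' where "M' = mat m m (\<lambda>(k, l). if k = i then if l = j then K i j else 0 else K k l)"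
    have M': "M' \<in> carrier_mat m m" by (simp add: M'_def)
    have "mat_delete M' i l = mat_delete M i l" for l
      by (rule eq_matI) (auto simp: mat_delete_def M_def M'_def)
    then have "det M' = (\<Sum>l<m. M' $$ (i, l) * cofactor M i l)"
      using laplace_expansion_row[OF M' ij(1)] by (simp add: cofactor_def)
    also have "\<dots> = (\<Sum>l<m. if l = j then K i j * cofactor M i j else 0)"
      using ij by (intro sum.cong) (auto simp: M'_def)
    finally have "K i j * cofactor M i j = det M'" using ij by simp
    also have "\<dots> = (\<Sum>p\<in>{p. p permutes {..<m}}. of_int (sign p) * (\<Prod>k<m. M' $$ (k, p k)))"
      by (simp add: det_def'[OF M'] lessThan_atLeast0)
    also have "\<dots> = (\<Sum>p\<in>{p. p permutes {..<m}}.
        if p i = j then of_int (sign p) * (\<Prod>k<m. K k (p k)) else 0)"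
    proof (intro sum.cong refl)
      fix p assume "p \<in> {p. p permutes {..<m}}"
      then have p: "p permutes {..<m}" by simp
      have idx: "M' $$ (k, p k) = (if k = i then if p i = j then K i j else 0 else K k (p k))"
        if "k < m" for k
        using permutes_in_image[OF p, of k] that by (auto simp: M'_def)
      show "of_int (sign p) * (\<Prod>k<m. M' $$ (k, p k))
          = (if p i = j then of_int (sign p) * (\<Prod>k<m. K k (p k)) else 0)"
      proof (cases "p i = j")
        case True
        then have "(\<Prod>k<m. M' $$ (k, p k)) = (\<Prod>k<m. K k (p k))"
          by (intro prod.cong) (auto simp: idx)
        then show ?thesis using True by simp
      next
        case False
        then have "(\<Prod>k<m. M' $$ (k, p k)) = 0"
          using ij idx[of i] by (intro prod_zero) auto
        then show ?thesis using False by simp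
      qed
    qed
    also have "\<dots> = (\<Sum>p\<in>{p. p permutes {..<m} \<and> p i = j}. of_int (sign p) * (\<Prod>k<m. K k (p k)))"
      using fin by (subst sum.inter_filter[symmetric]) (auto intro!: sum.cong)
    finally show ?thesis using sum_perm[of "\<lambda>p. p i = j"] by simp
  qed
  define G where "G j i = adj_mat M $$ (j, i) / det M" for i j
  note adj = adj_mat[OF M]
  have entry: "(X * Y) $$ (i, j) = (\<Sum>k<m. X $$ (i, k) * Y $$ (k, j))"
    if "X \<in> carrier_mat m m" "Y \<in> carrier_mat m m" "i < m" "j < m" for X Y :: "real mat" and i j
    using that by (simp add: scalar_prod_def lessThan_atLeast0)
  show ?thesis
  proof (rule exI[of _ G], intro conjI allI impI)
    fix i i' assume i: "i < m" "i' < m"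
    have "(\<Sum>j<m. K i j * G j i') = (M * adj_mat M) $$ (i, i') / det M"
      using i by (simp add: entry[OF M adj(1)] sum_divide_distrib G_def) (simp add: M_def)
    then show "(\<Sum>j<m. K i j * G j i') = of_bool (i = i')"
      unfolding adj(2) using i nz by auto
  next
    fix j j' assume j: "j < m" "j' < m"
    have "(\<Sum>i<m. G j i * K i j') = (adj_mat M * M) $$ (j, j') / det M"
      using j by (simp add: entry[OF adj(1) M] sum_divide_distrib G_def) (simp add: M_def)
    then show "(\<Sum>i<m. G j i * K i j') = of_bool (j = j')"
      unfolding adj(3) using j nz by auto
  next
    fix i j assume ij: "i < m" "j < m"
    have "G j i = cofactor M i j / det M" using ij M by (simp add: G_def adj_mat_def)
    then have "K i j * G j i = K i j * cofactor M i j / det M" by simp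
    then show "K i j * G j i = real (card {p \<in> P. p i = j}) / real (card P)"
      using c by (simp add: cof[OF ij] det)
  qed
qed

section \<open>Parity of crossings in a tiling\<close>

text \<open>The half-width \<open>N\<close> is kept independent of \<open>n\<close>; it becomes
  \<open>n * L\<close> only when the curve is drawn in the plane.\<close>

definition rect_set :: "nat \<Rightarrow> nat \<Rightarrow> cell set" where
  "rect_set N n = {- int N..int N} \<times> {0..2 * int n}"

lemma rect_set_iff: "c \<in> rect_set N n \<longleftrightarrow>
    - int N \<le> fst c \<and> fst c \<le> int N \<and> 0 \<le> snd c \<and> snd c \<le> 2 * int n"
  by (cases c) (simp add: rect_set_def)

lemma finite_rect_set: "finite (rect_set N n)"
  by (simp add: rect_set_def)

definition cell_up :: "cell \<Rightarrow> cell" where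
  "cell_up c = (fst c, snd c + 1)"

lemma cell_up_sel [simp]: "fst (cell_up c) = fst c" "snd (cell_up c) = snd c + 1"
  by (simp_all add: cell_up_def)

lemma cell_up_eq_iff: "cell_up c = d \<longleftrightarrow> fst c = fst d \<and> snd c + 1 = snd d"
  by (metis cell_up_sel prod.collapse prod.inject cell_up_def)

lemma cell_adjacent_sel_cases:
  assumes "cell_adjacent c d"
  obtains "fst d = fst c + 1" "snd d = snd c" | "fst d = fst c - 1" "snd d = snd c"
    | "d = cell_up c" | "c = cell_up d"
proof -
  have "cell_adjacent (fst c, snd c) (fst d, snd d)" using assms by simp
  then show thesis
    unfolding cell_adjacent_iff using that cell_up_eq_iff[of c d] cell_up_eq_iff[of d c] by smt
qed

definition vertical_bases :: "cell set set \<Rightarrow> cell set" where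
  "vertical_bases T = {c. {c, cell_up c} \<in> T}"

text \<open>Count the cells in the row above \<open>p\<close> and to the left of its column; by
  \<open>rows\<close> none is missing. Those not covered by vertical dominos are paired horizontally
  among themselves, since the cell above \<open>p\<close> is taken by the domino on \<open>p\<close>
  and blocks the right end.\<close>

lemma tiling_row_parity:
  assumes T: "T \<in> domino_tilings S" and S: "S \<subseteq> rect_set N n"
    and rows: "\<And>c. c \<in> rect_set N n \<Longrightarrow> 1 \<le> snd c \<Longrightarrow> c \<in> S"
    and p: "p \<in> vertical_bases T"
  shows "even (card {q \<in> vertical_bases T. snd q = snd p \<and> fst q < fst p}
    + card {q \<in> vertical_bases T. snd q = snd p + 1 \<and> fst q < fst p} + nat (fst p + int N))"
proof -
  define V where "V = vertical_bases T"
  have V: "c \<in> V \<longleftrightarrow> {c, cell_up c} \<in> T" for c by (simp add: V_def vertical_bases_def)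
  have VS: "c \<in> S" "cell_up c \<in> S" "partner T c = cell_up c" "partner T (cell_up c) = c" if "c \<in> V" for c
  proof -
    have e: "{c, cell_up c} \<in> T" using that by (simp add: V)
    show "c \<in> S" "cell_up c \<in> S" using tiling_edgeD[OF T e] by simp_all
    show "partner T c = cell_up c" using partner_eqI[OF T e] .
    show "partner T (cell_up c) = c" using e by (intro partner_eqI[OF T]) (simp add: insert_commute)
  qed
  have pV: "p \<in> V" using p by (simp add: V_def)
  define A where "A = {q \<in> V. snd q = snd p \<and> fst q < fst p}"
  define B where "B = {q \<in> V. snd q = snd p + 1 \<and> fst q < fst p}"
  define R where "R = {- int N..<fst p} \<times> {snd p + 1}"
  have R: "c \<in> R \<longleftrightarrow> - int N \<le> fst c \<and> fst c < fst p \<and> snd c = snd p + 1" for c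
    by (cases c) (auto simp: R_def)
  have pr: "p \<in> rect_set N n" "cell_up p \<in> rect_set N n" using VS[OF pV] S by blast+
  have RS: "c \<in> S" if "c \<in> R" for c
    using that pr rows[of c] by (auto simp: R rect_set_iff)
  have Vr: "- int N \<le> fst c" if "c \<in> S" for c
    using that S by (auto simp: rect_set_iff)
  have finR: "finite R" by (simp add: R_def)
  have BR: "B \<subseteq> R"
  proof
    fix c assume "c \<in> B"
    then show "c \<in> R" using Vr[of c] VS(1)[of c] by (simp add: B_def R)
  qed
  have AR: "cell_up ` A \<subseteq> R"
  proof (rule image_subsetI)
    fix c assume "c \<in> A"
    then show "cell_up c \<in> R" using Vr[of c] VS(1)[of c] by (simp add: A_def R)
  qed
  have up_not: "cell_up c \<notin> V" if "c \<in> V" for c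
  proof
    assume "cell_up c \<in> V"
    then have "cell_up (cell_up c) = c" using VS(3)[of "cell_up c"] VS(4)[OF that] by simp
    then have "snd (cell_up (cell_up c)) = snd c" by simp
    then show False by simp
  qed
  have disj: "B \<inter> cell_up ` A = {}" using up_not by (auto simp: A_def B_def simp del: split_paired_All)
  define H where "H = R - (B \<union> cell_up ` A)"
  have "even (card H)"
  proof (rule even_card_involution[of H "partner T"])
    show "finite H" using finR by (simp add: H_def)
    fix c assume c: "c \<in> H"
    then have cR: "c \<in> R" "c \<notin> B" "c \<notin> cell_up ` A" by (auto simp: H_def)
    note cS = RS[OF cR(1)]
    define d where "d = partner T c"
    have d: "d \<in> S" "cell_adjacent c d" "partner T d = c"
      unfolding d_def using partner_props[OF T cS] by simp_all
    have e: "{c, d} \<in> T" using partner_edge[OF T cS] by (simp add: d_def)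
    have "d \<noteq> cell_up c"
    proof
      assume "d = cell_up c"
      then have "c \<in> B" using e cR(1) by (auto simp: B_def V R)
      then show False using cR by simp
    qed
    moreover have "c \<noteq> cell_up d"
    proof
      assume *: "c = cell_up d"
      then have "d \<in> A" using e cR(1) by (auto simp: A_def V R insert_commute)
      then show False using cR * by simp
    qed
    ultimately have h: "snd d = snd c" "fst d = fst c + 1 \<or> fst d = fst c - 1"
      using d(2) by (auto elim: cell_adjacent_sel_cases)
    have "d \<noteq> cell_up p"
    proof
      assume "d = cell_up p"
      then have "c = p" using d(3) VS(4)[OF pV] by simp
      then show False using cR(1) by (simp add: R)
    qed
    then have "fst d \<noteq> fst p" using h cR(1) cell_up_eq_iff[of p d] by (auto simp: R)
    then have dR: "d \<in> R" using h cR(1) Vr[OF d(1)] by (auto simp: R)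
    have "d \<notin> B"
    proof
      assume "d \<in> B"
      then have "c = cell_up d" using VS(3)[of d] d(3) by (simp add: B_def)
      then show False using h by simp
    qed
    moreover have "d \<notin> cell_up ` A"
    proof
      assume "d \<in> cell_up ` A"
      then obtain q where "q \<in> V" "d = cell_up q" by (auto simp: A_def)
      then have "d = cell_up c" using VS(4)[of q] d(3) by simp
      then show False using h by simp
    qed
    ultimately have "d \<in> H" using dR by (simp add: H_def)
    moreover have "d \<noteq> c" using h by auto
    ultimately show "partner T c \<in> H \<and> partner T (partner T c) = c \<and> partner T c \<noteq> c"
      using d by (simp add: d_def)
  qed
  moreover have "card R = card H + card (B \<union> cell_up ` A)"
    unfolding H_def using finR BR AR
    by (metis Un_subset_iff card_Diff_subset card_mono finite_subset le_add_diff_inverse2)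
  moreover have "card (B \<union> cell_up ` A) = card B + card A"
  proof -
    have "inj_on cell_up A" by (rule inj_onI) (metis add_right_cancel cell_up_sel prod_eqI)
    then have "card (cell_up ` A) = card A" by (rule card_image)
    then show ?thesis
      using card_Un_disjoint[OF finite_subset[OF BR finR] finite_subset[OF AR finR] disj] by simp
  qed
  moreover have "card R = nat (fst p + int N)" by (simp add: R_def card_cartesian_product)
  ultimately show ?thesis unfolding A_def[symmetric] B_def[symmetric] V_def[symmetric] by auto
qed

text \<open>The pairs counted here are the pairs of dominos which cross when they are drawn as arcs over the
  line of all cells in lexicographic order; horizontal dominos cross nothing.\<close>

lemma tiling_crossing_parity:
  assumes T: "T \<in> domino_tilings S" and S: "S \<subseteq> rect_set N n"
    and rows: "\<And>c. c \<in> rect_set N n \<Longrightarrow> 1 \<le> snd c \<Longrightarrow> c \<in> S"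
  defines "V \<equiv> vertical_bases T"
  shows "even (card {pq. fst pq \<in> V \<and> snd pq \<in> V \<and>
      (snd (snd pq) = snd (fst pq) \<and> fst (fst pq) < fst (snd pq) \<or>
       snd (snd pq) = snd (fst pq) + 1 \<and> fst (snd pq) < fst (fst pq))}
    + (\<Sum>p\<in>V. nat (fst p + int N)))"
proof -
  have "V \<subseteq> S" unfolding V_def vertical_bases_def using tiling_edgeD(1)[OF T] by blast
  then have fin: "finite V" using finite_subset[OF _ finite_rect_set] S by blast
  \<comment> \<open>A pair in one row is counted at its right member and a pair in successive rows
    at its lower member, so summing \<open>tiling_row_parity\<close> over \<open>p\<close> counts
    every crossing once.\<close>
  define A where "A p = {q \<in> V. snd q = snd p \<and> fst q < fst p}" for p
  define B where "B p = {q \<in> V. snd q = snd p + 1 \<and> fst q < fst p}" for p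
  have finAB: "finite (A p)" "finite (B p)" for p using fin by (simp_all add: A_def B_def)
  have "{pq. fst pq \<in> V \<and> snd pq \<in> V \<and>
      (snd (snd pq) = snd (fst pq) \<and> fst (fst pq) < fst (snd pq) \<or>
       snd (snd pq) = snd (fst pq) + 1 \<and> fst (snd pq) < fst (fst pq))}
    = prod.swap ` Sigma V A \<union> Sigma V B" (is "?L = _")
  proof (intro equalityI subsetI)
    fix pq assume "pq \<in> ?L"
    then show "pq \<in> prod.swap ` Sigma V A \<union> Sigma V B"
      by (cases pq) (force simp: A_def B_def image_iff)
  next
    fix pq assume "pq \<in> prod.swap ` Sigma V A \<union> Sigma V B"
    then show "pq \<in> ?L" unfolding A_def B_def by auto
  qed
  moreover have "prod.swap ` Sigma V A \<inter> Sigma V B = {}"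
    unfolding A_def B_def by auto
  ultimately have "card ?L = card (prod.swap ` Sigma V A) + card (Sigma V B)"
    using fin finAB by (simp add: card_Un_disjoint)
  also have "card (prod.swap ` Sigma V A) = card (Sigma V A)"
    by (rule card_image[OF inj_on_subset[OF inj_swap subset_UNIV]])
  also have "card (Sigma V A) + card (Sigma V B) = (\<Sum>p\<in>V. card (A p) + card (B p))"
    using fin finAB by (simp add: card_SigmaI sum.distrib)
  finally have "card ?L + (\<Sum>p\<in>V. nat (fst p + int N))
      = (\<Sum>p\<in>V. card (A p) + card (B p) + nat (fst p + int N))"
    by (simp add: sum.distrib)
  moreover have "even \<dots>"
    unfolding A_def B_def V_def
    by (intro dvd_sum tiling_row_parity[OF T S rows])
  ultimately show ?thesis by simp
qed

definition row_pos :: "nat \<Rightarrow> cell \<Rightarrow> int" where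
  "row_pos N c = snd c * (2 * int N + 1) + fst c"

definition pos_sgn :: "nat \<Rightarrow> cell \<Rightarrow> cell \<Rightarrow> real" where
  "pos_sgn N c d = sgn (real_of_int (row_pos N d) - real_of_int (row_pos N c))"

text \<open>The factor \<open>pos_sgn\<close> turns the sign of a permutation into the crossing sign of the
  matching, which is the parity of the column numbers of its vertical dominos.\<close>

definition kast :: "nat \<Rightarrow> cell \<Rightarrow> cell \<Rightarrow> real" where
  "kast N e a = (if cell_adjacent e a
     then pos_sgn N e a * (if fst e = fst a then (- 1) ^ nat (fst a + int N) else 1) else 0)"

section \<open>Kasteleyn signs from crossings\<close>

lemma row_pos_less_iff:
  assumes "c \<in> rect_set N n" "d \<in> rect_set N n"
  shows "row_pos N c < row_pos N d \<longleftrightarrow> snd c < snd d \<or> snd c = snd d \<and> fst c < fst d"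
proof -
  define W where "W = 2 * int N + 1"
  have x: "\<bar>fst c - fst d\<bar> < W" using assms by (auto simp: rect_set_iff W_def)
  have W: "W > 0" by (simp add: W_def)
  have lt: "a * W + u < b * W + v" if "a < b" "\<bar>u - v\<bar> < W" for a b u v
  proof -
    have "(a + 1) * W \<le> b * W" using that W by (intro mult_right_mono) auto
    then show ?thesis using that by (simp add: algebra_simps)
  qed
  show ?thesis
    using lt[of "snd c" "snd d" "fst c" "fst d"] lt[of "snd d" "snd c" "fst d" "fst c"] x
    unfolding row_pos_def W_def[symmetric]
    by (cases "snd c" "snd d" rule: linorder_cases) (auto simp: abs_minus_commute)
qed

lemma inj_on_row_pos: "inj_on (row_pos N) (rect_set N n)"
proof (rule inj_onI)
  fix c d assume *: "c \<in> rect_set N n" "d \<in> rect_set N n" "row_pos N c = row_pos N d"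
  have "\<not> row_pos N c < row_pos N d" "\<not> row_pos N d < row_pos N c" using *(3) by simp_all
  then have "snd c = snd d" "fst c = fst d"
    unfolding row_pos_less_iff[OF *(1,2)] row_pos_less_iff[OF *(2,1)] by (smt (verit))+
  then show "c = d" by (rule prod_eqI[rotated])
qed

lemma pos_sgn_antisym: "pos_sgn N c d = - pos_sgn N d c"
  by (simp add: pos_sgn_def sgn_minus[symmetric])

text \<open>Exchanging the two ends of one arc only permutes the four factors, so the product
  depends on the arcs alone. The factors with the leftmost end are 1; the other two compare
  \<open>max e a\<close> with both ends of the second arc and disagree exactly when the arcs
  cross.\<close>

lemma arcs_cross_sign:
  fixes e a e' a' :: real
  assumes "e \<noteq> a" "e' \<noteq> a'" "e \<noteq> e'" "e \<noteq> a'" "a \<noteq> e'" "a \<noteq> a'" "min e a < min e' a'"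
  shows "sgn (e' - e) * sgn (a' - a) * sgn (a' - e) * sgn (e' - a)
    = (if min e' a' < max e a \<and> max e a < max e' a' then - 1 else 1)"
  using assms
  by (cases "e < a"; cases "e' < a'"; cases "e < e'"; cases "a < a'") (auto simp: sgn_if min_def max_def)

lemma prod_square_split:
  fixes f :: "nat \<Rightarrow> nat \<Rightarrow> 'a::comm_monoid_mult"
  shows "(\<Prod>i<m. \<Prod>j<m. f i j) = (\<Prod>(i, j)\<in>key_pairs (\<lambda>i. i) {..<m}. f i j * f j i) * (\<Prod>i<m. f i i)"
proof -
  let ?P = "key_pairs (\<lambda>i::nat. i) {..<m}"
  have fin: "finite ?P" by (simp add: finite_key_pairs)
  have "{..<m} \<times> {..<m} = (?P \<union> prod.swap ` ?P) \<union> (\<lambda>i. (i, i)) ` {..<m}"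
    by (auto simp: key_pairs_def image_iff)
  moreover have "(?P \<union> prod.swap ` ?P) \<inter> (\<lambda>i. (i, i)) ` {..<m} = {}" "?P \<inter> prod.swap ` ?P = {}"
    by (auto simp: key_pairs_def)
  ultimately have "(\<Prod>(i, j)\<in>{..<m} \<times> {..<m}. f i j)
      = (\<Prod>(i, j)\<in>?P. f i j) * (\<Prod>(i, j)\<in>prod.swap ` ?P. f i j) * (\<Prod>(i, j)\<in>(\<lambda>i. (i, i)) ` {..<m}. f i j)"
    using fin by (simp add: prod.union_disjoint)
  also have "(\<Prod>(i, j)\<in>prod.swap ` ?P. f i j) = (\<Prod>(i, j)\<in>?P. f j i)"
    by (subst prod.reindex) (auto intro: inj_on_subset[OF inj_swap] simp: case_prod_beta)
  also have "(\<Prod>(i, j)\<in>(\<lambda>i. (i, i)) ` {..<m}. f i j) = (\<Prod>i<m. f i i)"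
    by (subst prod.reindex) (auto simp: inj_on_def)
  finally show ?thesis
    by (simp add: prod.cartesian_product prod.distrib case_prod_beta)
qed

lemma tiling_of_pairing:
  fixes ee a :: "nat \<Rightarrow> cell"
  assumes e: "inj_on ee {..<m}" and a: "inj_on a {..<m}"
    and dis: "ee ` {..<m} \<inter> a ` {..<m} = {}"
    and adj: "\<And>i. i < m \<Longrightarrow> cell_adjacent (ee i) (a i)"
  shows "(\<lambda>i. {ee i, a i}) ` {..<m} \<in> domino_tilings (ee ` {..<m} \<union> a ` {..<m})"
proof -
  have "disjoint ((\<lambda>i. {ee i, a i}) ` {..<m})"
    unfolding disjoint_def pairwise_def disjnt_def
  proof (intro ballI impI)
    fix D D' assume "D \<in> (\<lambda>i. {ee i, a i}) ` {..<m}" "D' \<in> (\<lambda>i. {ee i, a i}) ` {..<m}" "D \<noteq> D'"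
    then obtain i j where ij: "i < m" "j < m" "D = {ee i, a i}" "D' = {ee j, a j}" "i \<noteq> j" by blast
    have "ee i \<noteq> ee j" "a i \<noteq> a j" "ee i \<noteq> a j" "a i \<noteq> ee j"
      using ij inj_onD[OF e, of i j] inj_onD[OF a, of i j] dis by (simp, simp, blast+)
    then show "D \<inter> D' = {}" using ij by simp
  qed
  then have "partition_on (ee ` {..<m} \<union> a ` {..<m}) ((\<lambda>i. {ee i, a i}) ` {..<m})"
    unfolding partition_on_def by blast
  then show ?thesis unfolding domino_tilings_def is_domino_def using adj by blast
qed

text \<open>A horizontal domino joins consecutive positions, so its arc cannot cross another one;
  all vertical arcs have the same length, so their crossings can be read off their lower
  cells.\<close>

lemma horizontal_or_vertical:
  assumes "cell_adjacent c d" "row_pos N c < row_pos N d"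
  shows "fst c = fst d \<and> d = cell_up c \<and> row_pos N d = row_pos N c + (2 * int N + 1) \<or>
    fst c \<noteq> fst d \<and> row_pos N d = row_pos N c + 1"
  using assms(1)
proof (cases rule: cell_adjacent_sel_cases)
  case 1
  then show ?thesis by (simp add: row_pos_def)
next
  case 2
  then show ?thesis using assms(2) by (simp add: row_pos_def)
next
  case 3
  then show ?thesis by (simp add: row_pos_def algebra_simps)
next
  case 4
  then show ?thesis using assms(2) by (simp add: row_pos_def algebra_simps)
qed

text \<open>Each \<open>t i j\<close> is the crossing sign of two arcs. Only vertical dominos cross,
  and \<open>tiling_crossing_parity\<close> trades the number of their crossings for the sum of
  their column numbers.\<close>

lemma pairing_crossing_sign:
  fixes ee a :: "nat \<Rightarrow> cell"
  assumes e: "inj_on ee {..<m}" and a: "inj_on a {..<m}"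
    and dis: "ee ` {..<m} \<inter> a ` {..<m} = {}"
    and adj: "\<And>i. i < m \<Longrightarrow> cell_adjacent (ee i) (a i)"
    and S: "ee ` {..<m} \<union> a ` {..<m} = S" "S \<subseteq> rect_set N n"
    and rows: "\<And>c. c \<in> rect_set N n \<Longrightarrow> 1 \<le> snd c \<Longrightarrow> c \<in> S"
  defines "t \<equiv> \<lambda>i j. pos_sgn N (ee i) (ee j) * pos_sgn N (a i) (a j) * pos_sgn N (ee i) (a j) * pos_sgn N (a i) (ee j)"
  shows "(\<Prod>(i, j)\<in>key_pairs (\<lambda>i. i) {..<m}. t i j)
    = (\<Prod>i<m. if fst (ee i) = fst (a i) then (- 1) ^ nat (fst (a i) + int N) else 1)"
proof -
  define T where "T = (\<lambda>i. {ee i, a i}) ` {..<m}"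
  have T: "T \<in> domino_tilings S" unfolding T_def S(1)[symmetric] by (rule tiling_of_pairing[OF e a dis adj])
  define V where "V = vertical_bases T"
  let ?p = "row_pos N"
  define low where "low i = (if ?p (ee i) < ?p (a i) then ee i else a i)" for i
  define high where "high i = (if ?p (ee i) < ?p (a i) then a i else ee i)" for i
  define vert where "vert i \<longleftrightarrow> fst (ee i) = fst (a i)" for i
  have inS: "ee i \<in> S" "a i \<in> S" if "i < m" for i using that S(1) by blast+
  have pos_eq: "?p c = ?p d \<longleftrightarrow> c = d" if "c \<in> S" "d \<in> S" for c d
    using inj_on_row_pos[of N n] S(2) that by (meson inj_onD subsetD)
  have neq: "ee i \<noteq> a j" if "i < m" "j < m" for i j using dis that by blast
  have eeq: "ee i = ee j \<longleftrightarrow> i = j" if "i < m" "j < m" for i j using e that by (auto dest: inj_onD)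
  have aeq: "a i = a j \<longleftrightarrow> i = j" if "i < m" "j < m" for i j using a that by (auto dest: inj_onD)
  have lowS: "low i \<in> S" "high i \<in> S" if "i < m" for i using inS[OF that] by (simp_all add: low_def high_def)
  have pos_low: "?p (low i) = min (?p (ee i)) (?p (a i))" "?p (high i) = max (?p (ee i)) (?p (a i))" for i
    by (simp_all add: low_def high_def)
  have low_high: "?p (low i) < ?p (high i)" "cell_adjacent (low i) (high i)" "{low i, high i} = {ee i, a i}" if "i < m" for i
    using pos_eq[OF inS[OF that]] neq[OF that that] adj[OF that] cell_adjacent_sym[of "a i" "ee i"]
    by (auto simp: low_def high_def)
  have vert_low: "vert i \<longleftrightarrow> fst (low i) = fst (high i)" for i
    by (auto simp: vert_def low_def high_def)
  have hv: "vert i \<and> high i = cell_up (low i) \<and> ?p (high i) = ?p (low i) + (2 * int N + 1) \<or>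
      \<not> vert i \<and> ?p (high i) = ?p (low i) + 1" if "i < m" for i
    using horizontal_or_vertical[OF low_high(2,1)[OF that]] unfolding vert_low .
  have low_inj: "i = j" if "i < m" "j < m" "low i = low j" for i j
    using that eeq[of i j] aeq[of i j] neq[of i j] neq[of j i] by (auto simp: low_def split: if_splits)
  have t_eq: "t i j = (if ?p (low j) < ?p (high i) \<and> ?p (high i) < ?p (high j) then - 1 else 1)"
    if ij: "i < m" "j < m" "?p (low i) < ?p (low j)" for i j
  proof -
    have ne: "i \<noteq> j" using ij by auto
    have p: "?p (ee i) \<noteq> ?p (a i)" "?p (ee j) \<noteq> ?p (a j)" "?p (ee i) \<noteq> ?p (ee j)"
      "?p (ee i) \<noteq> ?p (a j)" "?p (a i) \<noteq> ?p (ee j)" "?p (a i) \<noteq> ?p (a j)"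
      using ij(1,2) ne neq[OF ij(2,1), symmetric] by (simp_all add: pos_eq inS neq eeq aeq)
    show ?thesis
      unfolding t_def pos_sgn_def pos_low
      using arcs_cross_sign[of "?p (ee i)" "?p (a i)" "?p (ee j)" "?p (a j)"] p ij(3)
      unfolding pos_low of_int_eq_iff of_int_min[symmetric] of_int_max[symmetric] of_int_less_iff
      by simp
  qed
  have t_sym: "t i j = t j i" for i j
    unfolding t_def
    using pos_sgn_antisym[of N "ee i" "ee j"] pos_sgn_antisym[of N "a i" "a j"]
      pos_sgn_antisym[of N "ee i" "a j"] pos_sgn_antisym[of N "a i" "ee j"] by simp
  have inj: "inj_on (\<lambda>i. ?p (low i)) {..<m}"
    by (rule inj_onI) (use low_inj pos_eq lowS in auto)
  have low_V: "low ` {i. i < m \<and> vert i} = V"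
  proof (intro equalityI subsetI)
    fix c assume "c \<in> low ` {i. i < m \<and> vert i}"
    then obtain i where i: "i < m" "vert i" "c = low i" by blast
    then have "{c, cell_up c} = {ee i, a i}" using hv[OF i(1)] low_high(3)[OF i(1)] by simp
    then show "c \<in> V" using i(1) by (simp add: V_def vertical_bases_def T_def)
  next
    fix c assume "c \<in> V"
    then obtain i where i: "i < m" "{c, cell_up c} = {low i, high i}"
      using low_high(3) unfolding V_def vertical_bases_def T_def by auto
    have "?p c < ?p (cell_up c)" by (simp add: row_pos_def algebra_simps)
    then have "c = low i" "cell_up c = high i"
      using i(2) low_high(1)[OF i(1)] by (auto simp: doubleton_eq_iff)
    then show "c \<in> low ` {i. i < m \<and> vert i}" using i(1) vert_low[of i] cell_up_sel(1)[of c] by auto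
  qed
  have low_inj_on: "inj_on low {i. i < m \<and> vert i}" by (rule inj_onI) (use low_inj in auto)
  define crossing :: "cell \<Rightarrow> cell \<Rightarrow> bool" where
    "crossing p q \<longleftrightarrow> snd q = snd p \<and> fst p < fst q \<or> snd q = snd p + 1 \<and> fst q < fst p" for p q
  have cross_iff: "?p (low i) < ?p (low j) \<and> ?p (low j) < ?p (high i) \<and> ?p (high i) < ?p (high j)
      \<longleftrightarrow> vert i \<and> vert j \<and> crossing (low i) (low j)" if ij: "i < m" "j < m" for i j
  proof -
    have R: "low i \<in> rect_set N n" "low j \<in> rect_set N n" "high i \<in> rect_set N n"
      using lowS ij S(2) by blast+
    show ?thesis
    proof (cases "vert i \<and> vert j")
      case True
      then have h: "high i = cell_up (low i)" "?p (high i) = ?p (low i) + (2 * int N + 1)"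
        "?p (high j) = ?p (low j) + (2 * int N + 1)" using hv[OF ij(1)] hv[OF ij(2)] by auto
      have "?p (low j) < ?p (high i) \<longleftrightarrow> snd (low j) < snd (low i) + 1 \<or> snd (low j) = snd (low i) + 1 \<and> fst (low j) < fst (low i)"
        unfolding row_pos_less_iff[OF R(2,3)] unfolding h(1) by simp
      moreover have "?p (high i) < ?p (high j) \<longleftrightarrow> ?p (low i) < ?p (low j)" using h by simp
      ultimately show ?thesis
        using True row_pos_less_iff[OF R(1,2)] unfolding crossing_def by (smt (verit))
    next
      case False
      then show ?thesis using hv[OF ij(1)] hv[OF ij(2)] by linarith
    qed
  qed
  let ?cr = "\<lambda>i j. ?p (low j) < ?p (high i) \<and> ?p (high i) < ?p (high j)"
  let ?K = "key_pairs (\<lambda>i. ?p (low i)) {..<m}"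
  \<comment> \<open>Sorting the dominos by their first cell brings every pair into the situation of
    \<open>arcs_cross_sign\<close>.\<close>
  have "(\<Prod>(i, j)\<in>key_pairs (\<lambda>i. i) {..<m}. t i j) = (\<Prod>(i, j)\<in>?K. t i j)"
    by (rule prod_key_pairs_cong_key[OF _ inj t_sym]) simp
  also have "\<dots> = (\<Prod>x\<in>?K. if ?cr (fst x) (snd x) then - 1 else 1)"
    by (intro prod.cong refl) (auto simp: key_pairs_def t_eq)
  also have "\<dots> = (- 1) ^ card {x \<in> ?K. ?cr (fst x) (snd x)}"
    by (intro prod_if_minus_one finite_key_pairs) simp
  also have "card {x \<in> ?K. ?cr (fst x) (snd x)} = card {pq. fst pq \<in> V \<and> snd pq \<in> V \<and>
      (snd (snd pq) = snd (fst pq) \<and> fst (fst pq) < fst (snd pq) \<or>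
       snd (snd pq) = snd (fst pq) + 1 \<and> fst (snd pq) < fst (fst pq))}" (is "card ?X = card ?Y")
  proof -
    have X: "?X = {ij. fst ij < m \<and> snd ij < m \<and> vert (fst ij) \<and> vert (snd ij) \<and> crossing (low (fst ij)) (low (snd ij))}"
    proof (rule Set.set_eqI)
      fix x
      have "x \<in> ?X \<longleftrightarrow> fst x < m \<and> snd x < m \<and> (?p (low (fst x)) < ?p (low (snd x)) \<and>
          ?p (low (snd x)) < ?p (high (fst x)) \<and> ?p (high (fst x)) < ?p (high (snd x)))"
        by (cases x) (simp add: key_pairs_def)
      then show "x \<in> ?X \<longleftrightarrow> x \<in> {ij. fst ij < m \<and> snd ij < m \<and> vert (fst ij) \<and> vert (snd ij) \<and> crossing (low (fst ij)) (low (snd ij))}"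
        using cross_iff[of "fst x" "snd x"] by blast
    qed
    have eq: "map_prod low low ` ?X = ?Y"
    proof (intro equalityI subsetI)
      fix x assume "x \<in> map_prod low low ` ?X"
      then obtain ij where ij: "ij \<in> ?X" "x = map_prod low low ij" by (rule imageE)
      have "fst x = low (fst ij)" "snd x = low (snd ij)" by (simp_all add: ij(2))
      moreover have "low (fst ij) \<in> V" "low (snd ij) \<in> V" "crossing (low (fst ij)) (low (snd ij))"
        using ij(1) unfolding X using low_V by blast+
      ultimately show "x \<in> ?Y" unfolding crossing_def by simp
    next
      fix x assume "x \<in> ?Y"
      then have x: "fst x \<in> V" "snd x \<in> V" "crossing (fst x) (snd x)"
        unfolding crossing_def by blast+
      obtain i where i: "i < m" "vert i" "fst x = low i" using x(1) low_V by blast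
      obtain j where j: "j < m" "vert j" "snd x = low j" using x(2) low_V by blast
      have "(i, j) \<in> ?X" unfolding X using i j x(3) by simp
      moreover have "x = map_prod low low (i, j)" using i j by (simp add: prod_eq_iff)
      ultimately show "x \<in> map_prod low low ` ?X" by blast
    qed
    have inj_X: "inj_on (map_prod low low) ?X"
      unfolding X by (rule inj_onI) (simp add: prod_eq_iff low_inj)
    show ?thesis using card_image[OF inj_X, unfolded eq] by (rule sym)
  qed
  finally have 1: "(\<Prod>(i, j)\<in>key_pairs (\<lambda>i. i) {..<m}. t i j) = (- 1) ^ card ?Y" .
  have "(\<Prod>i<m. if fst (ee i) = fst (a i) then (- 1) ^ nat (fst (a i) + int N) else (1::real))
      = (\<Prod>i\<in>{i. i < m \<and> vert i}. (- 1) ^ nat (fst (a i) + int N))"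
    by (intro prod.mono_neutral_cong_right) (auto simp: vert_def)
  also have "\<dots> = (- 1) ^ (\<Sum>i\<in>{i. i < m \<and> vert i}. nat (fst (low i) + int N))"
    by (subst power_sum) (intro prod.cong refl, auto simp: low_def vert_def)
  also have "(\<Sum>i\<in>{i. i < m \<and> vert i}. nat (fst (low i) + int N)) = (\<Sum>p\<in>V. nat (fst p + int N))"
    unfolding low_V[symmetric] by (simp add: sum.reindex[OF low_inj_on])
  finally have 2: "(\<Prod>i<m. if fst (ee i) = fst (a i) then (- 1) ^ nat (fst (a i) + int N) else (1::real))
      = (- 1) ^ (\<Sum>p\<in>V. nat (fst p + int N))" .
  have "even (card ?Y + (\<Sum>p\<in>V. nat (fst p + int N)))"
    unfolding V_def by (rule tiling_crossing_parity[OF T S(2) rows])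
  then show ?thesis unfolding 1 2 by (simp add: minus_one_power_iff)
qed

text \<open>The chequerboard colour, normalised so that the left corner is even; the right corner is
  then even as well, so both polyominoes lack a cell of the same colour.\<close>

definition even_cell :: "nat \<Rightarrow> cell \<Rightarrow> bool" where
  "even_cell N c \<longleftrightarrow> even (fst c + snd c + int N)"

lemma even_cell_adjacent: "cell_adjacent c d \<Longrightarrow> even_cell N d \<longleftrightarrow> \<not> even_cell N c"
  by (erule cell_adjacent_sel_cases) (auto simp: even_cell_def)

lemma pos_sgn_nonzero:
  assumes "c \<in> rect_set N n" "d \<in> rect_set N n" "c \<noteq> d"
  shows "pos_sgn N c d \<noteq> 0"
proof -
  have "row_pos N c \<noteq> row_pos N d" using inj_onD[OF inj_on_row_pos _ assms(1,2)] assms(3) by blast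
  then show ?thesis by (simp add: pos_sgn_def sgn_0_0)
qed

text \<open>Kasteleyn's theorem for these weights. In the crossing product of a matching the orders
  within one colour give constants and the sign of \<open>p\<close>; the orders between the colours
  give, apart from matched pairs, a product over all pairs that does not depend on \<open>p\<close>.
  The matched pairs are the order signs in \<open>kast\<close>, and the crossing parity is the
  product of its column signs.\<close>

lemma kast_sign_constant:
  fixes ee aa :: "nat \<Rightarrow> cell"
  assumes e: "inj_on ee {..<m}" and a: "inj_on aa {..<m}"
    and dis: "ee ` {..<m} \<inter> aa ` {..<m} = {}"
    and S: "ee ` {..<m} \<union> aa ` {..<m} = S" "S \<subseteq> rect_set N n"
    and rows: "\<And>c. c \<in> rect_set N n \<Longrightarrow> 1 \<le> snd c \<Longrightarrow> c \<in> S"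
  shows "\<exists>c :: real. c \<noteq> 0 \<and>
    (\<forall>p. p permutes {..<m} \<and> (\<forall>i<m. cell_adjacent (ee i) (aa (p i))) \<longrightarrow>
       of_int (sign p) * (\<Prod>i<m. kast N (ee i) (aa (p i))) = c)"
proof -
  let ?P = "key_pairs (\<lambda>i::nat. i) {..<m}"
  let ?s = "pos_sgn N"
  have finP: "finite ?P" by (simp add: finite_key_pairs)
  have R: "ee i \<in> rect_set N n" "aa i \<in> rect_set N n" if "i < m" for i using that S by blast+
  have s_ee: "?s (ee i) (ee j) \<noteq> 0" if "i < m" "j < m" "i \<noteq> j" for i j
    using pos_sgn_nonzero[OF R(1)[OF that(1)] R(1)[OF that(2)]] inj_onD[OF e, of i j] that by blast
  have s_aa: "?s (aa i) (aa j) \<noteq> 0" if "i < m" "j < m" "i \<noteq> j" for i j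
    using pos_sgn_nonzero[OF R(2)[OF that(1)] R(2)[OF that(2)]] inj_onD[OF a, of i j] that by blast
  have s_ea: "?s (ee i) (aa j) \<noteq> 0" if "i < m" "j < m" for i j
    using pos_sgn_nonzero[OF R(1)[OF that(1)] R(2)[OF that(2)]] dis that by blast
  \<comment> \<open>The factors of the constant: the orders within either colour, one sign per pair
    from antisymmetry, and all orders between the two colours.\<close>
  define c1 where "c1 = (\<Prod>(i, j)\<in>?P. ?s (ee i) (ee j))"
  define c2 where "c2 = (\<Prod>(i, j)\<in>?P. ?s (aa i) (aa j))"
  define c3 where "c3 = (\<Prod>(i, j)\<in>?P. - 1 :: real)"
  define c4 where "c4 = (\<Prod>i<m. \<Prod>j<m. ?s (ee i) (aa j))"
  have c: "c1 \<noteq> 0" "c2 \<noteq> 0" "c3 \<noteq> 0" "c4 \<noteq> 0"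
    unfolding c1_def c2_def c3_def c4_def using finP s_ee s_aa s_ea
    by (auto simp: key_pairs_def prod_zero_iff)
  show ?thesis
  proof (rule exI[of _ "c1 * c2 * c3 * c4"], intro conjI allI impI)
    show "c1 * c2 * c3 * c4 \<noteq> 0" using c by simp
    fix p assume "p permutes {..<m} \<and> (\<forall>i<m. cell_adjacent (ee i) (aa (p i)))"
    then have p: "p permutes {..<m}" and adj: "\<And>i. i < m \<Longrightarrow> cell_adjacent (ee i) (aa (p i))" by blast+
    define b where "b i = aa (p i)" for i
    have pm: "p i < m" if "i < m" for i using permutes_in_image[OF p, of i] that by simp
    have pbij: "bij_betw p {..<m} {..<m}" using p by (rule permutes_imp_bij)
    have b_inj: "inj_on b {..<m}" unfolding b_def
      using a pbij by (metis (no_types, lifting) bij_betw_def comp_inj_on inj_on_cong comp_apply)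
    have b_im: "b ` {..<m} = aa ` {..<m}"
      unfolding b_def using pbij by (metis bij_betw_def image_image)
    define v where "v = (\<Prod>i<m. if fst (ee i) = fst (b i) then (- 1) ^ nat (fst (b i) + int N) else (1::real))"
    define D where "D = (\<Prod>i<m. ?s (ee i) (b i))"
    define Y where "Y = (\<Prod>(i, j)\<in>?P. ?s (ee i) (b j) * ?s (ee j) (b i))"
    have cross: "(\<Prod>(i, j)\<in>?P. ?s (ee i) (ee j) * ?s (b i) (b j) * ?s (ee i) (b j) * ?s (b i) (ee j)) = v"
      unfolding v_def
      by (rule pairing_crossing_sign[OF e b_inj _ _ _ S(2) rows])
        (use adj dis S(1) b_im in \<open>simp_all add: b_def\<close>)
    have neg: "?s (b i) (ee j) = - ?s (ee j) (b i)" for i j by (rule pos_sgn_antisym)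
    have "(\<Prod>(i, j)\<in>?P. ?s (ee i) (ee j) * ?s (b i) (b j) * ?s (ee i) (b j) * ?s (b i) (ee j))
        = (\<Prod>(i, j)\<in>?P. ?s (ee i) (ee j) * ?s (b i) (b j) * (- 1) * (?s (ee i) (b j) * ?s (ee j) (b i)))"
      unfolding neg by (intro prod.cong refl) (simp add: case_prod_unfold)
    also have "\<dots> = c1 * (\<Prod>(i, j)\<in>?P. ?s (b i) (b j)) * c3 * Y"
      unfolding c1_def c3_def Y_def by (simp only: case_prod_unfold prod.distrib)
    also have "(\<Prod>(i, j)\<in>?P. ?s (b i) (b j)) = of_int (sign p) * c2"
      unfolding b_def c2_def by (rule prod_key_pairs_sign[OF p pos_sgn_antisym])
    finally have v: "v = c1 * (of_int (sign p) * c2) * c3 * Y" using cross by simp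
    have "(\<Prod>j<m. ?s (ee i) (b j)) = (\<Prod>j<m. ?s (ee i) (aa j))" for i
      unfolding b_def by (rule prod.reindex_bij_betw[OF pbij])
    then have "c4 = (\<Prod>i<m. \<Prod>j<m. ?s (ee i) (b j))"
      by (simp add: c4_def)
    also have "\<dots> = Y * D" unfolding Y_def D_def by (rule prod_square_split)
    finally have c4: "c4 = Y * D" .
    have "(\<Prod>i<m. kast N (ee i) (aa (p i))) = D * v"
      unfolding D_def v_def prod.distrib[symmetric] using adj
      by (intro prod.cong) (simp_all add: kast_def b_def)
    then have "of_int (sign p) * (\<Prod>i<m. kast N (ee i) (aa (p i)))
        = (of_int (sign p) * of_int (sign p)) * (c1 * c2 * c3 * c4)"
      unfolding v c4 by (simp add: mult_ac)
    also have "of_int (sign p) * of_int (sign p) = (1::real)"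
      by (metis of_int_1 of_int_mult sign_idempotent)
    finally show "of_int (sign p) * (\<Prod>i<m. kast N (ee i) (aa (p i))) = c1 * c2 * c3 * c4" by simp
  qed
qed

section \<open>From permutations to tilings and edge probabilities\<close>

text \<open>Adjacent cells have opposite colours, so a tiling matches the odd cells with the even
  cells, which after numbering both classes is a permutation.\<close>

lemma bij_betw_tilings:
  fixes ee aa :: "nat \<Rightarrow> cell"
  assumes e: "bij_betw ee {..<m} {c \<in> S. \<not> even_cell N c}" and a: "bij_betw aa {..<m} {c \<in> S. even_cell N c}"
  defines "P \<equiv> {p. p permutes {..<m} \<and> (\<forall>i<m. cell_adjacent (ee i) (aa (p i)))}"
    and "\<Phi> \<equiv> \<lambda>p. (\<lambda>i. {ee i, aa (p i)}) ` {..<m}"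
  shows "bij_betw \<Phi> P (domino_tilings S)"
    and "\<And>p i j. p \<in> P \<Longrightarrow> i < m \<Longrightarrow> j < m \<Longrightarrow> {ee i, aa j} \<in> \<Phi> p \<longleftrightarrow> p i = j"
proof -
  have ee: "ee i \<in> S" "\<not> even_cell N (ee i)" if "i < m" for i using bij_betwE[OF e] that by auto
  have aa: "aa i \<in> S" "even_cell N (aa i)" if "i < m" for i using bij_betwE[OF a] that by auto
  have ne: "ee i \<noteq> aa j" if "i < m" "j < m" for i j using ee(2)[OF that(1)] aa(2)[OF that(2)] by metis
  have eeq: "ee i = ee j \<longleftrightarrow> i = j" if "i < m" "j < m" for i j using bij_betw_imp_inj_on[OF e] that by (auto dest: inj_onD)
  have aeq: "aa i = aa j \<longleftrightarrow> i = j" if "i < m" "j < m" for i j using bij_betw_imp_inj_on[OF a] that by (auto dest: inj_onD)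
  have Pm: "p i < m" if "p \<in> P" "i < m" for p i
    using permutes_in_image[of p "{..<m}" i] that by (simp add: P_def)
  have mem: "{ee i, aa j} \<in> \<Phi> p \<longleftrightarrow> p i = j" if "p \<in> P" "i < m" "j < m" for p i j
  proof
    assume "{ee i, aa j} \<in> \<Phi> p"
    then obtain k where k: "k < m" "{ee i, aa j} = {ee k, aa (p k)}" unfolding \<Phi>_def by blast
    have "ee i = ee k" "aa j = aa (p k)"
      using k(2) ne[OF that(2) Pm[OF that(1) k(1)]] unfolding doubleton_eq_iff by metis+
    then show "p i = j" using eeq[OF that(2) k(1)] aeq[OF that(3) Pm[OF that(1) k(1)]] by simp
  qed (use that in \<open>unfold \<Phi>_def, blast\<close>)
  show "\<And>p i j. p \<in> P \<Longrightarrow> i < m \<Longrightarrow> j < m \<Longrightarrow> {ee i, aa j} \<in> \<Phi> p \<longleftrightarrow> p i = j" by (rule mem)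
  show "bij_betw \<Phi> P (domino_tilings S)"
    unfolding bij_betw_def
  proof
    show "inj_on \<Phi> P"
    proof (rule inj_onI)
      fix p q assume pq: "p \<in> P" "q \<in> P" "\<Phi> p = \<Phi> q"
      show "p = q"
      proof
        fix i
        show "p i = q i"
        proof (cases "i < m")
          case True
          then show ?thesis using mem[OF pq(1) True Pm[OF pq(1) True]] mem[OF pq(2) True Pm[OF pq(1) True]] pq(3) by simp
        next
          case False
          have "p permutes {..<m}" "q permutes {..<m}" using pq by (simp_all add: P_def)
          then show ?thesis using False permutes_not_in[of p "{..<m}" i] permutes_not_in[of q "{..<m}" i] by simp
        qed
      qed
    qed
    show "\<Phi> ` P = domino_tilings S"
    proof (intro equalityI subsetI)
      fix T assume "T \<in> \<Phi> ` P"
      then obtain p where p: "p \<in> P" "T = \<Phi> p" by blast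
      have pp: "p permutes {..<m}" "\<And>i. i < m \<Longrightarrow> cell_adjacent (ee i) (aa (p i))" using p(1) by (simp_all add: P_def)
      have im: "(\<lambda>i. aa (p i)) ` {..<m} = aa ` {..<m}"
        using permutes_image[OF pp(1)] by (metis image_image)
      have class_disj: "{c \<in> S. \<not> even_cell N c} \<inter> {c \<in> S. even_cell N c} = {}" by fast
      have p_inj: "inj_on (\<lambda>i. aa (p i)) {..<m}"
        by (rule inj_onI) (use aeq Pm[OF p(1)] permutes_inj_on[OF pp(1), of "{..<m}"] in \<open>auto dest: inj_onD\<close>)
      have "ee ` {..<m} \<inter> (\<lambda>i. aa (p i)) ` {..<m} = {}"
        unfolding im bij_betw_imp_surj_on[OF e] bij_betw_imp_surj_on[OF a] by (rule class_disj)
      then have "\<Phi> p \<in> domino_tilings (ee ` {..<m} \<union> (\<lambda>i. aa (p i)) ` {..<m})"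
        unfolding \<Phi>_def by (rule tiling_of_pairing[OF bij_betw_imp_inj_on[OF e] p_inj _ pp(2)])
      moreover have "ee ` {..<m} \<union> (\<lambda>i. aa (p i)) ` {..<m} = S"
        unfolding im bij_betw_imp_surj_on[OF e] bij_betw_imp_surj_on[OF a] by blast
      ultimately show "T \<in> domino_tilings S" using p(2) by simp
    next
      fix T assume T: "T \<in> domino_tilings S"
      have ex: "\<exists>j<m. aa j = partner T (ee i)" if "i < m" for i
      proof -
        have "partner T (ee i) \<in> S" "even_cell N (partner T (ee i))"
          using partner_props[OF T ee(1)[OF that]] ee(2)[OF that] even_cell_adjacent by blast+
        then show ?thesis using bij_betw_imp_surj_on[OF a] by (metis (mono_tags, lifting) imageE lessThan_iff mem_Collect_eq)
      qed
      define p where "p i = (if i < m then SOME j. j < m \<and> aa j = partner T (ee i) else i)" for i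
      have p: "p i < m" "aa (p i) = partner T (ee i)" if "i < m" for i
        using someI_ex[OF ex[OF that]] that by (simp_all add: p_def)
      have edge: "{ee i, aa (p i)} \<in> T" if "i < m" for i
        using partner_edge[OF T ee(1)[OF that]] p[OF that] by simp
      have inj: "inj_on p {..<m}"
      proof (rule inj_onI)
        fix i j assume ij: "i \<in> {..<m}" "j \<in> {..<m}" "p i = p j"
        then have "partner T (ee i) = partner T (ee j)" using p(2)[of i] p(2)[of j] by simp
        then have "ee i = ee j" using partner_props(3)[OF T ee(1)] ij by (metis lessThan_iff)
        then show "i = j" using eeq ij by simp
      qed
      have "p ` {..<m} \<subseteq> {..<m}" using p(1) by auto
      then have "bij_betw p {..<m} {..<m}"
        using inj by (simp add: bij_betw_def endo_inj_surj)
      then have "p permutes {..<m}" by (rule bij_imp_permutes) (simp add: p_def)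
      then have pP: "p \<in> P" unfolding P_def using edge tiling_edgeD(3)[OF T] by blast
      have "T = \<Phi> p"
      proof (intro equalityI subsetI)
        fix D assume "D \<in> \<Phi> p"
        then show "D \<in> T" unfolding \<Phi>_def using edge by blast
      next
        fix D assume D: "D \<in> T"
        then obtain c where c: "c \<in> S" "D = {c, partner T c}"
          using tiling_eq_partner[OF T] by blast
        note pc = partner_props[OF T c(1)]
        have key: "{d, partner T d} \<in> \<Phi> p" if d: "d \<in> S" "\<not> even_cell N d" for d
        proof -
          obtain i where i: "i < m" "d = ee i"
            using bij_betw_imp_surj_on[OF e] d by (metis (mono_tags, lifting) imageE lessThan_iff mem_Collect_eq)
          then show ?thesis unfolding \<Phi>_def using p(2)[OF i(1)] by (auto intro!: image_eqI[of _ _ i])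
        qed
        show "D \<in> \<Phi> p"
        proof (cases "even_cell N c")
          case False
          then show ?thesis using key[OF c(1)] c(2) by simp
        next
          case True
          then show ?thesis
            using key[OF pc(1)] pc(3) even_cell_adjacent[OF pc(2)] c(2) by (simp add: insert_commute)
        qed
      qed
      then show "T \<in> \<Phi> ` P" using pP by blast
    qed
  qed
qed

definition edge_prob :: "cell set \<Rightarrow> cell \<Rightarrow> cell \<Rightarrow> real" where
  "edge_prob S c d = real (card {T \<in> domino_tilings S. {c, d} \<in> T}) / real (card (domino_tilings S))"

text \<open>A two-sided inverse of the Kasteleyn matrix of \<open>S\<close>, with odd cells as rows
  and even cells as columns, together with the formula for the probability of a single
  domino.\<close>

definition kast_inverse :: "nat \<Rightarrow> cell set \<Rightarrow> (cell \<Rightarrow> cell \<Rightarrow> real) \<Rightarrow> bool" where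
  "kast_inverse N S G \<longleftrightarrow>
    (\<forall>e\<in>{c \<in> S. \<not> even_cell N c}. \<forall>e'\<in>{c \<in> S. \<not> even_cell N c}.
       (\<Sum>a\<in>{c \<in> S. even_cell N c}. kast N e a * G a e') = of_bool (e = e')) \<and>
    (\<forall>a\<in>{c \<in> S. even_cell N c}. \<forall>a'\<in>{c \<in> S. even_cell N c}.
       (\<Sum>e\<in>{c \<in> S. \<not> even_cell N c}. G a e * kast N e a') = of_bool (a = a')) \<and>
    (\<forall>e\<in>{c \<in> S. \<not> even_cell N c}. \<forall>a\<in>{c \<in> S. even_cell N c}. kast N e a * G a e = edge_prob S e a)"

text \<open>Some tiling is needed for the two colour classes to have the same size, and
  \<open>rows\<close> confines the missing cells to the bottom row, as the crossing argument
  demands.\<close>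

lemma kasteleyn_inverse:
  assumes S: "S \<subseteq> rect_set N n"
    and rows: "\<And>c. c \<in> rect_set N n \<Longrightarrow> 1 \<le> snd c \<Longrightarrow> c \<in> S"
    and ne: "domino_tilings S \<noteq> {}"
  shows "\<exists>G. kast_inverse N S G"
proof -
  define E where "E = {c \<in> S. \<not> even_cell N c}"
  define A where "A = {c \<in> S. even_cell N c}"
  have fin: "finite S" using finite_subset[OF S finite_rect_set] .
  have finEA: "finite E" "finite A" using fin by (simp_all add: E_def A_def)
  obtain T where T: "T \<in> domino_tilings S" using ne by blast
  have "bij_betw (partner T) E A"
  proof (rule bij_betw_byWitness[where f' = "partner T"])
    show "\<forall>c\<in>E. partner T (partner T c) = c" "\<forall>c\<in>A. partner T (partner T c) = c"
      unfolding E_def A_def using partner_props(3)[OF T] by blast+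
    show "partner T ` E \<subseteq> A" "partner T ` A \<subseteq> E"
      unfolding E_def A_def using partner_props(1,2)[OF T] even_cell_adjacent by blast+
  qed
  then have card_eq: "card E = card A" by (rule bij_betw_same_card)
  define m where "m = card E"
  obtain ee where ee: "bij_betw ee {..<m} E"
    using ex_bij_betw_nat_finite[OF finEA(1)] by (auto simp: m_def lessThan_atLeast0)
  obtain aa where aa: "bij_betw aa {..<m} A"
    using ex_bij_betw_nat_finite[OF finEA(2)] card_eq by (auto simp: m_def lessThan_atLeast0)
  have EA: "E \<inter> A = {}" "E \<union> A = S" by (auto simp: E_def A_def simp del: split_paired_All)
  have eeE: "ee i \<in> E" "aa i \<in> A" if "i < m" for i
    using bij_betwE[OF ee] bij_betwE[OF aa] that by blast+
  note im = bij_betw_imp_surj_on[OF ee] bij_betw_imp_surj_on[OF aa]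
  have "\<exists>c :: real. c \<noteq> 0 \<and>
    (\<forall>p. p permutes {..<m} \<and> (\<forall>i<m. cell_adjacent (ee i) (aa (p i))) \<longrightarrow>
       of_int (sign p) * (\<Prod>i<m. kast N (ee i) (aa (p i))) = c)"
    by (rule kast_sign_constant[OF bij_betw_imp_inj_on[OF ee] bij_betw_imp_inj_on[OF aa] _ _ S rows])
      (simp_all only: im EA)
  then obtain c :: real where c: "c \<noteq> 0" "\<And>p. p permutes {..<m} \<and> (\<forall>i<m. cell_adjacent (ee i) (aa (p i))) \<Longrightarrow>
       of_int (sign p) * (\<Prod>i<m. kast N (ee i) (aa (p i))) = c"
    by blast
  have kast_nz: "kast N (ee i) (aa j) \<noteq> 0 \<longleftrightarrow> cell_adjacent (ee i) (aa j)" if "i < m" "j < m" for i j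
  proof -
    have "ee i \<in> E" "aa j \<in> A" using eeE that by simp_all
    then have "ee i \<noteq> aa j" "ee i \<in> rect_set N n" "aa j \<in> rect_set N n"
      using S by (auto simp: E_def A_def subset_iff simp del: split_paired_All)
    then show ?thesis using pos_sgn_nonzero by (simp add: kast_def)
  qed
  define P where "P = {p. p permutes {..<m} \<and> (\<forall>i<m. cell_adjacent (ee i) (aa (p i)))}"
  have P: "{p. p permutes {..<m} \<and> (\<forall>i<m. kast N (ee i) (aa (p i)) \<noteq> 0)} = P"
  proof -
    have "p i < m" if "p permutes {..<m}" "i < m" for p i
      using permutes_in_image[OF that(1), of i] that(2) by simp
    then show ?thesis unfolding P_def using kast_nz by blast
  qed
  note bij = bij_betw_tilings[of ee m S N aa, folded E_def A_def, OF ee aa, folded P_def]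
  define \<Phi> where "\<Phi> p = (\<lambda>i. {ee i, aa (p i)}) ` {..<m}" for p
  have \<Phi>: "bij_betw \<Phi> P (domino_tilings S)" unfolding \<Phi>_def by (rule bij(1))
  have cardP: "card P = card (domino_tilings S)" by (rule bij_betw_same_card[OF \<Phi>])
  have cardPij: "card {p \<in> P. p i = j} = card {T \<in> domino_tilings S. {ee i, aa j} \<in> T}" if "i < m" "j < m" for i j
  proof (rule bij_betw_same_card)
    have "\<Phi> ` {p \<in> P. p i = j} = {T \<in> domino_tilings S. {ee i, aa j} \<in> T}"
      using bij(2)[OF _ that, folded \<Phi>_def] bij_betw_imp_surj_on[OF \<Phi>] by blast
    then show "bij_betw \<Phi> {p \<in> P. p i = j} {T \<in> domino_tilings S. {ee i, aa j} \<in> T}"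
      using bij_betw_subset[OF \<Phi>, of "{p \<in> P. p i = j}"] by blast
  qed
  have Pne: "P \<noteq> {}" using \<Phi> T unfolding bij_betw_def by blast
  have "\<exists>G0 :: nat \<Rightarrow> nat \<Rightarrow> real.
    (\<forall>i<m. \<forall>i'<m. (\<Sum>j<m. kast N (ee i) (aa j) * G0 j i') = of_bool (i = i')) \<and>
    (\<forall>j<m. \<forall>j'<m. (\<Sum>i<m. G0 j i * kast N (ee i) (aa j')) = of_bool (j = j')) \<and>
    (\<forall>i<m. \<forall>j<m. kast N (ee i) (aa j) * G0 j i = real (card {p \<in> P. p i = j}) / real (card P))"
    using matrix_inverse_weighted_permutations[of c m "\<lambda>i j. kast N (ee i) (aa j)", unfolded P, OF c(1) Pne c(2)]
    unfolding P_def by simp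
  then obtain G0 where G0_conj:
    "(\<forall>i<m. \<forall>i'<m. (\<Sum>j<m. kast N (ee i) (aa j) * G0 j i') = of_bool (i = i')) \<and>
    (\<forall>j<m. \<forall>j'<m. (\<Sum>i<m. G0 j i * kast N (ee i) (aa j')) = of_bool (j = j')) \<and>
    (\<forall>i<m. \<forall>j<m. kast N (ee i) (aa j) * G0 j i = real (card {p \<in> P. p i = j}) / real (card P))"
    by (rule exE)
  note G0 = G0_conj[THEN conjunct1, rule_format]
    G0_conj[THEN conjunct2, THEN conjunct1, rule_format]
    G0_conj[THEN conjunct2, THEN conjunct2, rule_format]
  define ie where "ie = inv_into {..<m} ee"
  define ia where "ia = inv_into {..<m} aa"
  have ie: "ie (ee i) = i" "ia (aa i) = i" if "i < m" for i
    using that ee aa by (simp_all add: ie_def ia_def bij_betw_def inv_into_f_f)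
  have ei: "ie e < m" "ee (ie e) = e" if "e \<in> E" for e
    using that im(1) unfolding ie_def by (metis inv_into_into lessThan_iff, metis f_inv_into_f)
  have ai: "ia a < m" "aa (ia a) = a" if "a \<in> A" for a
    using that im(2) unfolding ia_def by (metis inv_into_into lessThan_iff, metis f_inv_into_f)
  have ie_inj: "ie e = ie e' \<longleftrightarrow> e = e'" if "e \<in> E" "e' \<in> E" for e e'
    using ei(2)[OF that(1)] ei(2)[OF that(2)] by metis
  have ia_inj: "ia a = ia a' \<longleftrightarrow> a = a'" if "a \<in> A" "a' \<in> A" for a a'
    using ai(2)[OF that(1)] ai(2)[OF that(2)] by metis
  show ?thesis
    unfolding kast_inverse_def E_def[symmetric] A_def[symmetric]
  proof (rule exI[of _ "\<lambda>a e. G0 (ia a) (ie e)"], intro conjI ballI)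
    fix e e' assume e: "e \<in> E" "e' \<in> E"
    have "(\<Sum>a\<in>A. kast N e a * G0 (ia a) (ie e')) = (\<Sum>j<m. kast N e (aa j) * G0 (ia (aa j)) (ie e'))"
      by (rule sum.reindex_bij_betw[OF aa, symmetric])
    also have "\<dots> = (\<Sum>j<m. kast N (ee (ie e)) (aa j) * G0 j (ie e'))"
      using ei(2)[OF e(1)] by (intro sum.cong) (simp_all add: ie)
    finally show "(\<Sum>a\<in>A. kast N e a * G0 (ia a) (ie e')) = of_bool (e = e')"
      using G0(1)[OF ei(1)[OF e(1)] ei(1)[OF e(2)]] ie_inj[OF e] by simp
  next
    fix a a' assume a: "a \<in> A" "a' \<in> A"
    have "(\<Sum>e\<in>E. G0 (ia a) (ie e) * kast N e a') = (\<Sum>i<m. G0 (ia a) (ie (ee i)) * kast N (ee i) a')"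
      by (rule sum.reindex_bij_betw[OF ee, symmetric])
    also have "\<dots> = (\<Sum>i<m. G0 (ia a) i * kast N (ee i) (aa (ia a')))"
      using ai(2)[OF a(2)] by (intro sum.cong) (simp_all add: ie)
    finally show "(\<Sum>e\<in>E. G0 (ia a) (ie e) * kast N e a') = of_bool (a = a')"
      using G0(2)[OF ai(1)[OF a(1)] ai(1)[OF a(2)]] ia_inj[OF a] by simp
  next
    fix e a assume ea: "e \<in> E" "a \<in> A"
    show "kast N e a * G0 (ia a) (ie e) = edge_prob S e a"
      unfolding edge_prob_def
      using G0(3)[OF ei(1)[OF ea(1)] ai(1)[OF ea(2)]] cardPij[OF ei(1)[OF ea(1)] ai(1)[OF ea(2)]]
      unfolding ei(2)[OF ea(1)] ai(2)[OF ea(2)] cardP by simp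
  qed
qed

section \<open>The current between the two corners\<close>

definition left_corner :: "nat \<Rightarrow> cell" where "left_corner N = (- int N, 0)"
definition right_corner :: "nat \<Rightarrow> cell" where "right_corner N = (int N, 0)"

text \<open>An explicit tiling of either polyomino: vertical dominos in rows 1 and 2, 3 and 4 and so
  on, horizontal ones in row 0, counted from the left end if \<open>b\<close> holds and from the
  right end otherwise.\<close>

definition row_partner :: "bool \<Rightarrow> nat \<Rightarrow> cell \<Rightarrow> cell" where
  "row_partner b N c =
     (if snd c = 0 then (if even (fst c + int N) = b then (fst c + 1, 0) else (fst c - 1, 0))
      else if odd (snd c) then (fst c, snd c + 1) else (fst c, snd c - 1))"

lemma corner_tilings_nonempty:
  "domino_tilings (rect_set N n - {left_corner N}) \<noteq> {}"
  "domino_tilings (rect_set N n - {right_corner N}) \<noteq> {}"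
proof -
  have "domino_tilings (rect_set N n - {k}) \<noteq> {}" if k: "k = (if b then right_corner N else left_corner N)" for b k
  proof -
    let ?f = "row_partner b N"
    have "?f c \<in> rect_set N n - {k} \<and> ?f (?f c) = c \<and> cell_adjacent c (?f c)"
      if "c \<in> rect_set N n - {k}" for c
    proof -
      obtain x y where c: "c = (x, y)" by (cases c)
      have xy: "- int N \<le> x" "x \<le> int N" "0 \<le> y" "y \<le> 2 * int n" "(x, y) \<noteq> k"
        using that by (auto simp: c rect_set_iff)
      show ?thesis
      proof (cases "y = 0")
        case y: True
        have "even (x + int N) = b \<Longrightarrow> x \<noteq> int N" "even (x + int N) \<noteq> b \<Longrightarrow> x \<noteq> - int N"
          using xy(5) y by (auto simp: k left_corner_def right_corner_def)
        moreover have "odd (x + int N)" if "x - 1 = - int N \<or> x + 1 = int N"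
        proof -
          have "x + int N = 1 \<or> x + int N = 2 * int N - 1" using that by linarith
          moreover have "odd (1 :: int)" "odd (2 * int N - 1)" by simp_all
          ultimately show ?thesis by metis
        qed
        ultimately show ?thesis
          using y xy by (auto simp: c k row_partner_def rect_set_iff left_corner_def right_corner_def cell_adjacent_iff)
      next
        case False
        with xy have "odd y \<Longrightarrow> y + 1 \<le> 2 * int n" "even y \<Longrightarrow> y \<noteq> 1" by (cases "y = 2 * int n", auto)
        with False xy show ?thesis
          by (auto simp: c k row_partner_def rect_set_iff left_corner_def right_corner_def cell_adjacent_iff)
      qed
    qed
    then show ?thesis using domino_tilingI(1)[of "rect_set N n - {k}" ?f] by blast
  qed
  from this[of _ False] this[of _ True]
  show "domino_tilings (rect_set N n - {left_corner N}) \<noteq> {}" "domino_tilings (rect_set N n - {right_corner N}) \<noteq> {}"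
    by simp_all
qed

lemma kast_values:
  "kast N (x + 1, y) (x, y) = - 1" "kast N (x - 1, y) (x, y) = 1"
  "kast N (x, y + 1) (x, y) = - ((- 1) ^ nat (x + int N))" "kast N (x, y - 1) (x, y) = (- 1) ^ nat (x + int N)"
proof -
  have "sgn (- 1 - 2 * real N) = - 1" "sgn (2 * real N + 1) = (1 :: real)"
    by (simp_all add: sgn_if)
  then show "kast N (x + 1, y) (x, y) = - 1" "kast N (x - 1, y) (x, y) = 1"
    "kast N (x, y + 1) (x, y) = - ((- 1) ^ nat (x + int N))" "kast N (x, y - 1) (x, y) = (- 1) ^ nat (x + int N)"
    by (simp_all add: kast_def cell_adjacent_iff pos_sgn_def row_pos_def algebra_simps sgn_if)
qed

definition odd_cells :: "nat \<Rightarrow> nat \<Rightarrow> cell set" where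
  "odd_cells N n = {c \<in> rect_set N n. \<not> even_cell N c}"

definition even_cells :: "nat \<Rightarrow> nat \<Rightarrow> cell set" where
  "even_cells N n = {c \<in> rect_set N n. even_cell N c}"

lemma finite_odd_even_cells: "finite (odd_cells N n)" "finite (even_cells N n)"
  using finite_rect_set by (simp_all add: odd_cells_def even_cells_def)

lemma kast_zero: "\<not> cell_adjacent e a \<Longrightarrow> kast N e a = 0"
  by (simp add: kast_def)

text \<open>Around an odd cell in an even row the two horizontal weights are opposite, around one in
  an odd row the two vertical weights are. Parity keeps the former off the left and right sides and
  the latter off top and bottom, so no cancelling neighbour is missing.\<close>

lemma kast_column_constant:
  assumes "e \<in> odd_cells N n"
  shows "(\<Sum>a\<in>even_cells N n. kast N e a * of_bool (even (snd a))) = 0"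
proof -
  obtain x y where e: "e = (x, y)" by (cases e)
  have xy: "- int N \<le> x" "x \<le> int N" "0 \<le> y" "y \<le> 2 * int n" "odd (x + y + int N)"
    using assms by (auto simp: e odd_cells_def rect_set_iff even_cell_def)
  let ?f = "\<lambda>a. kast N e a * of_bool (even (snd a))"
  have nb: "a \<in> {(x + 1, y), (x - 1, y), (x, y + 1), (x, y - 1)}" if "kast N e a \<noteq> 0" for a
  proof -
    have "cell_adjacent e a" using that kast_zero by blast
    then show ?thesis by (cases a) (auto simp: e cell_adjacent_iff)
  qed
  show ?thesis
  proof (cases "even y")
    case True
    then have o: "odd (x + int N)" using xy by simp
    have "x \<noteq> - int N" "x \<noteq> int N" using o by auto
    then have x: "- int N < x" "x < int N" using xy by simp_all
    have "(\<Sum>a\<in>even_cells N n. ?f a) = (\<Sum>a\<in>{(x + 1, y), (x - 1, y)}. ?f a)"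
    proof (rule sum.mono_neutral_right[OF finite_odd_even_cells(2)])
      show "{(x + 1, y), (x - 1, y)} \<subseteq> even_cells N n"
        using x xy True o by (auto simp: even_cells_def rect_set_iff even_cell_def)
      show "\<forall>a\<in>even_cells N n - {(x + 1, y), (x - 1, y)}. ?f a = 0"
      proof
        fix a assume a: "a \<in> even_cells N n - {(x + 1, y), (x - 1, y)}"
        have "a \<noteq> (x + 1, y)" "a \<noteq> (x - 1, y)" using a by simp_all
        then have "kast N e a = 0 \<or> a = (x, y + 1) \<or> a = (x, y - 1)" using nb[of a] by (metis insert_iff empty_iff)
        then show "?f a = 0" using True by (elim disjE) simp_all
      qed
    qed
    also have "\<dots> = 0"
      using True kast_values(1)[of N "x - 1" y] kast_values(2)[of N "x + 1" y] by (simp add: e)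
    finally show ?thesis .
  next
    case False
    then have ev: "even (x + int N)" using xy by simp
    have "y \<noteq> 0" "y \<noteq> 2 * int n" using False by auto
    then have y: "0 < y" "y < 2 * int n" using xy by simp_all
    have s: "(- 1 :: real) ^ nat (x + int N) = 1" using ev xy by (simp add: even_nat_iff)
    have "(\<Sum>a\<in>even_cells N n. ?f a) = (\<Sum>a\<in>{(x, y + 1), (x, y - 1)}. ?f a)"
    proof (rule sum.mono_neutral_right[OF finite_odd_even_cells(2)])
      show "{(x, y + 1), (x, y - 1)} \<subseteq> even_cells N n"
        using y xy False ev by (auto simp: even_cells_def rect_set_iff even_cell_def)
      show "\<forall>a\<in>even_cells N n - {(x, y + 1), (x, y - 1)}. ?f a = 0"
      proof
        fix a assume a: "a \<in> even_cells N n - {(x, y + 1), (x, y - 1)}"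
        have "a \<noteq> (x, y + 1)" "a \<noteq> (x, y - 1)" using a by simp_all
        then have "kast N e a = 0 \<or> a = (x + 1, y) \<or> a = (x - 1, y)" using nb[of a] by (metis insert_iff empty_iff)
        then show "?f a = 0" using \<open>odd y\<close> by (elim disjE) simp_all
      qed
    qed
    also have "\<dots> = 0"
      using False s kast_values(3)[of N x "y - 1"] kast_values(4)[of N x "y + 1"] by (simp add: e)
    finally show ?thesis .
  qed
qed

lemma edge_prob_sym: "edge_prob S c d = edge_prob S d c"
  by (simp add: edge_prob_def insert_commute)

lemma edge_prob_outside: "c \<notin> S \<Longrightarrow> edge_prob S c d = 0"
proof -
  assume "c \<notin> S"
  then have "{T \<in> domino_tilings S. {c, d} \<in> T} = {}" using tiling_edgeD(1) by blast
  then show ?thesis by (simp add: edge_prob_def del: Collect_empty_eq)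
qed

text \<open>The columns of the two inverse Kasteleyn matrices differ by an element of the kernel of the
  matrix of the full rectangle, that is, by a multiple \<open>\<phi> e\<close> of the indicator of the
  even cells in even rows.\<close>

lemma corner_current:
  assumes N: "N > 0"
  shows "\<exists>\<phi> :: cell \<Rightarrow> real.
    (\<forall>e\<in>odd_cells N n. \<forall>a\<in>even_cells N n.
       edge_prob (rect_set N n - {right_corner N}) e a - edge_prob (rect_set N n - {left_corner N}) e a
       = kast N e a * \<phi> e * of_bool (even (snd a))) \<and>
    (\<forall>a\<in>even_cells N n. a \<noteq> right_corner N \<longrightarrow>
       (\<Sum>e\<in>odd_cells N n. \<phi> e * kast N e a) = of_bool (a = left_corner N))"
proof -
  let ?E = "odd_cells N n" and ?A = "even_cells N n"
  let ?l = "left_corner N" and ?r = "right_corner N"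
  let ?S1 = "rect_set N n - {?l}" and ?S2 = "rect_set N n - {?r}"
  have corners: "even_cell N ?l" "even_cell N ?r" "?l \<noteq> ?r" "snd ?l = 0" "snd ?r = 0"
    using N by (simp_all add: even_cell_def left_corner_def right_corner_def)
  have lr: "?l \<in> ?A" "?r \<in> ?A"
    by (simp_all add: even_cells_def corners rect_set_iff) (simp_all add: left_corner_def right_corner_def)
  have E: "{c \<in> ?S1. \<not> even_cell N c} = ?E" "{c \<in> ?S2. \<not> even_cell N c} = ?E"
    using corners by (auto simp: odd_cells_def simp del: split_paired_All)
  have A: "{c \<in> ?S1. even_cell N c} = ?A - {?l}" "{c \<in> ?S2. even_cell N c} = ?A - {?r}"
    by (auto simp: even_cells_def simp del: split_paired_All)
  have rows: "c \<in> ?S1 \<and> c \<in> ?S2" if "c \<in> rect_set N n" "1 \<le> snd c" for c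
    using that corners by auto
  obtain G1 where "kast_inverse N ?S1 G1"
    using kasteleyn_inverse[OF Diff_subset _ corner_tilings_nonempty(1)] rows by blast
  note G1_conj = this[unfolded kast_inverse_def E A]
  note G1 = G1_conj[THEN conjunct1, rule_format] G1_conj[THEN conjunct2, THEN conjunct1, rule_format]
    G1_conj[THEN conjunct2, THEN conjunct2, rule_format]
  obtain G2 where "kast_inverse N ?S2 G2"
    using kasteleyn_inverse[OF Diff_subset _ corner_tilings_nonempty(2)] rows by blast
  note G2_conj = this[unfolded kast_inverse_def E A]
  note G2 = G2_conj[THEN conjunct1, rule_format] G2_conj[THEN conjunct2, THEN conjunct1, rule_format]
    G2_conj[THEN conjunct2, THEN conjunct2, rule_format]
  \<comment> \<open>Extended by 0 to the missing corner, both inverses solve the same equations on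
    the whole rectangle; the formula for the edge probabilities persists, since both of its sides
    are 0 at that corner.\<close>
  define g1 where "g1 a e = (if a = ?l then 0 else G1 a e)" for a e
  define g2 where "g2 a e = (if a = ?r then 0 else G2 a e)" for a e
  have g1: "(\<Sum>a\<in>?A. kast N e a * g1 a e') = of_bool (e = e')" if "e \<in> ?E" "e' \<in> ?E" for e e'
  proof -
    have "(\<Sum>a\<in>?A. kast N e a * g1 a e') = (\<Sum>a\<in>?A - {?l}. kast N e a * g1 a e')"
      by (subst sum.remove[OF finite_odd_even_cells(2) lr(1)]) (simp add: g1_def)
    also have "\<dots> = (\<Sum>a\<in>?A - {?l}. kast N e a * G1 a e')"
      by (rule sum.cong) (simp_all add: g1_def)
    finally show ?thesis using G1(1)[OF that] by simp
  qed
  have g2: "(\<Sum>a\<in>?A. kast N e a * g2 a e') = of_bool (e = e')" if "e \<in> ?E" "e' \<in> ?E" for e e'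
  proof -
    have "(\<Sum>a\<in>?A. kast N e a * g2 a e') = (\<Sum>a\<in>?A - {?r}. kast N e a * g2 a e')"
      by (subst sum.remove[OF finite_odd_even_cells(2) lr(2)]) (simp add: g2_def)
    also have "\<dots> = (\<Sum>a\<in>?A - {?r}. kast N e a * G2 a e')"
      by (rule sum.cong) (simp_all add: g2_def)
    finally show ?thesis using G2(1)[OF that] by simp
  qed
  have prob1: "edge_prob ?S1 e a = kast N e a * g1 a e" if "e \<in> ?E" "a \<in> ?A" for e a
    using G1(3)[OF that(1), of a] that(2) edge_prob_outside[of ?l ?S1 e] edge_prob_sym[of ?S1 e ?l]
    by (simp add: g1_def)
  have prob2: "edge_prob ?S2 e a = kast N e a * g2 a e" if "e \<in> ?E" "a \<in> ?A" for e a
    using G2(3)[OF that(1), of a] that(2) edge_prob_outside[of ?r ?S2 e] edge_prob_sym[of ?S2 e ?r]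
    by (simp add: g2_def)
  \<comment> \<open>The multiple is read off at the left corner, where \<open>g1\<close> vanishes
    and the kernel vector is 1.\<close>
  define \<phi> where "\<phi> e = g2 ?l e" for e
  have diff: "g2 a e - g1 a e = \<phi> e * of_bool (even (snd a))" if e: "e \<in> ?E" and a: "a \<in> ?A" for a e
  proof -
    define f where "f a = g2 a e - g1 a e - \<phi> e * of_bool (even (snd a))" for a
    have fl: "f ?l = 0" using corners by (simp add: f_def \<phi>_def g1_def)
    have ker: "(\<Sum>a\<in>?A - {?l}. kast N e' a * f a) = 0" if e': "e' \<in> ?E" for e'
    proof -
      have "(\<Sum>a\<in>?A - {?l}. kast N e' a * f a) = (\<Sum>a\<in>?A. kast N e' a * f a)"
        by (subst sum.remove[OF finite_odd_even_cells(2) lr(1)]) (simp add: fl)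
      also have "\<dots> = (\<Sum>a\<in>?A. kast N e' a * g2 a e) - (\<Sum>a\<in>?A. kast N e' a * g1 a e)
          - \<phi> e * (\<Sum>a\<in>?A. kast N e' a * of_bool (even (snd a)))"
        unfolding sum_subtractf[symmetric] sum_distrib_left
        by (rule sum.cong) (simp_all add: f_def algebra_simps)
      finally show ?thesis
        using g1[OF e' e] g2[OF e' e] kast_column_constant[OF e'] by simp
    qed
    have "f a = 0"
    proof (cases "a = ?l")
      case False
      \<comment> \<open>The function \<open>f\<close> is 0 at the left corner and annihilated by the
        matrix without that column, which has the left inverse \<open>G1\<close>.\<close>
      have "(\<Sum>b\<in>?A - {?l}. (\<Sum>e'\<in>?E. G1 a e' * kast N e' b) * f b)
          = (\<Sum>b\<in>?A - {?l}. if b = a then f b else 0)"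
        using G1(2)[of a] False a by (intro sum.cong) auto
      also have "\<dots> = f a" using False a finite_odd_even_cells(2) by simp
      finally have "f a = (\<Sum>b\<in>?A - {?l}. (\<Sum>e'\<in>?E. G1 a e' * kast N e' b) * f b)" ..
      also have "\<dots> = (\<Sum>e'\<in>?E. G1 a e' * (\<Sum>b\<in>?A - {?l}. kast N e' b * f b))"
        unfolding sum_distrib_left sum_distrib_right by (subst sum.swap) (simp add: mult.assoc)
      also have "\<dots> = 0" using ker by simp
      finally show ?thesis .
    qed (simp add: fl)
    then show ?thesis by (simp add: f_def)
  qed
  show ?thesis
  proof (rule exI[of _ \<phi>], intro conjI ballI impI)
    fix e a assume ea: "e \<in> ?E" "a \<in> ?A"
    have "edge_prob ?S2 e a - edge_prob ?S1 e a = kast N e a * (g2 a e - g1 a e)"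
      unfolding prob1[OF ea] prob2[OF ea] by (simp add: algebra_simps)
    then show "edge_prob ?S2 e a - edge_prob ?S1 e a = kast N e a * \<phi> e * of_bool (even (snd a))"
      unfolding diff[OF ea] by simp
  next
    fix a assume a: "a \<in> ?A" "a \<noteq> ?r"
    have "(\<Sum>e\<in>?E. \<phi> e * kast N e a) = (\<Sum>e\<in>?E. G2 ?l e * kast N e a)"
      using corners by (simp add: \<phi>_def g2_def)
    also have "\<dots> = of_bool (a = ?l)" using G2(2)[of ?l a] lr a corners by auto
    finally show "(\<Sum>e\<in>?E. \<phi> e * kast N e a) = of_bool (a = ?l)" .
  qed
qed

section \<open>The stream function of the mean flow\<close>

text \<open>The right corner is exempt from \<open>balance\<close> because its column is absent from
  the matrix whose inverse supplies \<open>\<phi>\<close>.\<close>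

locale corner_flow =
  fixes N n :: nat and \<phi> :: "cell \<Rightarrow> real"
  assumes N: "N > 0"
    and balance: "\<And>a. a \<in> even_cells N n \<Longrightarrow> a \<noteq> right_corner N \<Longrightarrow>
       (\<Sum>e\<in>odd_cells N n. \<phi> e * kast N e a) = of_bool (a = left_corner N)"
begin

text \<open>The sign makes the left corner a source. Extension by 0 builds in that no current leaves
  the rectangle.\<close>

definition flow :: "cell \<Rightarrow> real" where
  "flow e = (if e \<in> odd_cells N n then - \<phi> e else 0)"

lemma balance_local:
  assumes a: "(x, y) \<in> even_cells N n" "(x, y) \<noteq> right_corner N"
  shows "flow (x + 1, y) - flow (x - 1, y)
    + (- 1) ^ nat (x + int N) * (flow (x, y + 1) - flow (x, y - 1)) = of_bool ((x, y) = left_corner N)"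
proof -
  let ?B = "{(x + 1, y), (x - 1, y), (x, y + 1), (x, y - 1)}"
  have "(\<Sum>e\<in>odd_cells N n. \<phi> e * kast N e (x, y)) = (\<Sum>e\<in>odd_cells N n \<union> ?B. - flow e * kast N e (x, y))"
    by (rule sum.mono_neutral_cong_left) (auto simp: flow_def finite_odd_even_cells)
  also have "\<dots> = (\<Sum>e\<in>?B. - flow e * kast N e (x, y))"
  proof (rule sum.mono_neutral_right)
    show "\<forall>e\<in>odd_cells N n \<union> ?B - ?B. - flow e * kast N e (x, y) = 0"
    proof
      fix e assume "e \<in> odd_cells N n \<union> ?B - ?B"
      then have "e \<notin> ?B" by simp
      then have "\<not> cell_adjacent (x, y) e" by (cases e) (simp add: cell_adjacent_iff)
      then show "- flow e * kast N e (x, y) = 0"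
        using kast_zero cell_adjacent_sym[of "(x, y)" e] by simp
    qed
  qed (simp_all add: finite_odd_even_cells)
  also have "\<dots> = flow (x + 1, y) - flow (x - 1, y)
    + (- 1) ^ nat (x + int N) * (flow (x, y + 1) - flow (x, y - 1))"
    by (simp add: kast_values) (simp add: algebra_simps)
  finally show ?thesis using balance[OF a] by simp
qed

text \<open>The cells even in both coordinates relative to the left corner are the vertices
  \<open>(i, j)\<close> of a grid: \<open>hflow i j\<close> is the current from
  \<open>(i, j)\<close> to \<open>(i + 1, j)\<close>, and \<open>vflow i j\<close> the current from
  \<open>(i, j - 1)\<close> to \<open>(i, j)\<close>.\<close>

definition hflow :: "int \<Rightarrow> int \<Rightarrow> real" where "hflow i j = flow (2 * i + 1 - int N, 2 * j)"
definition vflow :: "int \<Rightarrow> int \<Rightarrow> real" where "vflow i j = flow (2 * i - int N, 2 * j - 1)"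

lemma flow_outside: "c \<notin> rect_set N n \<Longrightarrow> flow c = 0"
  by (simp add: flow_def odd_cells_def)

lemma flow_boundary:
  "hflow (- 1) j = 0" "hflow (int N) j = 0" "vflow i 0 = 0" "vflow i (int n + 1) = 0"
  unfolding hflow_def vflow_def by (rule flow_outside, simp add: rect_set_iff)+

text \<open>At an even cell in an even column the column sign is 1, and the balance equation is a
  divergence.\<close>

lemma vertex_balance:
  assumes "0 \<le> i" "i \<le> int N" "0 \<le> j" "j \<le> int n" "i < int N \<or> j \<noteq> 0"
  shows "hflow i j - hflow (i - 1) j + vflow i (j + 1) - vflow i j = of_bool (i = 0 \<and> j = 0)"
proof -
  have "(2 * i - int N, 2 * j) \<in> even_cells N n"
    using assms by (simp add: even_cells_def rect_set_iff even_cell_def)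
  moreover have "(2 * i - int N, 2 * j) \<noteq> right_corner N"
    using assms by (auto simp: right_corner_def)
  moreover have "even (nat (2 * i))" using assms by (simp add: even_nat_iff)
  moreover have "(2 * i - int N, 2 * j) = left_corner N \<longleftrightarrow> i = 0 \<and> j = 0"
    by (auto simp: left_corner_def)
  moreover have "hflow i j = flow (2 * i - int N + 1, 2 * j)"
    unfolding hflow_def by (rule arg_cong[of _ _ flow]) simp
  moreover have "hflow (i - 1) j = flow (2 * i - int N - 1, 2 * j)"
    unfolding hflow_def by (rule arg_cong[of _ _ flow]) simp
  moreover have "vflow i (j + 1) = flow (2 * i - int N, 2 * j + 1)"
    unfolding vflow_def by (rule arg_cong[of _ _ flow]) simp
  moreover have "vflow i j = flow (2 * i - int N, 2 * j - 1)"
    by (simp add: vflow_def)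
  ultimately show ?thesis
    using balance_local[of "2 * i - int N" "2 * j"] by (simp del: of_bool_conj)
qed

text \<open>An even cell in an odd column is the centre of a face of the grid. There the column sign
  is - 1, and the same balance equation becomes a circulation around the face.\<close>

lemma face_curl:
  assumes "0 \<le> i" "i < int N" "1 \<le> j" "j \<le> int n"
  shows "vflow (i + 1) j - vflow i j = hflow i j - hflow i (j - 1)"
proof -
  have "(2 * i + 1 - int N, 2 * j - 1) \<in> even_cells N n"
    using assms by (simp add: even_cells_def rect_set_iff even_cell_def)
  moreover have "(2 * i + 1 - int N, 2 * j - 1) \<noteq> right_corner N" "(2 * i + 1 - int N, 2 * j - 1) \<noteq> left_corner N"
    using assms by (auto simp: right_corner_def left_corner_def)
  moreover have "odd (nat (2 * i + 1))" using assms by (simp add: even_nat_iff)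
  moreover have "vflow (i + 1) j = flow (2 * i + 1 - int N + 1, 2 * j - 1)"
    unfolding vflow_def by (rule arg_cong[of _ _ flow]) simp
  moreover have "vflow i j = flow (2 * i + 1 - int N - 1, 2 * j - 1)"
    unfolding vflow_def by (rule arg_cong[of _ _ flow]) simp
  moreover have "hflow i j = flow (2 * i + 1 - int N, 2 * j - 1 + 1)"
    unfolding hflow_def by (rule arg_cong[of _ _ flow]) simp
  moreover have "hflow i (j - 1) = flow (2 * i + 1 - int N, 2 * j - 1 - 1)"
    unfolding hflow_def by (rule arg_cong[of _ _ flow]) simp
  moreover have "(- 1 :: real) ^ nat (2 * i + 1 - int N + int N) = - 1"
    using \<open>odd (nat (2 * i + 1))\<close> by simp
  ultimately show ?thesis
    using balance_local[of "2 * i + 1 - int N" "2 * j - 1"] by (simp only:) simp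
qed

text \<open>Lives on the faces of the grid: the current between columns \<open>i\<close> and
  \<open>i + 1\<close> below height \<open>j\<close>. The outer columns \<open>- 1\<close> and
  \<open>int N\<close> behave as if the unit current came in and went out along row 0.\<close>

definition stream :: "int \<Rightarrow> int \<Rightarrow> real" where
  "stream i j = (if 0 \<le> i \<and> i < int N then (\<Sum>j'\<in>{0..<j}. hflow i j') else of_bool (1 \<le> j))"

lemma stream_step:
  assumes "0 \<le> i" "i < int N" "0 \<le> j"
  shows "stream i (j + 1) = stream i j + hflow i j"
proof -
  have "{0..<j + 1} = insert j {0..<j}" using assms by auto
  then show ?thesis using assms by (simp add: stream_def)
qed

lemma stream_bottom: "stream i 0 = 0"
  by (simp add: stream_def)

text \<open>Induction on the height by \<open>vertex_balance\<close>; the source at the left corner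
  is matched by the jump of \<open>stream (- 1)\<close> from 0 to 1.\<close>

lemma vflow_stream:
  assumes "0 \<le> i" "i < int N" "0 \<le> j" "j \<le> int n + 1"
  shows "vflow i j = stream (i - 1) j - stream i j"
  using assms(3,4)
proof (induction j rule: int_ge_induct)
  case base
  then show ?case by (simp add: flow_boundary stream_bottom)
next
  case (step j)
  have IH: "vflow i j = stream (i - 1) j - stream i j" using step by simp
  have b: "vflow i (j + 1) = of_bool (i = 0 \<and> j = 0) - hflow i j + hflow (i - 1) j + vflow i j"
    using vertex_balance[of i j] assms step by simp
  have s: "stream (i - 1) (j + 1) = stream (i - 1) j + hflow (i - 1) j + of_bool (i = 0 \<and> j = 0)"
  proof (cases "i = 0")
    case True
    then show ?thesis using step by (simp add: stream_def flow_boundary)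
  next
    case False
    then show ?thesis using stream_step[of "i - 1" j] assms step by simp
  qed
  show ?case using b s IH stream_step[OF assms(1,2) step.hyps(1)] by simp
qed

text \<open>No current crosses the top, so the stream function keeps there the value that it has in
  the left outer column.\<close>

lemma stream_top:
  assumes "- 1 \<le> i" "i \<le> int N"
  shows "stream i (int n + 1) = 1"
proof -
  have "stream i (int n + 1) = 1" if "- 1 \<le> i" "i < int N" for i
    using that
  proof (induction i rule: int_ge_induct)
    case base
    then show ?case by (simp add: stream_def)
  next
    case (step i)
    then show ?case
      using vflow_stream[of "i + 1" "int n + 1"] by (simp add: flow_boundary)
  qed
  then show ?thesis using assms by (cases "i = int N") (auto simp: stream_def)
qed

lemma vflow_stream_right:
  assumes "1 \<le> j" "j \<le> int n + 1"
  shows "vflow (int N) j = stream (int N - 1) j - 1"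
proof -
  have "vflow (int N) (int n + 1 - k) = stream (int N - 1) (int n + 1 - k) - 1"
    if "0 \<le> k" "k \<le> int n" for k
    using that
  proof (induction k rule: int_ge_induct)
    case base
    then show ?case using stream_top[of "int N - 1"] by (simp add: flow_boundary)
  next
    case (step k)
    define j where "j = int n + 1 - (k + 1)"
    have j: "int n + 1 - k = j + 1" "0 < j" "j \<le> int n" using step by (simp_all add: j_def)
    then have IH: "vflow (int N) (j + 1) = stream (int N - 1) (j + 1) - 1"
      using step.IH step.prems unfolding j(1) by simp
    have "hflow (int N) j - hflow (int N - 1) j + vflow (int N) (j + 1) - vflow (int N) j = 0"
      using vertex_balance[of "int N" j] j N by simp
    moreover have "stream (int N - 1) (j + 1) = stream (int N - 1) j + hflow (int N - 1) j"
      using stream_step[of "int N - 1" j] j N by simp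
    ultimately show ?case unfolding j_def[symmetric] using IH by (simp add: flow_boundary)
  qed
  from this[of "int n + 1 - j"] show ?thesis using assms by simp
qed

text \<open>Differences of \<open>stream\<close> are currents, so vanishing circulation around a
  face is the discrete Laplace equation at that face.\<close>

lemma stream_harmonic: "harmonic_on_rect (- 1) (int N) 0 (int n + 1) stream"
  unfolding harmonic_on_rect_def
proof (intro allI impI)
  fix i j assume ij: "- 1 < i \<and> i < int N \<and> 0 < j \<and> j < int n + 1"
  have "vflow i j = stream (i - 1) j - stream i j" using vflow_stream[of i j] ij by simp
  moreover have "vflow (i + 1) j = stream i j - stream (i + 1) j"
  proof (cases "i + 1 = int N")
    case True
    then have "i = int N - 1" by simp
    then show ?thesis using vflow_stream_right[of j] ij by (simp add: stream_def)
  next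
    case False
    then show ?thesis using vflow_stream[of "i + 1" j] ij by simp
  qed
  moreover have "stream i (j + 1) = stream i j + hflow i j" using stream_step[of i j] ij by simp
  moreover have "stream i j = stream i (j - 1) + hflow i (j - 1)" using stream_step[of i "j - 1"] ij by simp
  ultimately show "4 * stream i j = stream (i - 1) j + stream (i + 1) j + stream i (j - 1) + stream i (j + 1)"
    using face_curl[of i j] ij by simp
qed

lemma stream_eq_strip_solution:
  assumes "- 1 \<le> i" "i \<le> int N" "0 \<le> j" "j \<le> int n + 1"
  shows "stream i j = strip_solution N (Suc n) (of_int i) (of_int j)"
proof (rule harmonic_unique[OF stream_harmonic strip_solution_harmonic _ assms])
  fix i j assume "(i, j) \<in> rect_boundary (- 1) (int N) 0 (int n + 1)"
  then have ij: "- 1 \<le> i" "i \<le> int N" "0 \<le> j" "j \<le> int n + 1" "i = - 1 \<or> i = int N \<or> j = 0 \<or> j = int n + 1"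
    by (auto simp: rect_boundary_def)
  show "stream i j = strip_solution N (Suc n) (of_int i) (of_int j)"
  proof (cases "j = 0 \<or> j = int n + 1")
    case True
    have top: "strip_solution N (Suc n) x (real n + 1) = 1" for x
      using strip_solution_top[of "Suc n" N x] by (simp add: add.commute)
    show ?thesis
    proof (cases "j = 0")
      case True
      then show ?thesis by (simp add: stream_bottom strip_solution_bottom)
    next
      case False
      then have j: "j = int n + 1" using \<open>j = 0 \<or> j = int n + 1\<close> by simp
      show ?thesis unfolding j using stream_top[OF ij(1,2)] top by simp
    qed
  next
    case False
    then obtain k where k: "j = int k" using ij(3) nonneg_int_cases by blast
    have "stream i j = 1" using False ij by (auto simp: stream_def)
    moreover have "strip_solution N (Suc n) (of_int i) (real k) = 1"
      using False ij k by (intro strip_solution_side) auto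
    ultimately show ?thesis using k by simp
  qed
qed

end

text \<open>The sum is the mean flow through the vertical segment below \<open>(a, b)\<close>.\<close>

lemma mean_crossing_eq_strip_solution:
  assumes N: "N > 0" and a: "- int N < a" "a \<le> int N" and b: "0 \<le> b" "b \<le> 2 * int n + 1"
  shows "(\<Sum>y\<in>{0..<b}. (if even_cell N (a - 1, y) then - 1 else 1) *
      (edge_prob (rect_set N n - {left_corner N}) (a - 1, y) (a, y)
       - edge_prob (rect_set N n - {right_corner N}) (a - 1, y) (a, y)))
    = strip_solution N (Suc n) (of_int ((a - 1 + int N) div 2)) (of_int ((b + 1) div 2))"
    (is "(\<Sum>y\<in>_. ?g y) = _")
proof -
  let ?S1 = "rect_set N n - {left_corner N}" and ?S2 = "rect_set N n - {right_corner N}"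
  obtain \<phi> where phi_conj: "(\<forall>e\<in>odd_cells N n. \<forall>a\<in>even_cells N n.
       edge_prob ?S2 e a - edge_prob ?S1 e a = kast N e a * \<phi> e * of_bool (even (snd a))) \<and>
    (\<forall>a\<in>even_cells N n. a \<noteq> right_corner N \<longrightarrow>
       (\<Sum>e\<in>odd_cells N n. \<phi> e * kast N e a) = of_bool (a = left_corner N))"
    using corner_current[OF N, of n] by (rule exE)
  note phi = phi_conj[THEN conjunct1, rule_format] and balance = phi_conj[THEN conjunct2, rule_format]
  interpret corner_flow N n \<phi> by unfold_locales (fact N, rule balance)
  \<comment> \<open>The grid column cut by the vertical line through \<open>a\<close>: in an even
    row, the odd one of the two cells beside the line has first coordinate
    \<open>2 * i + 1 - int N\<close>.\<close>
  define i where "i = (a - 1 + int N) div 2"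
  have i: "0 \<le> i" "i < int N" using a unfolding i_def by linarith+
  \<comment> \<open>Odd rows contribute nothing because the kernel vector vanishes there.\<close>
  have g: "?g y = (if even y then hflow i (y div 2) else 0)" if y: "0 \<le> y" "y \<le> 2 * int n" for y
  proof -
    have R: "(a - 1, y) \<in> rect_set N n" "(a, y) \<in> rect_set N n" using a y by (simp_all add: rect_set_iff)
    have adj: "cell_adjacent (a - 1, y) (a, y)" by (simp add: cell_adjacent_iff)
    have hflow_even: "hflow i (y div 2) = flow (2 * i + 1 - int N, y)" if "even y"
      using that by (simp add: hflow_def)
    show ?thesis
    proof (cases "even_cell N (a - 1, y)")
      case True
      then have m: "(a, y) \<in> odd_cells N n" "(a - 1, y) \<in> even_cells N n"
        using R even_cell_adjacent[OF adj] by (simp_all add: odd_cells_def even_cells_def)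
      have "?g y = - \<phi> (a, y) * of_bool (even y)"
        using phi[OF m] True kast_values(1)[of N "a - 1" y]
        by (simp add: edge_prob_sym[of _ "(a - 1, y)"])
      moreover have "2 * i + 1 - int N = a" if "even y"
      proof -
        have "even (a - 1 + int N)" using True that by (simp add: even_cell_def)
        then show ?thesis by (simp add: i_def)
      qed
      ultimately show ?thesis using m(1) hflow_even by (cases "even y") (simp_all add: flow_def)
    next
      case False
      then have m: "(a - 1, y) \<in> odd_cells N n" "(a, y) \<in> even_cells N n"
        using R even_cell_adjacent[OF adj] by (simp_all add: odd_cells_def even_cells_def)
      have "?g y = - \<phi> (a - 1, y) * of_bool (even y)"
        using phi[OF m] False kast_values(2)[of N a y] by simp
      moreover have "hflow i (y div 2) = flow (a - 1, y)" if "even y"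
      proof -
        have "odd (a - 1 + int N)" using False that by (simp add: even_cell_def)
        then have "2 * i + 1 = a - 1 + int N" unfolding i_def by (rule odd_two_times_div_two_succ)
        then have "2 * i + 1 - int N = a - 1" by simp
        then show ?thesis using hflow_even[OF that] by (simp only:)
      qed
      ultimately show ?thesis using m(1) by (cases "even y") (simp_all add: flow_def)
    qed
  qed
  \<comment> \<open>The argument \<open>(b + 1) div 2\<close> is the number of even rows below
    \<open>b\<close>.\<close>
  have "(\<Sum>y\<in>{0..<b}. ?g y) = stream i ((b + 1) div 2)"
    using b
  proof (induction b rule: int_ge_induct)
    case base
    then show ?case by (simp add: stream_bottom)
  next
    case (step b)
    have "{0..<b + 1} = insert b {0..<b}" using step by auto
    then have "(\<Sum>y\<in>{0..<b + 1}. ?g y) = stream i ((b + 1) div 2) + (if even b then hflow i (b div 2) else 0)"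
      using step g[of b] by simp
    also have "\<dots> = stream i ((b + 1 + 1) div 2)"
    proof (cases "even b")
      case True
      then have "(b + 1) div 2 = b div 2" "(b + 1 + 1) div 2 = b div 2 + 1" by auto
      then show ?thesis using stream_step[OF i, of "b div 2"] True step by (simp add: add.commute)
    next
      case False
      then have "(b + 1 + 1) div 2 = (b + 1) div 2" by presburger
      then show ?thesis using False by simp
    qed
    finally show ?case .
  qed
  also have "\<dots> = strip_solution N (Suc n) (of_int i) (of_int ((b + 1) div 2))"
    using i b by (intro stream_eq_strip_solution) auto
  finally show ?thesis by (simp add: i_def)
qed

section \<open>The path in the superposition of two tilings\<close>

text \<open>A step to a cell that was already visited truncates the path there.\<close>

lemma rtrancl_distinct_path:
  assumes "(a, b) \<in> R\<^sup>*"
  shows "\<exists>xs. xs \<noteq> [] \<and> distinct xs \<and> hd xs = a \<and> last xs = b \<and> successively (\<lambda>c d. (c, d) \<in> R) xs"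
  using assms
proof (induction rule: rtrancl_induct)
  case base
  show ?case by (rule exI[of _ "[a]"]) simp
next
  case (step y z)
  then obtain xs where xs: "xs \<noteq> []" "distinct xs" "hd xs = a" "last xs = y"
    "successively (\<lambda>c d. (c, d) \<in> R) xs" by blast
  show ?case
  proof (cases "z \<in> set xs")
    case True
    then obtain us vs where uv: "xs = us @ z # vs" by (meson split_list)
    have "successively (\<lambda>c d. (c, d) \<in> R) ((us @ [z]) @ vs)" using xs(5) uv by simp
    then have "successively (\<lambda>c d. (c, d) \<in> R) (us @ [z])"
      unfolding successively_append_iff by blast
    moreover have "hd (us @ [z]) = a" using xs(3) uv by (cases us) simp_all
    moreover have "distinct (us @ [z])" using xs(2) uv by simp
    ultimately show ?thesis by (intro exI[of _ "us @ [z]"]) simp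
  next
    case False
    have "successively (\<lambda>c d. (c, d) \<in> R) (xs @ [z])"
      unfolding successively_append_iff using xs step(2) by simp
    then show ?thesis using xs False by (intro exI[of _ "xs @ [z]"]) simp
  qed
qed

section \<open>The alternating path and its flow\<close>

definition cell_sgn :: "nat \<Rightarrow> cell \<Rightarrow> real" where
  "cell_sgn N c = (if even_cell N c then - 1 else 1)"

definition path_step :: "cell list \<Rightarrow> cell \<Rightarrow> cell \<Rightarrow> bool" where
  "path_step xs c d \<longleftrightarrow> (\<exists>i. Suc i < length xs \<and> xs ! i = c \<and> xs ! Suc i = d)"

lemma path_step_nth:
  assumes "distinct xs" and i: "i < length xs"
  shows "path_step xs (xs ! i) d \<longleftrightarrow> Suc i < length xs \<and> d = xs ! Suc i"
    "path_step xs d (xs ! i) \<longleftrightarrow> 0 < i \<and> d = xs ! (i - 1)"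
proof -
  have nth_eq: "xs ! j = xs ! i \<longleftrightarrow> j = i" if "j < length xs" for j
    using assms that by (simp add: nth_eq_iff_index_eq)
  show "path_step xs (xs ! i) d \<longleftrightarrow> Suc i < length xs \<and> d = xs ! Suc i"
    unfolding path_step_def using nth_eq by (metis Suc_lessD)
  show "path_step xs d (xs ! i) \<longleftrightarrow> 0 < i \<and> d = xs ! (i - 1)"
  proof
    assume "path_step xs d (xs ! i)"
    then obtain j where j: "Suc j < length xs" "xs ! j = d" "xs ! Suc j = xs ! i"
      unfolding path_step_def by blast
    then have "Suc j = i" using nth_eq[OF j(1)] by simp
    then show "0 < i \<and> d = xs ! (i - 1)" using j(2) by auto
  next
    assume "0 < i \<and> d = xs ! (i - 1)"
    then show "path_step xs d (xs ! i)"
      unfolding path_step_def using i by (intro exI[of _ "i - 1"]) simp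
  qed
qed

definition path_flow :: "cell list \<Rightarrow> cell \<Rightarrow> cell \<Rightarrow> real" where
  "path_flow xs c d = of_bool (path_step xs c d) - of_bool (path_step xs d c)"

definition corner_path :: "nat \<Rightarrow> cell set set \<Rightarrow> cell set set \<Rightarrow> cell list \<Rightarrow> bool" where
  "corner_path N T1 T2 xs \<longleftrightarrow> xs \<noteq> [] \<and> distinct xs \<and> hd xs = left_corner N \<and> last xs = right_corner N \<and>
     successively (\<lambda>c d. {c, d} \<in> T1 \<union> T2) xs"

locale tiling_pair =
  fixes N n :: nat and T1 T2 :: "cell set set"
  assumes N: "N > 0"
    and T1: "T1 \<in> domino_tilings (rect_set N n - {left_corner N})"
    and T2: "T2 \<in> domino_tilings (rect_set N n - {right_corner N})"
begin

abbreviation "l \<equiv> left_corner N"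
abbreviation "r \<equiv> right_corner N"
abbreviation "R \<equiv> rect_set N n"

lemma corners: "l \<in> R" "r \<in> R" "l \<noteq> r" "even_cell N l" "even_cell N r"
  using N by (simp_all add: left_corner_def right_corner_def rect_set_iff even_cell_def)

lemma not_edge: "{l, d} \<notin> T1" "{r, d} \<notin> T2"
  using tiling_edgeD(1)[OF T1, of l d] tiling_edgeD(1)[OF T2, of r d] by blast+

lemma edge1: "{c, d} \<in> T1 \<longleftrightarrow> c \<in> R \<and> c \<noteq> l \<and> d = partner T1 c"
  unfolding edge_iff_partner[OF T1] by simp

lemma edge2: "{c, d} \<in> T2 \<longleftrightarrow> c \<in> R \<and> c \<noteq> r \<and> d = partner T2 c"
  unfolding edge_iff_partner[OF T2] by simp

lemma partner1:
  assumes "c \<in> R" "c \<noteq> l"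
  shows "partner T1 c \<in> R" "partner T1 c \<noteq> l" "partner T1 (partner T1 c) = c" "cell_adjacent c (partner T1 c)"
  using partner_props[OF T1, of c] assms by simp_all

lemma partner2:
  assumes "c \<in> R" "c \<noteq> r"
  shows "partner T2 c \<in> R" "partner T2 c \<noteq> r" "partner T2 (partner T2 c) = c" "cell_adjacent c (partner T2 c)"
  using partner_props[OF T2, of c] assms by simp_all

lemma edge_props:
  assumes "{c, d} \<in> T1 \<union> T2"
  shows "c \<in> R" "d \<in> R" "cell_adjacent c d"
  using assms tiling_edgeD[OF T1, of c d] tiling_edgeD[OF T2, of c d] by blast+

text \<open>The component of \<open>l\<close> consists of \<open>l\<close> and dominos of \<open>T1\<close>, so it has an odd number of
  cells; if it missed \<open>r\<close> it would consist of dominos of \<open>T2\<close>.\<close>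

lemma corners_connected: "(l, r) \<in> {(c, d). {c, d} \<in> T1 \<union> T2}\<^sup>*"
proof (rule ccontr)
  let ?E = "{(c, d). {c, d} \<in> T1 \<union> T2}"
  assume nr: "(l, r) \<notin> ?E\<^sup>*"
  define S where "S = {c. (l, c) \<in> ?E\<^sup>*}"
  have lS: "l \<in> S" by (simp add: S_def)
  have step: "d \<in> S" if "c \<in> S" "{c, d} \<in> T1 \<union> T2" for c d
    using that rtrancl_into_rtrancl[of l c ?E d] by (simp add: S_def)
  have SR: "c \<in> R" if "c \<in> S" for c
    using that unfolding S_def mem_Collect_eq
    by (induction rule: rtrancl_induct) (simp_all add: corners edge_props)
  have fin: "finite S" by (rule finite_subset[OF _ finite_rect_set[of N n]]) (use SR in blast)
  have "even (card S)"
  proof (rule even_card_involution[of S "partner T2", OF fin])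
    fix c assume c: "c \<in> S"
    then have cR: "c \<in> R" "c \<noteq> r" using SR nr by (auto simp: S_def)
    note p = partner2[OF cR]
    have "partner T2 c \<in> S" using step[OF c] edge2[of c] cR by blast
    moreover have "partner T2 c \<noteq> c" using p(4) by (metis cell_adjacent_irrefl)
    ultimately show "partner T2 c \<in> S \<and> partner T2 (partner T2 c) = c \<and> partner T2 c \<noteq> c"
      using p(3) by simp
  qed
  moreover have "even (card (S - {l}))"
  proof (rule even_card_involution[of "S - {l}" "partner T1"])
    show "finite (S - {l})" using fin by simp
    fix c assume "c \<in> S - {l}"
    then have c: "c \<in> S" "c \<noteq> l" by simp_all
    have cR: "c \<in> R" using SR c by simp
    note p = partner1[OF cR c(2)]
    have "partner T1 c \<in> S" using step[OF c(1)] edge1[of c] cR c(2) by blast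
    moreover have "partner T1 c \<noteq> c" using p(4) by (metis cell_adjacent_irrefl)
    ultimately show "partner T1 c \<in> S - {l} \<and> partner T1 (partner T1 c) = c \<and> partner T1 c \<noteq> c"
      using p(2,3) by simp
  qed
  moreover have "card S = Suc (card (S - {l}))"
    using lS fin by (metis card_Suc_Diff1)
  ultimately show False by simp
qed

lemma corner_path_exists: "\<exists>xs. corner_path N T1 T2 xs"
  using rtrancl_distinct_path[OF corners_connected] by (simp add: corner_path_def)

end

locale tiling_pair_path = tiling_pair +
  fixes xs :: "cell list"
  assumes xs: "corner_path N T1 T2 xs"
begin

lemma path_basic:
  shows "distinct xs" "xs ! 0 = l" "xs ! (length xs - 1) = r" "2 \<le> length xs"
    "\<And>i. Suc i < length xs \<Longrightarrow> {xs ! i, xs ! Suc i} \<in> T1 \<union> T2"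
proof -
  have ne: "xs \<noteq> []" and d: "distinct xs" and h: "hd xs = l" and la: "last xs = r"
    and s: "successively (\<lambda>c d. {c, d} \<in> T1 \<union> T2) xs"
    using xs by (simp_all add: corner_path_def)
  show "distinct xs" by (fact d)
  show "xs ! 0 = l" "xs ! (length xs - 1) = r" using h la ne by (simp_all add: hd_conv_nth last_conv_nth)
  show "2 \<le> length xs"
  proof (rule ccontr)
    assume "\<not> 2 \<le> length xs"
    moreover have "length xs \<noteq> 0" using ne by simp
    ultimately have "length xs = 1" by linarith
    then show False using \<open>xs ! 0 = l\<close> \<open>xs ! (length xs - 1) = r\<close> corners by simp
  qed
  show "{xs ! i, xs ! Suc i} \<in> T1 \<union> T2" if "Suc i < length xs" for i
    using s that by (simp add: successively_conv_nth)
qed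

lemma nth_inj: "i < length xs \<Longrightarrow> j < length xs \<Longrightarrow> xs ! i = xs ! j \<longleftrightarrow> i = j"
  using path_basic(1) by (simp add: nth_eq_iff_index_eq)

text \<open>The first step is in \<open>T2\<close> since \<open>T1\<close> does not cover
  \<open>l\<close>; afterwards a step in the same tiling as its predecessor would return to the cell
  before.\<close>

lemma path_alternates:
  assumes "Suc i < length xs"
  shows "if even i then {xs ! i, xs ! Suc i} \<in> T2 else {xs ! i, xs ! Suc i} \<in> T1"
  using assms
proof (induction i)
  case 0
  then show ?case using path_basic(5)[of 0] path_basic(2) not_edge(1) by simp
next
  case (Suc i)
  have IH: "if even i then {xs ! i, xs ! Suc i} \<in> T2 else {xs ! i, xs ! Suc i} \<in> T1" using Suc by simp
  have e: "{xs ! Suc i, xs ! Suc (Suc i)} \<in> T1 \<union> T2" using path_basic(5)[of "Suc i"] Suc.prems by simp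
  have ne: "xs ! i \<noteq> xs ! Suc (Suc i)" using nth_inj[of i "Suc (Suc i)"] Suc.prems by simp
  show ?case
  proof (cases "even i")
    case True
    then have "{xs ! Suc i, xs ! i} \<in> T2" using IH by (simp add: insert_commute)
    then have "{xs ! Suc i, xs ! Suc (Suc i)} \<notin> T2" using ne unfolding edge2 by metis
    then show ?thesis using e True by simp
  next
    case False
    then have "{xs ! Suc i, xs ! i} \<in> T1" using IH by (simp add: insert_commute)
    then have "{xs ! Suc i, xs ! Suc (Suc i)} \<notin> T1" using ne unfolding edge1 by metis
    then show ?thesis using e False by simp
  qed
qed

text \<open>Otherwise the last step would be in \<open>T2\<close>, which does not cover
  \<open>r\<close>.\<close>

lemma odd_length: "odd (length xs)"
proof
  assume ev: "even (length xs)"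
  define k where "k = length xs - 2"
  have k: "Suc k < length xs" "even k" "Suc k = length xs - 1" using ev path_basic(4) by (simp_all add: k_def)
  have "{xs ! Suc k, xs ! k} \<in> T2" using path_alternates[OF k(1)] k(2) by (simp add: insert_commute)
  then show False using not_edge(2) path_basic(3) k(3) by simp
qed

lemma path_mem: "i < length xs \<Longrightarrow> xs ! i \<in> R"
proof -
  assume i: "i < length xs"
  show ?thesis
  proof (cases "Suc i < length xs")
    case True
    then show ?thesis using path_basic(5) edge_props(1) by blast
  next
    case False
    then have "i = length xs - 1" using i by simp
    then show ?thesis using path_basic(3) corners by simp
  qed
qed

text \<open>Every partner of a cell of the path is one of its neighbours on the path. With
  \<open>path_edge2\<close> this makes the path a whole component of the superposition.\<close>

lemma path_edge1:
  assumes i: "i < length xs"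
  shows "{xs ! i, d} \<in> T1 \<longleftrightarrow> (if even i then 0 < i \<and> d = xs ! (i - 1) else Suc i < length xs \<and> d = xs ! Suc i)"
proof (cases "even i")
  case True
  show ?thesis
  proof (cases "i = 0")
    case True
    then show ?thesis using not_edge(1) path_basic(2) by simp
  next
    case False
    then have k: "Suc (i - 1) < length xs" "odd (i - 1)" "Suc (i - 1) = i" using i True by simp_all
    have "{xs ! i, xs ! (i - 1)} \<in> T1" using path_alternates[OF k(1)] k(2,3) by (simp add: insert_commute)
    then show ?thesis using True False unfolding edge1 by auto
  qed
next
  case False
  then have k: "Suc i < length xs" using i odd_length by (metis Suc_lessI even_Suc)
  have "{xs ! i, xs ! Suc i} \<in> T1" using path_alternates[OF k] False by simp
  then show ?thesis using k False unfolding edge1 by auto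
qed

lemma path_edge2:
  assumes i: "i < length xs"
  shows "{xs ! i, d} \<in> T2 \<longleftrightarrow> (if even i then Suc i < length xs \<and> d = xs ! Suc i else 0 < i \<and> d = xs ! (i - 1))"
proof (cases "even i")
  case True
  show ?thesis
  proof (cases "Suc i < length xs")
    case False
    then have "i = length xs - 1" using i by simp
    then show ?thesis using not_edge(2) path_basic(3) True False by simp
  next
    case k: True
    have "{xs ! i, xs ! Suc i} \<in> T2" using path_alternates[OF k] True by simp
    then show ?thesis using True k unfolding edge2 by auto
  qed
next
  case False
  then have k: "Suc (i - 1) < length xs" "even (i - 1)" "Suc (i - 1) = i" "0 < i" using i by (simp_all add: odd_pos)
  have "{xs ! i, xs ! (i - 1)} \<in> T2" using path_alternates[OF k(1)] k(2,3) by (simp add: insert_commute)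
  then show ?thesis using k False unfolding edge2 by auto
qed

lemma path_closed1: "c \<in> set xs \<Longrightarrow> {c, d} \<in> T1 \<Longrightarrow> d \<in> set xs"
  unfolding in_set_conv_nth using path_edge1 by (metis less_imp_diff_less)

lemma path_closed2: "c \<in> set xs \<Longrightarrow> {c, d} \<in> T2 \<Longrightarrow> d \<in> set xs"
  unfolding in_set_conv_nth using path_edge2 by (metis less_imp_diff_less)

lemma path_colour: "i < length xs \<Longrightarrow> even_cell N (xs ! i) \<longleftrightarrow> even i"
proof (induction i)
  case 0
  then show ?case using path_basic(2) corners by simp
next
  case (Suc i)
  then have "cell_adjacent (xs ! i) (xs ! Suc i)" using path_basic(5) edge_props(3) by blast
  then show ?case using Suc even_cell_adjacent by simp
qed

text \<open>By alternation the path runs through dominos of \<open>T1\<close> from odd to even cells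
  and through dominos of \<open>T2\<close> from even to odd ones. This rule makes sense for all
  dominos, and \<open>cell_sgn\<close> encodes it.\<close>

lemma path_flow_eq:
  "path_flow xs c d = cell_sgn N c * of_bool (c \<in> set xs) * (of_bool ({c, d} \<in> T1) - of_bool ({c, d} \<in> T2))"
proof (cases "c \<in> set xs")
  case True
  then obtain i where i: "i < length xs" "c = xs ! i" by (metis in_set_conv_nth)
  show ?thesis
    unfolding path_flow_def i(2) path_step_nth[OF path_basic(1) i(1)] path_edge1[OF i(1)] path_edge2[OF i(1)]
      cell_sgn_def path_colour[OF i(1)]
    using i(1) by (cases "even i") (simp_all add: algebra_simps)
next
  case False
  then have "\<not> path_step xs c d" "\<not> path_step xs d c"
    unfolding path_step_def by (metis Suc_lessD nth_mem)+
  then show ?thesis using False by (simp add: path_flow_def)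
qed

text \<open>Both paths start at \<open>l\<close> and alternate in the same order, so every next cell
  is forced; neither meets \<open>r\<close> before its end.\<close>

lemma path_unique:
  assumes "corner_path N T1 T2 ys"
  shows "ys = xs"
proof -
  interpret Y: tiling_pair_path N n T1 T2 ys by unfold_locales (rule assms)
  have eq: "ys ! i = xs ! i" if "i < length xs" "i < length ys" for i
    using that
  proof (induction i)
    case 0
    then show ?case using path_basic(2) Y.path_basic(2) by simp
  next
    case (Suc i)
    then have IH: "ys ! i = xs ! i" by simp
    show ?case
    proof (cases "even i")
      case True
      have "{xs ! i, ys ! Suc i} \<in> T2" using Y.path_alternates[of i] Suc.prems True IH by simp
      then show ?thesis using path_edge2[of i "ys ! Suc i"] Suc.prems True by simp
    next
      case False
      have "{xs ! i, ys ! Suc i} \<in> T1" using Y.path_alternates[of i] Suc.prems False IH by simp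
      then show ?thesis using path_edge1[of i "ys ! Suc i"] Suc.prems False by simp
    qed
  qed
  have "length xs = length ys"
  proof (cases "length xs" "length ys" rule: linorder_cases)
    case less
    let ?k = "length xs - 1"
    have "ys ! ?k = ys ! (length ys - 1)"
      using eq[of ?k] path_basic(3,4) Y.path_basic(3) less by simp
    moreover have "?k < length ys" "length ys - 1 < length ys" using less by linarith+
    ultimately have "?k = length ys - 1" using Y.nth_inj by blast
    then show ?thesis using less path_basic(4) by linarith
  next
    case greater
    let ?k = "length ys - 1"
    have "xs ! ?k = xs ! (length xs - 1)"
      using eq[of ?k] Y.path_basic(3,4) path_basic(3) greater by simp
    moreover have "?k < length xs" "length xs - 1 < length xs" using greater by linarith+
    ultimately have "?k = length xs - 1" using nth_inj by blast
    then show ?thesis using greater Y.path_basic(4) by linarith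
  qed simp
  then show ?thesis using eq by (intro nth_equalityI) simp_all
qed

end

section \<open>Exchanging the tilings off the path\<close>

definition gpath :: "nat \<Rightarrow> cell set set \<Rightarrow> cell set set \<Rightarrow> cell list" where
  "gpath N T1 T2 = (THE xs. corner_path N T1 T2 xs)"

definition swap_off :: "cell set \<Rightarrow> cell set \<Rightarrow> cell set set \<Rightarrow> cell set set \<Rightarrow> cell set set" where
  "swap_off X S T T' = (\<lambda>c. {c, if c \<in> X then partner T c else partner T' c}) ` S"

text \<open>Closure of \<open>X\<close> under \<open>T\<close> and of its complement under
  \<open>T'\<close> is what makes the glued partner map an involution.\<close>

lemma swap_off_tiling:
  assumes T: "T \<in> domino_tilings S" and T': "T' \<in> domino_tilings S'"
    and X: "\<And>c. c \<in> S \<Longrightarrow> c \<in> X \<Longrightarrow> partner T c \<in> X" "\<And>c. c \<in> S' \<Longrightarrow> c \<notin> X \<Longrightarrow> partner T' c \<notin> X"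
    and S: "\<And>c. c \<notin> X \<Longrightarrow> c \<in> S \<longleftrightarrow> c \<in> S'"
  shows "swap_off X S T T' \<in> domino_tilings S"
    and "c \<in> S \<Longrightarrow> partner (swap_off X S T T') c = (if c \<in> X then partner T c else partner T' c)"
proof -
  let ?f = "\<lambda>c. if c \<in> X then partner T c else partner T' c"
  have f: "?f c \<in> S \<and> ?f (?f c) = c \<and> cell_adjacent c (?f c)" if c: "c \<in> S" for c
  proof (cases "c \<in> X")
    case True
    then show ?thesis using partner_props[OF T c] X(1)[OF c] by simp
  next
    case False
    then have c': "c \<in> S'" using S c by blast
    show ?thesis using partner_props[OF T' c'] X(2)[OF c' False] S False by simp
  qed
  show "swap_off X S T T' \<in> domino_tilings S" "c \<in> S \<Longrightarrow> partner (swap_off X S T T') c = ?f c"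
    unfolding swap_off_def using domino_tilingI[of S ?f] f by blast+
qed

lemma swap_off_swap:
  assumes T: "T \<in> domino_tilings S" and T': "T' \<in> domino_tilings S'"
    and X: "\<And>c. c \<in> S \<Longrightarrow> c \<in> X \<Longrightarrow> partner T c \<in> X" "\<And>c. c \<in> S \<Longrightarrow> c \<notin> X \<Longrightarrow> partner T c \<notin> X"
      "\<And>c. c \<in> S' \<Longrightarrow> c \<in> X \<Longrightarrow> partner T' c \<in> X" "\<And>c. c \<in> S' \<Longrightarrow> c \<notin> X \<Longrightarrow> partner T' c \<notin> X"
    and S: "\<And>c. c \<notin> X \<Longrightarrow> c \<in> S \<longleftrightarrow> c \<in> S'"
  shows "swap_off X S (swap_off X S T T') (swap_off X S' T' T) = T"
proof -
  note p = swap_off_tiling(2)[OF T T' X(1,4) S] swap_off_tiling(2)[OF T' T X(3,2) S[symmetric]]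
  have "swap_off X S (swap_off X S T T') (swap_off X S' T' T) = (\<lambda>c. {c, partner T c}) ` S"
    unfolding swap_off_def[of X S "swap_off X S T T'"]
  proof (rule image_cong[OF refl])
    fix c assume c: "c \<in> S"
    show "{c, if c \<in> X then partner (swap_off X S T T') c else partner (swap_off X S' T' T) c} = {c, partner T c}"
      using p[of c] c S[of c] by (cases "c \<in> X") simp_all
  qed
  then show ?thesis using tiling_eq_partner[OF T] by simp
qed

context tiling_pair
begin

lemma gpath: "corner_path N T1 T2 (gpath N T1 T2)"
proof -
  obtain xs where xs: "corner_path N T1 T2 xs" using corner_path_exists by blast
  interpret tiling_pair_path N n T1 T2 xs by unfold_locales (rule xs)
  show ?thesis unfolding gpath_def by (rule theI[of _ xs]) (auto intro: xs path_unique)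
qed

sublocale G: tiling_pair_path N n T1 T2 "gpath N T1 T2"
  by unfold_locales (rule gpath)

definition "X = set (gpath N T1 T2)"
definition "T1' = swap_off X (R - {l}) T1 T2"
definition "T2' = swap_off X (R - {r}) T2 T1"

lemma corners_X: "l \<in> X" "r \<in> X"
proof -
  have "0 < length (gpath N T1 T2)" using G.path_basic(4) by linarith
  then show "l \<in> X" "r \<in> X"
    unfolding X_def using G.path_basic(2,3) nth_mem[of 0 "gpath N T1 T2"]
      nth_mem[of "length (gpath N T1 T2) - 1" "gpath N T1 T2"] by simp_all
qed

lemma off_X: "c \<notin> X \<Longrightarrow> c \<noteq> l \<and> c \<noteq> r"
  using corners_X by metis

lemma X_closed:
  shows "\<And>c. c \<in> R - {l} \<Longrightarrow> c \<in> X \<Longrightarrow> partner T1 c \<in> X" "\<And>c. c \<in> R - {r} \<Longrightarrow> c \<in> X \<Longrightarrow> partner T2 c \<in> X"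
proof -
  show "partner T1 c \<in> X" if "c \<in> R - {l}" "c \<in> X" for c
    using G.path_closed1[of c "partner T1 c"] edge1[of c "partner T1 c"] that by (simp add: X_def)
  show "partner T2 c \<in> X" if "c \<in> R - {r}" "c \<in> X" for c
    using G.path_closed2[of c "partner T2 c"] edge2[of c "partner T2 c"] that by (simp add: X_def)
qed

lemma X_coclosed:
  shows "\<And>c. c \<in> R - {l} \<Longrightarrow> c \<notin> X \<Longrightarrow> partner T1 c \<notin> X" "\<And>c. c \<in> R - {r} \<Longrightarrow> c \<notin> X \<Longrightarrow> partner T2 c \<notin> X"
proof -
  show "partner T1 c \<notin> X" if "c \<in> R - {l}" "c \<notin> X" for c
    using X_closed(1)[of "partner T1 c"] partner_props[OF T1 that(1)] that(2) by metis
  show "partner T2 c \<notin> X" if "c \<in> R - {r}" "c \<notin> X" for c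
    using X_closed(2)[of "partner T2 c"] partner_props[OF T2 that(1)] that(2) by metis
qed

lemma off_X_iff: "c \<notin> X \<Longrightarrow> c \<in> R - {l} \<longleftrightarrow> c \<in> R - {r}"
  using off_X[of c] by simp

lemma swap1:
  shows "T1' \<in> domino_tilings (R - {l})"
    and "c \<in> R - {l} \<Longrightarrow> partner T1' c = (if c \<in> X then partner T1 c else partner T2 c)"
  unfolding T1'_def
  by (rule swap_off_tiling[OF T1 T2]; (rule X_closed(1) X_coclosed(2) off_X_iff)?; assumption)+

lemma swap2:
  shows "T2' \<in> domino_tilings (R - {r})"
    and "c \<in> R - {r} \<Longrightarrow> partner T2' c = (if c \<in> X then partner T2 c else partner T1 c)"
  unfolding T2'_def
  by (rule swap_off_tiling[OF T2 T1]; (rule X_closed(2) X_coclosed(1) off_X_iff[symmetric])?; assumption)+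

lemma swap_swap: "swap_off X (R - {l}) T1' T2' = T1" "swap_off X (R - {r}) T2' T1' = T2"
  unfolding T1'_def T2'_def
  by (rule swap_off_swap[OF T1 T2]; (rule X_closed X_coclosed off_X_iff); assumption)
     (rule swap_off_swap[OF T2 T1]; (rule X_closed X_coclosed off_X_iff[symmetric]); assumption)

lemma swap_edges:
  shows "c \<in> X \<Longrightarrow> {c, d} \<in> T1' \<longleftrightarrow> {c, d} \<in> T1" "c \<in> X \<Longrightarrow> {c, d} \<in> T2' \<longleftrightarrow> {c, d} \<in> T2"
    "c \<notin> X \<Longrightarrow> {c, d} \<in> T1' \<longleftrightarrow> {c, d} \<in> T2" "c \<notin> X \<Longrightarrow> {c, d} \<in> T2' \<longleftrightarrow> {c, d} \<in> T1"
  unfolding edge_iff_partner[OF swap1(1)] edge_iff_partner[OF swap2(1)] edge1 edge2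
  using swap1(2)[of c] swap2(2)[of c] off_X[of c] corners_X by auto

text \<open>All dominos on the path stay where they are, so the old path is a corner path of the new
  pair, and such a path is unique.\<close>

lemma swap_path: "gpath N T1' T2' = gpath N T1 T2"
proof -
  interpret S: tiling_pair N n T1' T2' by unfold_locales (fact N, fact swap1(1), fact swap2(1))
  let ?xs = "gpath N T1 T2"
  have "{?xs ! i, ?xs ! Suc i} \<in> T1' \<union> T2'" if "Suc i < length ?xs" for i
  proof -
    have "?xs ! i \<in> X" unfolding X_def using that by (intro nth_mem) simp
    then show ?thesis using G.path_basic(5)[OF that] swap_edges(1,2) by blast
  qed
  then have "corner_path N T1' T2' ?xs"
    using gpath unfolding corner_path_def by (simp add: successively_conv_nth)
  then interpret SP: tiling_pair_path N n T1' T2' ?xs by unfold_locales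
  show ?thesis by (rule SP.path_unique[OF S.gpath])
qed

text \<open>On the path both summands agree; off the path the exchange reverses the sign, and they
  cancel.\<close>

lemma flow_symmetrized:
  "2 * path_flow (gpath N T1 T2) c d =
     cell_sgn N c * (of_bool ({c, d} \<in> T1) - of_bool ({c, d} \<in> T2)) +
     cell_sgn N c * (of_bool ({c, d} \<in> T1') - of_bool ({c, d} \<in> T2'))"
proof (cases "c \<in> X")
  case True
  then show ?thesis using G.path_flow_eq[of c d] swap_edges(1,2)[OF True] by (simp add: X_def)
next
  case False
  then show ?thesis using G.path_flow_eq[of c d] swap_edges(3,4)[OF False] by (simp add: X_def algebra_simps)
qed

end

definition tiling_pairs :: "nat \<Rightarrow> nat \<Rightarrow> (cell set set \<times> cell set set) set" where
  "tiling_pairs N n = domino_tilings (rect_set N n - {left_corner N}) \<times> domino_tilings (rect_set N n - {right_corner N})"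

lemma finite_tiling_pairs: "finite (tiling_pairs N n)"
  unfolding tiling_pairs_def by (intro finite_cartesian_product finite_domino_tilings finite_Diff finite_rect_set)

lemma tiling_pairs_nonempty: "tiling_pairs N n \<noteq> {}"
  unfolding tiling_pairs_def using corner_tilings_nonempty by simp

text \<open>Exchanging the two tilings away from the path is a measure preserving involution which
  fixes the path and reverses the flow along all closed cycles.\<close>

lemma sum_path_flow:
  assumes N: "N > 0"
  shows "(\<Sum>p\<in>tiling_pairs N n. path_flow (gpath N (fst p) (snd p)) c d)
    = real (card (tiling_pairs N n)) * (cell_sgn N c *
       (edge_prob (rect_set N n - {left_corner N}) c d - edge_prob (rect_set N n - {right_corner N}) c d))"
proof -
  let ?D1 = "domino_tilings (rect_set N n - {left_corner N})"
  let ?D2 = "domino_tilings (rect_set N n - {right_corner N})"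
  define F where "F p = cell_sgn N c * (of_bool ({c, d} \<in> fst p) - of_bool ({c, d} \<in> snd p))"
    for p :: "cell set set \<times> cell set set"
  define \<Phi> where "\<Phi> p = (tiling_pair.T1' N n (fst p) (snd p), tiling_pair.T2' N n (fst p) (snd p))" for p
  have fin: "finite ?D1" "finite ?D2" by (simp_all add: finite_domino_tilings finite_rect_set)
  have tp: "tiling_pair N n (fst p) (snd p)" if "p \<in> tiling_pairs N n" for p
    using that N by unfold_locales (auto simp: tiling_pairs_def)
  have \<Phi>_mem: "\<Phi> p \<in> tiling_pairs N n" if "p \<in> tiling_pairs N n" for p
    using tiling_pair.swap1(1)[OF tp[OF that]] tiling_pair.swap2(1)[OF tp[OF that]]
    by (simp add: \<Phi>_def tiling_pairs_def)
  have \<Phi>_inv: "\<Phi> (\<Phi> p) = p" if "p \<in> tiling_pairs N n" for p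
  proof -
    note t = tp[OF that]
    have t': "tiling_pair N n (fst (\<Phi> p)) (snd (\<Phi> p))" by (rule tp[OF \<Phi>_mem[OF that]])
    have "tiling_pair.X N (fst (\<Phi> p)) (snd (\<Phi> p)) = tiling_pair.X N (fst p) (snd p)"
      unfolding tiling_pair.X_def[OF t] tiling_pair.X_def[OF t'] using tiling_pair.swap_path[OF t]
      by (simp add: \<Phi>_def)
    then show ?thesis
      using tiling_pair.swap_swap[OF t]
      unfolding \<Phi>_def[of "\<Phi> p"] tiling_pair.T1'_def[OF t'] tiling_pair.T2'_def[OF t']
      by (simp add: \<Phi>_def)
  qed
  have "(\<Sum>p\<in>tiling_pairs N n. F (\<Phi> p)) = (\<Sum>p\<in>tiling_pairs N n. F p)"
    by (rule sum.reindex_bij_witness[of _ \<Phi> \<Phi>]) (simp_all add: \<Phi>_mem \<Phi>_inv)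
  moreover have "2 * path_flow (gpath N (fst p) (snd p)) c d = F p + F (\<Phi> p)" if "p \<in> tiling_pairs N n" for p
    unfolding tiling_pair.flow_symmetrized[OF tp[OF that]] F_def \<Phi>_def by simp
  ultimately have "2 * (\<Sum>p\<in>tiling_pairs N n. path_flow (gpath N (fst p) (snd p)) c d)
      = 2 * (\<Sum>p\<in>tiling_pairs N n. F p)"
    by (simp add: sum_distrib_left sum.distrib)
  then have "(\<Sum>p\<in>tiling_pairs N n. path_flow (gpath N (fst p) (snd p)) c d) = (\<Sum>p\<in>tiling_pairs N n. F p)"
    by simp
  also have "\<dots> = cell_sgn N c * ((\<Sum>p\<in>?D1 \<times> ?D2. of_bool ({c, d} \<in> fst p)) - (\<Sum>p\<in>?D1 \<times> ?D2. of_bool ({c, d} \<in> snd p)))"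
    unfolding F_def tiling_pairs_def by (simp add: sum_distrib_left sum_subtractf algebra_simps)
  also have "(\<Sum>p\<in>?D1 \<times> ?D2. of_bool ({c, d} \<in> fst p)) = real (card {T \<in> ?D1. {c, d} \<in> T}) * real (card ?D2)"
  proof -
    have "(\<Sum>p\<in>?D1 \<times> ?D2. of_bool ({c, d} \<in> fst p) :: real) = (\<Sum>T\<in>?D1. \<Sum>T'\<in>?D2. of_bool ({c, d} \<in> T))"
      by (simp only: sum.cartesian_product case_prod_unfold)
    also have "\<dots> = real (card ?D2) * (\<Sum>T\<in>?D1. of_bool ({c, d} \<in> T))" by (simp add: sum_distrib_left)
    also have "(\<Sum>T\<in>?D1. of_bool ({c, d} \<in> T) :: real) = real (card {T \<in> ?D1. {c, d} \<in> T})"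
      using fin by (simp add: of_bool_def sum.If_cases Int_def)
    finally show ?thesis by simp
  qed
  also have "(\<Sum>p\<in>?D1 \<times> ?D2. of_bool ({c, d} \<in> snd p)) = real (card ?D1) * real (card {T \<in> ?D2. {c, d} \<in> T})"
  proof -
    have "(\<Sum>p\<in>?D1 \<times> ?D2. of_bool ({c, d} \<in> snd p) :: real) = (\<Sum>T\<in>?D1. \<Sum>T'\<in>?D2. of_bool ({c, d} \<in> T'))"
      by (simp only: sum.cartesian_product case_prod_unfold)
    also have "(\<Sum>T\<in>?D2. of_bool ({c, d} \<in> T) :: real) = real (card {T \<in> ?D2. {c, d} \<in> T})"
      using fin by (simp add: of_bool_def sum.If_cases Int_def)
    finally show ?thesis by simp
  qed
  also have "real (card {T \<in> ?D1. {c, d} \<in> T}) * real (card ?D2) - real (card ?D1) * real (card {T \<in> ?D2. {c, d} \<in> T})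
      = real (card ?D1) * real (card ?D2) * (edge_prob (rect_set N n - {left_corner N}) c d - edge_prob (rect_set N n - {right_corner N}) c d)"
    using corner_tilings_nonempty fin by (simp add: edge_prob_def right_diff_distrib)
  finally show ?thesis
    by (simp add: tiling_pairs_def card_cartesian_product)
qed

section \<open>The two sides of the path\<close>

locale lattice_path =
  fixes N n :: nat and xs :: "cell list"
  assumes N: "N > 0"
    and distinct: "distinct xs" and start: "xs ! 0 = left_corner N"
    and finish: "xs ! (length xs - 1) = right_corner N" and len: "2 \<le> length xs"
    and step_adjacent: "\<And>i. Suc i < length xs \<Longrightarrow> cell_adjacent (xs ! i) (xs ! Suc i)"
    and in_rect: "\<And>i. i < length xs \<Longrightarrow> xs ! i \<in> rect_set N n"
begin

definition linked :: "cell \<Rightarrow> cell \<Rightarrow> bool" where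
  "linked c d \<longleftrightarrow> path_step xs c d \<or> path_step xs d c"

lemma linked_sym: "linked c d \<longleftrightarrow> linked d c"
  by (auto simp: linked_def)

lemma len_pos: "0 < length xs" "length xs - 1 < length xs"
  using len by linarith+

lemma nth_eq: "i < length xs \<Longrightarrow> j < length xs \<Longrightarrow> xs ! i = xs ! j \<longleftrightarrow> i = j"
  using distinct by (simp add: nth_eq_iff_index_eq)

lemma step_nth:
  assumes "i < length xs"
  shows "path_step xs (xs ! i) d \<longleftrightarrow> Suc i < length xs \<and> d = xs ! Suc i"
    "path_step xs d (xs ! i) \<longleftrightarrow> 0 < i \<and> d = xs ! (i - 1)"
  using path_step_nth[OF distinct assms] by simp_all

lemma path_step_rect: "path_step xs c d \<Longrightarrow> c \<in> rect_set N n \<and> d \<in> rect_set N n \<and> cell_adjacent c d"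
  unfolding path_step_def using in_rect step_adjacent by (metis Suc_lessD)

lemma linked_rect: "linked c d \<Longrightarrow> c \<in> rect_set N n \<and> d \<in> rect_set N n \<and> cell_adjacent c d"
  unfolding linked_def using path_step_rect cell_adjacent_sym by blast

lemma flow_zero: "\<not> linked c d \<Longrightarrow> path_flow xs c d = 0"
  by (simp add: path_flow_def linked_def)

lemma flow_antisym: "path_flow xs c d = - path_flow xs d c"
  by (simp add: path_flow_def)

lemma sum_neighbours:
  assumes "cell_adjacent (x, y) e"
  shows "of_bool ((x + 1, y) = e) + of_bool ((x - 1, y) = e) + of_bool ((x, y + 1) = e) + of_bool ((x, y - 1) = e) = (1 :: real)"
proof -
  obtain u v where e: "e = (u, v)" by (cases e)
  show ?thesis using assms unfolding e cell_adjacent_iff by auto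
qed

text \<open>Successor and predecessor each occur once among the four neighbours and cancel, except
  at the two ends of the path.\<close>

lemma flow_divergence:
  "path_flow xs (x, y) (x + 1, y) + path_flow xs (x, y) (x - 1, y)
    + path_flow xs (x, y) (x, y + 1) + path_flow xs (x, y) (x, y - 1)
    = of_bool ((x, y) = left_corner N) - of_bool ((x, y) = right_corner N)"
proof (cases "(x, y) \<in> set xs")
  case True
  then obtain i where i: "i < length xs" "xs ! i = (x, y)" by (metis in_set_conv_nth)
  have f: "path_flow xs (x, y) d = of_bool (Suc i < length xs) * of_bool (d = xs ! Suc i)
      - of_bool (0 < i) * of_bool (d = xs ! (i - 1))" for d
    unfolding path_flow_def i(2)[symmetric] step_nth[OF i(1)] by simp
  have out: "of_bool (Suc i < length xs) * (of_bool ((x + 1, y) = xs ! Suc i) + of_bool ((x - 1, y) = xs ! Suc i)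
      + of_bool ((x, y + 1) = xs ! Suc i) + of_bool ((x, y - 1) = xs ! Suc i)) = (of_bool (Suc i < length xs) :: real)"
  proof (cases "Suc i < length xs")
    case True
    then show ?thesis using sum_neighbours[of x y "xs ! Suc i"] step_adjacent[OF True] i(2) by simp
  qed simp
  have inn: "of_bool (0 < i) * (of_bool ((x + 1, y) = xs ! (i - 1)) + of_bool ((x - 1, y) = xs ! (i - 1))
      + of_bool ((x, y + 1) = xs ! (i - 1)) + of_bool ((x, y - 1) = xs ! (i - 1))) = (of_bool (0 < i) :: real)"
  proof (cases "0 < i")
    case True
    then have "cell_adjacent (x, y) (xs ! (i - 1))"
      using step_adjacent[of "i - 1"] i cell_adjacent_sym by simp
    then show ?thesis using sum_neighbours[of x y "xs ! (i - 1)"] True by simp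
  qed simp
  have l: "(x, y) = left_corner N \<longleftrightarrow> i = 0"
    using nth_eq[OF i(1) len_pos(1)] i(2) start by simp
  have r: "(x, y) = right_corner N \<longleftrightarrow> i = length xs - 1"
    using nth_eq[OF i(1) len_pos(2)] i(2) finish by simp
  have "Suc i < length xs \<longleftrightarrow> i \<noteq> length xs - 1" using i len by auto
  then show ?thesis
    unfolding f l r using out inn by (simp add: algebra_simps)
next
  case False
  then have "\<not> path_step xs (x, y) d" "\<not> path_step xs d (x, y)" for d
    unfolding path_step_def by (metis Suc_lessD nth_mem)+
  moreover have "left_corner N \<in> set xs" "right_corner N \<in> set xs"
    using nth_mem[OF len_pos(1)] nth_mem[OF len_pos(2)] start finish by simp_all
  then have "(x, y) \<noteq> left_corner N" "(x, y) \<noteq> right_corner N" using False by metis+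
  ultimately show ?thesis by (simp add: path_flow_def)
qed

section \<open>The height function and lattice walks beside the path\<close>

definition outer :: "int \<Rightarrow> bool" where
  "outer a \<longleftrightarrow> a \<le> - int N \<or> int N + 1 \<le> a"

text \<open>Counts signed crossings of the path with the vertical line below \<open>(a, b)\<close>.
  The \<open>outer\<close> term continues the path along row 0 beyond both ends, so that source and
  sink disappear.\<close>

definition hgt :: "int \<Rightarrow> int \<Rightarrow> real" where
  "hgt a b = (\<Sum>y\<in>{0..<b}. path_flow xs (a - 1, y) (a, y)) + of_bool (outer a \<and> 1 \<le> b)"

lemma hgt_bottom: "hgt a 0 = 0"
  by (simp add: hgt_def)

lemma hgt_up:
  assumes "0 \<le> b"
  shows "hgt a (b + 1) = hgt a b + path_flow xs (a - 1, b) (a, b) + of_bool (outer a \<and> b = 0)"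
proof -
  have "{0..<b + 1} = insert b {0..<b}" using assms by auto
  then show ?thesis using assms by (simp add: hgt_def)
qed

lemma flow_outside: "c \<notin> rect_set N n \<Longrightarrow> path_flow xs c d = 0" "d \<notin> rect_set N n \<Longrightarrow> path_flow xs c d = 0"
  using linked_rect flow_zero by blast+

text \<open>Induction on the height by \<open>flow_divergence\<close>; the \<open>outer\<close> term
  compensates the two corners.\<close>

lemma hgt_right:
  assumes "0 \<le> b"
  shows "hgt (a + 1) b = hgt a b - path_flow xs (a, b - 1) (a, b)"
  using assms
proof (induction b rule: int_ge_induct)
  case base
  have "path_flow xs (a, 0 - 1) (a, 0) = 0" by (rule flow_outside(1)) (simp add: rect_set_iff)
  then show ?case by (simp add: hgt_bottom)
next
  case (step b)
  have "of_bool (outer (a + 1) \<and> b = 0) - of_bool (outer a \<and> b = 0)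
      = of_bool ((a, b) = right_corner N) - (of_bool ((a, b) = left_corner N) :: real)"
    using N by (auto simp: outer_def left_corner_def right_corner_def)
  then show ?case
    using flow_divergence[of a b] hgt_up[OF step(1), of a] hgt_up[OF step(1), of "a + 1"] step(2)
      flow_antisym[of "(a, b)" "(a - 1, b)"] flow_antisym[of "(a, b)" "(a, b - 1)"]
    by simp
qed

lemma hgt_right_eq: "0 \<le> b \<Longrightarrow> \<not> linked (a, b - 1) (a, b) \<Longrightarrow> hgt (a + 1) b = hgt a b"
  using hgt_right[of b a] flow_zero by simp

lemma hgt_up_eq: "0 \<le> b \<Longrightarrow> \<not> linked (a - 1, b) (a, b) \<Longrightarrow> \<not> (outer a \<and> b = 0) \<Longrightarrow> hgt a (b + 1) = hgt a b"
  using hgt_up[of b a] flow_zero by simp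

lemma hgt_outer: "1 \<le> b \<Longrightarrow> hgt (- int N) b = 1" "1 \<le> b \<Longrightarrow> hgt (int N + 1) b = 1"
proof -
  have "path_flow xs (- int N - 1, y) (- int N, y) = 0" for y
    by (rule flow_outside(1)) (simp add: rect_set_iff)
  then show "1 \<le> b \<Longrightarrow> hgt (- int N) b = 1" by (simp add: hgt_def outer_def)
  have "path_flow xs (int N, y) (int N + 1, y) = 0" for y
    by (rule flow_outside(2)) (simp add: rect_set_iff)
  then show "1 \<le> b \<Longrightarrow> hgt (int N + 1) b = 1" by (simp add: hgt_def outer_def)
qed

text \<open>The two bottom corners are left out because they lie on the curve.\<close>

definition lattice :: "int \<Rightarrow> int \<Rightarrow> bool" where
  "lattice a b \<longleftrightarrow> - int N \<le> a \<and> a \<le> int N + 1 \<and> 0 \<le> b \<and> b \<le> 2 * int n + 1 \<and> \<not> (outer a \<and> b = 0)"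

text \<open>Walks along lattice edges that the path does not cross, a combinatorial form of
  connectedness off the curve.\<close>

inductive conn :: "int \<times> int \<Rightarrow> int \<times> int \<Rightarrow> bool" where
  refl: "conn p p"
| right: "conn p (a, b) \<Longrightarrow> lattice a b \<Longrightarrow> lattice (a + 1) b \<Longrightarrow> \<not> linked (a, b - 1) (a, b) \<Longrightarrow> conn p (a + 1, b)"
| left: "conn p (a + 1, b) \<Longrightarrow> lattice a b \<Longrightarrow> lattice (a + 1) b \<Longrightarrow> \<not> linked (a, b - 1) (a, b) \<Longrightarrow> conn p (a, b)"
| up: "conn p (a, b) \<Longrightarrow> lattice a b \<Longrightarrow> lattice a (b + 1) \<Longrightarrow> \<not> linked (a - 1, b) (a, b) \<Longrightarrow> conn p (a, b + 1)"
| down: "conn p (a, b + 1) \<Longrightarrow> lattice a b \<Longrightarrow> lattice a (b + 1) \<Longrightarrow> \<not> linked (a - 1, b) (a, b) \<Longrightarrow> conn p (a, b)"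

lemma conn_trans: "conn q r \<Longrightarrow> conn p q \<Longrightarrow> conn p r"
  by (induction rule: conn.induct) (blast intro: conn.intros)+

lemma conn_sym: "conn p q \<Longrightarrow> conn q p"
proof (induction rule: conn.induct)
  case (refl p)
  show ?case by (rule conn.refl)
next
  case (right p a b)
  then show ?case using conn_trans conn.left[OF conn.refl] by metis
next
  case (left p a b)
  then show ?case using conn_trans conn.right[OF conn.refl] by metis
next
  case (up p a b)
  then show ?case using conn_trans conn.down[OF conn.refl] by metis
next
  case (down p a b)
  then show ?case using conn_trans conn.up[OF conn.refl] by metis
qed

lemma hgt_conn: "conn p q \<Longrightarrow> hgt (fst q) (snd q) = hgt (fst p) (snd p)"
  by (induction rule: conn.induct) (simp_all add: hgt_right_eq hgt_up_eq lattice_def)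

text \<open>The endpoint to the left of the common side of two adjacent cells when crossing
  it from \<open>c\<close> to \<open>d\<close>.\<close>

definition lft :: "cell \<Rightarrow> cell \<Rightarrow> int \<times> int" where
  "lft c d = (fst c + (1 + (fst d - fst c) - (snd d - snd c)) div 2,
              snd c + (1 + (fst d - fst c) + (snd d - snd c)) div 2)"

lemma lft_values:
  "lft (x - 1, y) (x, y) = (x, y + 1)" "lft (x + 1, y) (x, y) = (x + 1, y)"
  "lft (x, y - 1) (x, y) = (x, y)" "lft (x, y + 1) (x, y) = (x + 1, y + 1)"
  "lft (x, y) (x + 1, y) = (x + 1, y + 1)" "lft (x, y) (x - 1, y) = (x, y)"
  "lft (x, y) (x, y + 1) = (x, y + 1)" "lft (x, y) (x, y - 1) = (x + 1, y)"
  by (simp_all add: lft_def)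

text \<open>Going around the cell \<open>d\<close>, from the left of its entrance to the left of its
  exit, uses only sides that the path does not cross.\<close>

lemma turn:
  assumes d: "d \<in> rect_set N n" "d \<noteq> left_corner N" "d \<noteq> right_corner N"
    and c: "cell_adjacent d c" and e: "cell_adjacent d e" and ce: "c \<noteq> e"
    and free: "\<And>f. linked d f \<Longrightarrow> f = c \<or> f = e"
  shows "conn (lft c d) (lft d e)"
proof -
  obtain x y where xy: "d = (x, y)" by (cases d)
  have lat: "lattice x y" "lattice (x + 1) y" "lattice x (y + 1)" "lattice (x + 1) (y + 1)"
    using d by (auto simp: xy lattice_def rect_set_iff outer_def left_corner_def right_corner_def)
  have U: "conn (x, y + 1) (x + 1, y + 1)" "conn (x + 1, y + 1) (x, y + 1)" if "\<not> linked (x, y) (x, y + 1)"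
    using conn.right[OF conn.refl, of x "y + 1"] conn.left[OF conn.refl, of x "y + 1"] lat that by simp_all
  have D: "conn (x, y) (x + 1, y)" "conn (x + 1, y) (x, y)" if "\<not> linked (x, y) (x, y - 1)"
    using conn.right[OF conn.refl, of x y] conn.left[OF conn.refl, of x y] lat that linked_sym by metis+
  have L: "conn (x, y) (x, y + 1)" "conn (x, y + 1) (x, y)" if "\<not> linked (x, y) (x - 1, y)"
    using conn.up[OF conn.refl, of x y] conn.down[OF conn.refl, of x y] lat that linked_sym by metis+
  have Rr: "conn (x + 1, y) (x + 1, y + 1)" "conn (x + 1, y + 1) (x + 1, y)" if "\<not> linked (x, y) (x + 1, y)"
    using conn.up[OF conn.refl, of "x + 1" y] conn.down[OF conn.refl, of "x + 1" y] lat that by simp_all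
  have dirs: "f = (x + 1, y) \<or> f = (x - 1, y) \<or> f = (x, y + 1) \<or> f = (x, y - 1)" if "cell_adjacent d f" for f
    using that by (cases f) (simp add: xy cell_adjacent_iff)
  have nl: "\<not> linked (x, y) f" if "f \<noteq> c" "f \<noteq> e" for f using free[of f] that unfolding xy by blast
  have two: "\<not> linked (x, y) (x, y + 1) \<Longrightarrow> \<not> linked (x, y) (x + 1, y) \<Longrightarrow> conn (x, y + 1) (x + 1, y)"
    "\<not> linked (x, y) (x, y - 1) \<Longrightarrow> \<not> linked (x, y) (x - 1, y) \<Longrightarrow> conn (x + 1, y) (x, y + 1)"
    "\<not> linked (x, y) (x - 1, y) \<Longrightarrow> \<not> linked (x, y) (x, y + 1) \<Longrightarrow> conn (x, y) (x + 1, y + 1)"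
    "\<not> linked (x, y) (x + 1, y) \<Longrightarrow> \<not> linked (x, y) (x, y - 1) \<Longrightarrow> conn (x + 1, y + 1) (x, y)"
    using conn_trans[OF Rr(2) U(1)] conn_trans[OF L(1) D(2)] conn_trans[OF U(1) L(1)] conn_trans[OF D(2) Rr(2)]
    by blast+
  from dirs[OF c] dirs[OF e] ce nl show ?thesis
    unfolding xy
    by (elim disjE) (simp_all add: lft_values conn.refl U D L Rr two)
qed

lemma neighbours:
  assumes "Suc (Suc i) < length xs" "linked (xs ! Suc i) f"
  shows "f = xs ! i \<or> f = xs ! Suc (Suc i)"
  using assms step_nth[of "Suc i" f] by (auto simp: linked_def)

text \<open>Induction along the path, one \<open>turn\<close> at each cell. With its arguments
  reversed \<open>lft\<close> is the right side, so \<open>turn\<close> serves both claims.\<close>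

lemma sides_connected:
  assumes "Suc i < length xs"
  shows "conn (lft (xs ! i) (xs ! Suc i)) (- int N, 1)" "conn (lft (xs ! Suc i) (xs ! i)) (1 - int N, 0)"
proof -
  have "conn (lft (xs ! i) (xs ! Suc i)) (- int N, 1) \<and> conn (lft (xs ! Suc i) (xs ! i)) (1 - int N, 0)"
    using assms
  proof (induction i)
    case 0
    let ?l = "(- int N, 0 :: int)"
    obtain u v where uv: "xs ! Suc 0 = (u, v)" by (cases "xs ! Suc 0")
    have l: "xs ! 0 = ?l" using start by (simp add: left_corner_def)
    have adj: "cell_adjacent ?l (u, v)" using step_adjacent[of 0] 0 l uv by simp
    have "(u, v) \<in> rect_set N n" using in_rect[of "Suc 0"] 0 uv by simp
    then have b: "0 \<le> v" "- int N \<le> u" "v \<le> 2 * int n" by (simp_all add: rect_set_iff)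
    have free: "\<not> linked ?l f" if "f \<noteq> (u, v)" for f
      using step_nth[OF len_pos(1), of f] that uv l 0 by (auto simp: linked_def)
    have lat: "lattice (- int N) 1" "lattice (1 - int N) 0" "lattice (1 - int N) 1"
      using N by (auto simp: lattice_def outer_def)
    \<comment> \<open>The path leaves the corner cell through its right or its top side. In the
      first case a walk along the top reaches \<open>(- int N, 1)\<close>, in the second a walk
      along the right side reaches \<open>(1 - int N, 0)\<close>.\<close>
    consider "u = 1 - int N" "v = 0" | "u = - int N" "v = 1"
      using adj b unfolding cell_adjacent_iff by fastforce
    then show ?case
    proof cases
      case 1
      have "\<not> linked (- int N, 1 - 1) (- int N, 1)" using free[of "(- int N, 1)"] 1 by simp
      then have "conn (1 - int N, 1) (- int N, 1)"
        using conn.left[OF conn.refl, of "- int N" 1] lat by (simp add: add.commute)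
      then show ?thesis using 1 l uv by (simp add: lft_def conn.refl)
    next
      case 2
      have "\<not> linked (1 - int N - 1, 0) (1 - int N, 0)" using free[of "(1 - int N, 0)"] 2 by simp
      then have "conn (1 - int N, 1) (1 - int N, 0)"
        using conn.down[OF conn.refl, of "1 - int N" 0] lat by simp
      then show ?thesis using 2 l uv by (simp add: lft_def conn.refl)
    qed
  next
    case (Suc i)
    let ?c = "xs ! i" and ?d = "xs ! Suc i" and ?e = "xs ! Suc (Suc i)"
    have IH: "conn (lft ?c ?d) (- int N, 1)" "conn (lft ?d ?c) (1 - int N, 0)" using Suc by simp_all
    have d: "?d \<in> rect_set N n" "?d \<noteq> left_corner N" "?d \<noteq> right_corner N"
      using in_rect[of "Suc i"] nth_eq[OF _ len_pos(1), of "Suc i"] nth_eq[OF _ len_pos(2), of "Suc i"]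
        start finish Suc.prems by simp_all
    have adj: "cell_adjacent ?d ?c" "cell_adjacent ?d ?e"
      using step_adjacent[of i] step_adjacent[of "Suc i"] Suc.prems cell_adjacent_sym by simp_all
    have ce: "?c \<noteq> ?e" using nth_eq[of i "Suc (Suc i)"] Suc.prems by simp
    have "conn (lft ?c ?d) (lft ?d ?e)"
      by (rule turn[OF d adj ce]) (rule neighbours[OF Suc.prems])
    moreover have "conn (lft ?e ?d) (lft ?d ?c)"
      by (rule turn[OF d adj(2,1) ce[symmetric]]) (use neighbours[OF Suc.prems] in blast)
    ultimately show ?case using IH conn_trans conn_sym by blast
  qed
  then show "conn (lft (xs ! i) (xs ! Suc i)) (- int N, 1)" "conn (lft (xs ! Suc i) (xs ! i)) (1 - int N, 0)"
    by simp_all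
qed

text \<open>A straight walk downwards reaches the bottom or stops at a step of the path; the
  direction of this step tells on which of its sides the walk has arrived.\<close>

lemma above_or_below:
  assumes a: "\<not> outer a" and b: "0 \<le> b" "b \<le> 2 * int n + 1"
  shows "conn (a, b) (- int N, 1) \<or> (\<exists>a'. \<not> outer a' \<and> conn (a, b) (a', 0))"
  using b
proof (induction b rule: int_ge_induct)
  case base
  then show ?case using a conn.refl by blast
next
  case (step b)
  have lat: "lattice a b" "lattice a (b + 1)" using a step by (auto simp: lattice_def outer_def)
  show ?case
  proof (cases "linked (a - 1, b) (a, b)")
    case False
    then have "conn (a, b + 1) (a, b)" using conn.down[OF conn.refl] lat by blast
    then show ?thesis using step conn_trans[of "(a, b)" _ "(a, b + 1)"] by auto
  next
    case True
    then consider i where "Suc i < length xs" "xs ! i = (a - 1, b)" "xs ! Suc i = (a, b)"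
      | i where "Suc i < length xs" "xs ! i = (a, b)" "xs ! Suc i = (a - 1, b)"
      unfolding linked_def path_step_def by blast
    then show ?thesis
    proof cases
      case 1
      then show ?thesis using sides_connected(1)[OF 1(1)] lft_values(1)[of a b] by simp
    next
      case 2
      have "\<not> outer (1 - int N)" using N by (simp add: outer_def)
      then show ?thesis using sides_connected(2)[OF 2(1)] lft_values(1)[of a b] 2 by auto
    qed
  qed
qed

text \<open>Height is constant along \<open>conn\<close>, is 1 at \<open>(- int N, 1)\<close> and 0
  at the bottom; no other value can occur.\<close>

lemma hgt_cases:
  assumes a: "\<not> outer a" and b: "0 \<le> b" "b \<le> 2 * int n + 1"
  shows "hgt a b = 1 \<or> hgt a b = 0 \<and> (\<exists>a'. \<not> outer a' \<and> conn (a, b) (a', 0))"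
  using above_or_below[OF assms] hgt_conn hgt_outer(1)[of 1] hgt_bottom by fastforce

end

section \<open>The curve in the plane\<close>

lemma closed_segment_centres:
  "z \<in> closed_segment (cell_centre (x, y)) (cell_centre (x + 1, y)) \<longleftrightarrow>
     Im z = of_int y + 1 / 2 \<and> of_int x + 1 / 2 \<le> Re z \<and> Re z \<le> of_int x + 3 / 2"
  "z \<in> closed_segment (cell_centre (x, y)) (cell_centre (x, y + 1)) \<longleftrightarrow>
     Re z = of_int x + 1 / 2 \<and> of_int y + 1 / 2 \<le> Im z \<and> Im z \<le> of_int y + 3 / 2"
  by (auto simp: cell_centre_def lattice_point_def closed_segment_same_Re closed_segment_same_Im
      closed_segment_eq_real_ivl)

lemma closed_segment_lattice:
  "z \<in> closed_segment (lattice_point (a, b)) (lattice_point (a + 1, b)) \<longleftrightarrow>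
     Im z = of_int b \<and> of_int a \<le> Re z \<and> Re z \<le> of_int a + 1"
  "z \<in> closed_segment (lattice_point (a, b)) (lattice_point (a, b + 1)) \<longleftrightarrow>
     Re z = of_int a \<and> of_int b \<le> Im z \<and> Im z \<le> of_int b + 1"
  by (auto simp: lattice_point_def closed_segment_same_Re closed_segment_same_Im
      closed_segment_eq_real_ivl)

text \<open>Describes the end segments, from a bottom corner to the centre of its cell;
  \<open>s\<close> is the slope.\<close>

lemma closed_segment_diagonal:
  assumes "s = 1 \<or> s = - 1"
  shows "z \<in> closed_segment (Complex x 0) (Complex (x + s / 2) (1 / 2)) \<longleftrightarrow>
    Re z = x + s * Im z \<and> 0 \<le> Im z \<and> Im z \<le> 1 / 2"
proof
  assume "z \<in> closed_segment (Complex x 0) (Complex (x + s / 2) (1 / 2))"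
  then obtain u where u: "0 \<le> u" "u \<le> 1" "z = (1 - u) *\<^sub>R Complex x 0 + u *\<^sub>R Complex (x + s / 2) (1 / 2)"
    unfolding closed_segment_def by blast
  then have "Re z = x + s * (u / 2)" "Im z = u / 2"
    unfolding u(3) by (simp_all add: algebra_simps)
  then show "Re z = x + s * Im z \<and> 0 \<le> Im z \<and> Im z \<le> 1 / 2" using u by simp
next
  assume z: "Re z = x + s * Im z \<and> 0 \<le> Im z \<and> Im z \<le> 1 / 2"
  then have "z = (1 - 2 * Im z) *\<^sub>R Complex x 0 + (2 * Im z) *\<^sub>R Complex (x + s / 2) (1 / 2)"
    by (intro complex_eqI) (simp_all add: algebra_simps)
  then show "z \<in> closed_segment (Complex x 0) (Complex (x + s / 2) (1 / 2))"
    unfolding closed_segment_def using z by (intro CollectI exI[of _ "2 * Im z"]) simp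
qed

lemma gamma_curve_iff:
  assumes "xs \<noteq> []"
  shows "z \<in> gamma_curve n L xs \<longleftrightarrow>
    z \<in> closed_segment (lattice_point (bottom_left n L)) (cell_centre (xs ! 0)) \<or>
    (\<exists>i. Suc i < length xs \<and> z \<in> closed_segment (cell_centre (xs ! i)) (cell_centre (xs ! Suc i))) \<or>
    z \<in> closed_segment (cell_centre (xs ! (length xs - 1))) (lattice_point (bottom_right n L))"
proof -
  let ?p = "lattice_point (bottom_left n L)" and ?q = "lattice_point (bottom_right n L)"
  let ?ps = "[?p] @ map cell_centre xs @ [?q]"
  have len: "0 < length xs" using assms by simp
  have nth: "?ps ! 0 = ?p" "\<And>i. i < length xs \<Longrightarrow> ?ps ! Suc i = cell_centre (xs ! i)" "?ps ! Suc (length xs) = ?q"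
    by (simp_all add: nth_append)
  have "z \<in> gamma_curve n L xs \<longleftrightarrow> (\<exists>i. i \<le> length xs \<and> z \<in> closed_segment (?ps ! i) (?ps ! Suc i))"
    unfolding gamma_curve_def polyline_def by (auto simp: less_Suc_eq_le)
  also have "\<dots> \<longleftrightarrow> z \<in> closed_segment (?ps ! 0) (?ps ! Suc 0) \<or>
      (\<exists>i. Suc i < length xs \<and> z \<in> closed_segment (?ps ! Suc i) (?ps ! Suc (Suc i))) \<or>
      z \<in> closed_segment (?ps ! length xs) (?ps ! Suc (length xs))"
  proof
    assume "\<exists>i. i \<le> length xs \<and> z \<in> closed_segment (?ps ! i) (?ps ! Suc i)"
    then obtain i where i: "i \<le> length xs" "z \<in> closed_segment (?ps ! i) (?ps ! Suc i)" by blast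
    consider "i = 0" | "i = length xs" | j where "i = Suc j" "Suc j < length xs"
      using i(1) by (metis le_neq_implies_less not0_implies_Suc)
    then show "z \<in> closed_segment (?ps ! 0) (?ps ! Suc 0) \<or>
      (\<exists>i. Suc i < length xs \<and> z \<in> closed_segment (?ps ! Suc i) (?ps ! Suc (Suc i))) \<or>
      z \<in> closed_segment (?ps ! length xs) (?ps ! Suc (length xs))"
      using i(2) by cases blast+
  next
    assume "z \<in> closed_segment (?ps ! 0) (?ps ! Suc 0) \<or>
      (\<exists>i. Suc i < length xs \<and> z \<in> closed_segment (?ps ! Suc i) (?ps ! Suc (Suc i))) \<or>
      z \<in> closed_segment (?ps ! length xs) (?ps ! Suc (length xs))"
    then show "\<exists>i. i \<le> length xs \<and> z \<in> closed_segment (?ps ! i) (?ps ! Suc i)"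
      by (metis le0 less_imp_le_nat order_refl)
  qed
  also have "(\<exists>i. Suc i < length xs \<and> z \<in> closed_segment (?ps ! Suc i) (?ps ! Suc (Suc i))) \<longleftrightarrow>
      (\<exists>i. Suc i < length xs \<and> z \<in> closed_segment (cell_centre (xs ! i)) (cell_centre (xs ! Suc i)))"
    using nth(2) by (metis Suc_lessD)
  also have "?ps ! length xs = cell_centre (xs ! (length xs - 1))"
    using nth(2)[of "length xs - 1"] len by simp
  finally show ?thesis unfolding nth(1,3) nth(2)[OF len] .
qed

locale lattice_curve = lattice_path +
  fixes L :: nat
  assumes NL: "N = n * L"
begin

abbreviation "C \<equiv> gamma_curve n L xs"

definition diag_left :: "complex \<Rightarrow> bool" where
  "diag_left z \<longleftrightarrow> Re z = Im z - real N \<and> 0 \<le> Im z \<and> Im z \<le> 1 / 2"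
definition diag_right :: "complex \<Rightarrow> bool" where
  "diag_right z \<longleftrightarrow> Re z = real N + 1 - Im z \<and> 0 \<le> Im z \<and> Im z \<le> 1 / 2"
definition link_h :: "complex \<Rightarrow> bool" where
  "link_h z \<longleftrightarrow> (\<exists>x y. linked (x, y) (x + 1, y) \<and> Im z = of_int y + 1 / 2 \<and> of_int x + 1 / 2 \<le> Re z \<and> Re z \<le> of_int x + 3 / 2)"
definition link_v :: "complex \<Rightarrow> bool" where
  "link_v z \<longleftrightarrow> (\<exists>x y. linked (x, y) (x, y + 1) \<and> Re z = of_int x + 1 / 2 \<and> of_int y + 1 / 2 \<le> Im z \<and> Im z \<le> of_int y + 3 / 2)"

lemma curve_iff: "z \<in> C \<longleftrightarrow> diag_left z \<or> diag_right z \<or> link_h z \<or> link_v z"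
proof -
  have ne: "xs \<noteq> []" using len_pos by auto
  have "z \<in> closed_segment (lattice_point (bottom_left n L)) (cell_centre (xs ! 0)) \<longleftrightarrow> diag_left z"
  proof -
    have "lattice_point (bottom_left n L) = Complex (- real N) 0"
      "cell_centre (xs ! 0) = Complex (- real N + 1 / 2) (1 / 2)"
      unfolding bottom_left_def NL[symmetric] start
      by (simp_all add: lattice_point_def cell_centre_def left_corner_def complex_eq_iff)
    then show ?thesis using closed_segment_diagonal[of 1 z "- real N"] by (auto simp: diag_left_def)
  qed
  moreover have "z \<in> closed_segment (cell_centre (xs ! (length xs - 1))) (lattice_point (bottom_right n L)) \<longleftrightarrow> diag_right z"
  proof -
    have "lattice_point (bottom_right n L) = Complex (real N + 1) 0"
      "cell_centre (xs ! (length xs - 1)) = Complex (real N + 1 + - 1 / 2) (1 / 2)"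
      unfolding bottom_right_def NL[symmetric] finish
      by (simp_all add: lattice_point_def cell_centre_def right_corner_def complex_eq_iff)
    then show ?thesis using closed_segment_diagonal[of "- 1" z "real N + 1"]
      by (auto simp: diag_right_def closed_segment_commute)
  qed
  moreover have "(\<exists>i. Suc i < length xs \<and> z \<in> closed_segment (cell_centre (xs ! i)) (cell_centre (xs ! Suc i)))
      \<longleftrightarrow> link_h z \<or> link_v z"
  proof
    assume "\<exists>i. Suc i < length xs \<and> z \<in> closed_segment (cell_centre (xs ! i)) (cell_centre (xs ! Suc i))"
    then obtain i where i: "Suc i < length xs" "z \<in> closed_segment (cell_centre (xs ! i)) (cell_centre (xs ! Suc i))"
      by blast
    obtain x y u v where c: "xs ! i = (x, y)" "xs ! Suc i = (u, v)" by (meson surj_pair)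
    have ln: "linked (x, y) (u, v)" "linked (u, v) (x, y)"
      using i(1) c unfolding linked_def path_step_def by blast+
    have z: "z \<in> closed_segment (cell_centre (x, y)) (cell_centre (u, v))"
      "z \<in> closed_segment (cell_centre (u, v)) (cell_centre (x, y))"
      using i(2) c by (simp_all add: closed_segment_commute)
    have "cell_adjacent (x, y) (u, v)" using step_adjacent[OF i(1)] c by simp
    then consider "u = x + 1" "v = y" | "x = u + 1" "v = y" | "u = x" "v = y + 1" | "u = x" "y = v + 1"
      unfolding cell_adjacent_iff by fastforce
    then show "link_h z \<or> link_v z"
    proof cases
      case 1
      then show ?thesis using ln(1) z(1) closed_segment_centres(1)[of z x y] unfolding link_h_def by blast
    next
      case 2
      then show ?thesis using ln(2) z(2) closed_segment_centres(1)[of z u v] unfolding link_h_def by blast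
    next
      case 3
      then show ?thesis using ln(1) z(1) closed_segment_centres(2)[of z x y] unfolding link_v_def by blast
    next
      case 4
      then show ?thesis using ln(2) z(2) closed_segment_centres(2)[of z u v] unfolding link_v_def by blast
    qed
  next
    have seg: "\<exists>i. Suc i < length xs \<and> z \<in> closed_segment (cell_centre (xs ! i)) (cell_centre (xs ! Suc i))"
      if "linked c d" "z \<in> closed_segment (cell_centre c) (cell_centre d)" for c d
      using that unfolding linked_def path_step_def by (metis closed_segment_commute)
    assume "link_h z \<or> link_v z"
    then show "\<exists>i. Suc i < length xs \<and> z \<in> closed_segment (cell_centre (xs ! i)) (cell_centre (xs ! Suc i))"
      unfolding link_h_def link_v_def closed_segment_centres[symmetric] using seg by blast
  qed
  ultimately show ?thesis unfolding gamma_curve_iff[OF ne] by blast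
qed

lemma rect_iff: "z \<in> rect n L \<longleftrightarrow> - real N \<le> Re z \<and> Re z \<le> real N + 1 \<and> 0 \<le> Im z \<and> Im z \<le> 2 * real n + 1"
  unfolding rect_def NL[symmetric] by (auto simp: in_cbox_complex_iff)

lemma bottom_side_iff: "z \<in> bottom_side n L \<longleftrightarrow> Im z = 0 \<and> - real N \<le> Re z \<and> Re z \<le> real N + 1"
  unfolding bottom_side_def bottom_left_def bottom_right_def NL[symmetric]
  by (auto simp: lattice_point_def closed_segment_same_Im closed_segment_eq_real_ivl)

text \<open>Duality: the common side of the unit boxes centred at \<open>(a, b)\<close> and
  \<open>(a + 1, b)\<close> is the segment between the centres of the cells
  \<open>(a, b - 1)\<close> and \<open>(a, b)\<close>.\<close>

lemma on_curve_h:
  assumes "linked (a, b - 1) (a, b)" "Re z = of_int a + 1 / 2" "\<bar>Im z - of_int b\<bar> \<le> 1 / 2"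
  shows "z \<in> C"
proof -
  have "link_v z"
    unfolding link_v_def
  proof (intro exI conjI)
    show "linked (a, b - 1) (a, b - 1 + 1)" using assms(1) by simp
    show "Re z = of_int a + 1 / 2" by (fact assms(2))
    show "of_int (b - 1) + 1 / 2 \<le> Im z" "Im z \<le> of_int (b - 1) + 3 / 2"
      using assms(3) unfolding abs_le_iff by simp_all
  qed
  then show ?thesis by (simp add: curve_iff)
qed

lemma on_curve_v:
  assumes "linked (a - 1, b) (a, b)" "Im z = of_int b + 1 / 2" "\<bar>Re z - of_int a\<bar> \<le> 1 / 2"
  shows "z \<in> C"
proof -
  have "link_h z"
    unfolding link_h_def
  proof (intro exI conjI)
    show "linked (a - 1, b) (a - 1 + 1, b)" using assms(1) by simp
    show "Im z = of_int b + 1 / 2" by (fact assms(2))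
    show "of_int (a - 1) + 1 / 2 \<le> Re z" "Re z \<le> of_int (a - 1) + 3 / 2"
      using assms(3) unfolding abs_le_iff by simp_all
  qed
  then show ?thesis by (simp add: curve_iff)
qed

text \<open>A lattice edge meets the grid through the cell centres only in its midpoint, where only
  the link across it can pass; the end segments touch lattice edges only in the two bottom
  corners.\<close>

lemma off_curve_h:
  assumes "lattice a b" "lattice (a + 1) b" "\<not> linked (a, b - 1) (a, b)"
    and z: "Im z = of_int b" "of_int a \<le> Re z" "Re z \<le> of_int a + 1"
  shows "z \<in> rect n L - C"
proof -
  have ab: "- int N \<le> a" "a \<le> int N" "0 \<le> b" "b \<le> 2 * int n + 1" "b = 0 \<Longrightarrow> - int N < a" "b = 0 \<Longrightarrow> a < int N"
    using assms(1,2) by (auto simp: lattice_def outer_def)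
  have "\<not> diag_left z"
  proof
    assume d: "diag_left z"
    then have "b = 0" using z ab by (simp add: diag_left_def)
    then show False using d z ab(5) by (simp add: diag_left_def)
  qed
  moreover have "\<not> diag_right z"
  proof
    assume d: "diag_right z"
    then have "b = 0" using z ab by (simp add: diag_right_def)
    then show False using d z ab(6) by (simp add: diag_right_def)
  qed
  moreover have "\<not> link_h z"
  proof
    assume "link_h z"
    then obtain y :: int where "of_int b = of_int y + (1 / 2 :: real)" unfolding link_h_def z(1) by blast
    then have "y < b" "b < y + 1" by linarith+
    then show False by simp
  qed
  moreover have "\<not> link_v z"
  proof
    assume "link_v z"
    then obtain x y where l: "linked (x, y) (x, y + 1)" "Re z = of_int x + 1 / 2"
      "of_int y + 1 / 2 \<le> (of_int b :: real)" "(of_int b :: real) \<le> of_int y + 3 / 2"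
      unfolding link_v_def z(1) by blast
    have "y < b" "b < y + 2" "x < a + 1" "a < x + 1" using l z by linarith+
    then have "x = a" "y = b - 1" by simp_all
    then show False using l(1) assms(3) by simp
  qed
  ultimately have "z \<notin> C" unfolding curve_iff by blast
  moreover have "z \<in> rect n L" unfolding rect_iff using z ab by simp
  ultimately show ?thesis by blast
qed

lemma off_curve_v:
  assumes "lattice a b" "lattice a (b + 1)" "\<not> linked (a - 1, b) (a, b)"
    and z: "Re z = of_int a" "of_int b \<le> Im z" "Im z \<le> of_int b + 1"
  shows "z \<in> rect n L - C"
proof -
  have ab: "- int N \<le> a" "a \<le> int N + 1" "0 \<le> b" "b \<le> 2 * int n" "b = 0 \<Longrightarrow> - int N < a" "b = 0 \<Longrightarrow> a < int N + 1"
    using assms(1,2) by (auto simp: lattice_def outer_def)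
  have "\<not> diag_left z"
  proof
    assume d: "diag_left z"
    then have b: "b = 0" using z ab by (simp add: diag_left_def)
    have "a < - int N + 1" "- int N < a" using d z ab(5)[OF b] by (auto simp: diag_left_def)
    then show False by simp
  qed
  moreover have "\<not> diag_right z"
  proof
    assume d: "diag_right z"
    then have b: "b = 0" using z ab by (simp add: diag_right_def)
    have "real_of_int a \<ge> real N + 1 / 2" using d z by (simp add: diag_right_def)
    then have "int N < a" by linarith
    then show False using ab(6)[OF b] by simp
  qed
  moreover have "\<not> link_v z"
  proof
    assume "link_v z"
    then obtain x :: int where "of_int a = of_int x + (1 / 2 :: real)" unfolding link_v_def z(1) by blast
    then have "x < a" "a < x + 1" by linarith+
    then show False by simp
  qed
  moreover have "\<not> link_h z"
  proof
    assume "link_h z"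
    then obtain x y where l: "linked (x, y) (x + 1, y)" "Im z = of_int y + 1 / 2"
      "of_int x + 1 / 2 \<le> (of_int a :: real)" "(of_int a :: real) \<le> of_int x + 3 / 2"
      unfolding link_h_def z(1) by blast
    have "x < a" "a < x + 2" "y < b + 1" "b < y + 1" using l z by linarith+
    then have "x = a - 1" "y = b" by simp_all
    then show False using l(1) assms(3) by simp
  qed
  ultimately have "z \<notin> C" unfolding curve_iff by blast
  moreover have "z \<in> rect n L" unfolding rect_iff using z ab by simp
  ultimately show ?thesis by blast
qed

lemma lattice_off_curve:
  assumes "lattice a b"
  shows "lattice_point (a, b) \<in> rect n L - C"
proof -
  have ab: "- int N \<le> a" "a \<le> int N + 1" "0 \<le> b" "b \<le> 2 * int n + 1" "b = 0 \<Longrightarrow> - int N < a" "b = 0 \<Longrightarrow> a < int N + 1"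
    using assms by (auto simp: lattice_def outer_def)
  have "\<not> link_h (lattice_point (a, b))"
  proof
    assume "link_h (lattice_point (a, b))"
    then obtain y :: int where "of_int b = of_int y + (1 / 2 :: real)"
      unfolding link_h_def by (auto simp: lattice_point_def)
    then have "y < b" "b < y + 1" by linarith+
    then show False by simp
  qed
  moreover have "\<not> link_v (lattice_point (a, b))"
  proof
    assume "link_v (lattice_point (a, b))"
    then obtain x :: int where "of_int a = of_int x + (1 / 2 :: real)"
      unfolding link_v_def by (auto simp: lattice_point_def)
    then have "x < a" "a < x + 1" by linarith+
    then show False by simp
  qed
  moreover have "\<not> diag_left (lattice_point (a, b))" "\<not> diag_right (lattice_point (a, b))"
    using ab by (auto simp: diag_left_def diag_right_def lattice_point_def)
  moreover have "lattice_point (a, b) \<in> rect n L"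
    unfolding rect_iff using ab by (simp add: lattice_point_def)
  ultimately show ?thesis by (simp add: curve_iff)
qed

lemma segment_connects:
  fixes p q :: complex
  assumes "closed_segment p q \<subseteq> S"
  shows "connected_component S p q" "connected_component S q p"
  unfolding connected_component_def using assms
  by (auto intro!: exI[of _ "closed_segment p q"] convex_connected)

section \<open>Closed sets separating the two sides\<close>

text \<open>Boxes around lattice points have cell centres as corners, so the curve runs along their
  sides, apart from its two end segments.\<close>

definition box :: "int \<Rightarrow> int \<Rightarrow> complex set" where
  "box a b = {z. \<bar>Re z - of_int a\<bar> \<le> 1 / 2 \<and> \<bar>Im z - of_int b\<bar> \<le> 1 / 2}"

lemma box_iff: "z \<in> box a b \<longleftrightarrow> \<bar>Re z - of_int a\<bar> \<le> 1 / 2 \<and> \<bar>Im z - of_int b\<bar> \<le> 1 / 2"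
  by (simp add: box_def)

lemma closed_box: "closed (box a b)"
  unfolding box_def by (intro closed_Collect_conj closed_Collect_le continuous_intros)

lemma box_step_h:
  assumes z: "z \<in> box a b" "z \<in> box a' b" and b: "0 \<le> b" and h: "hgt a b \<noteq> hgt a' b"
  shows "z \<in> C"
proof -
  have *: "z \<in> C" if "z \<in> box a b" "z \<in> box (a + 1) b" "hgt a b \<noteq> hgt (a + 1) b" for a
  proof -
    have "linked (a, b - 1) (a, b)" using hgt_right_eq[OF b, of a] that(3) by metis
    moreover have "Re z = of_int a + 1 / 2" using that(1,2) unfolding box_iff abs_le_iff by simp
    ultimately show ?thesis using on_curve_h that(1) unfolding box_iff by blast
  qed
  have "a' < a + 2" "a < a' + 2" using z unfolding box_iff abs_le_iff by linarith+
  then consider "a' = a" | "a' = a + 1" | "a = a' + 1" by linarith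
  then show ?thesis using *[of a] *[of a'] z h by cases auto
qed

lemma box_step_v:
  assumes z: "z \<in> box a b" "z \<in> box a b'" and b: "0 \<le> b" "0 \<le> b'" and h: "hgt a b \<noteq> hgt a b'"
    and o: "\<not> (outer a \<and> (b = 0 \<or> b' = 0))"
  shows "z \<in> C"
proof -
  have *: "z \<in> C" if "z \<in> box a b" "z \<in> box a (b + 1)" "hgt a b \<noteq> hgt a (b + 1)" "0 \<le> b" "\<not> (outer a \<and> b = 0)" for b
  proof -
    have "linked (a - 1, b) (a, b)" using hgt_up_eq[OF that(4) _ that(5)] that(3) by metis
    moreover have "Im z = of_int b + 1 / 2" using that(1,2) unfolding box_iff abs_le_iff by simp
    ultimately show ?thesis using on_curve_v that(1) unfolding box_iff by blast
  qed
  have "b' < b + 2" "b < b' + 2" using z unfolding box_iff abs_le_iff by linarith+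
  then consider "b' = b" | "b' = b + 1" | "b = b' + 1" by linarith
  then show ?thesis using *[of b] *[of b'] z h b o by cases auto
qed

text \<open>Boxes that touch in a corner are compared through one of the two boxes in between. The
  case distinction avoids a vertical step into a bottom corner, where the height jumps without a
  step of the path; if both columns are outer, both heights are 1.\<close>

lemma box_separation:
  assumes z: "z \<in> box a b" "z \<in> box a' b'" and lat: "lattice a b" "lattice a' b'" and h: "hgt a b \<noteq> hgt a' b'"
  shows "z \<in> C"
proof -
  have z': "z \<in> box a' b" "z \<in> box a b'" using z by (simp_all add: box_iff)
  have b: "0 \<le> b" "0 \<le> b'" using lat by (simp_all add: lattice_def)
  show ?thesis
  proof (cases "outer a'")
    case False
    then show ?thesis using box_step_h[OF z(1) z'(1) b(1)] box_step_v[OF z'(1) z(2) b] h by metis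
  next
    case True
    then have b': "b' \<noteq> 0" using lat(2) by (simp add: lattice_def)
    show ?thesis
    proof (cases "outer a")
      case False
      then show ?thesis using box_step_v[OF z(1) z'(2) b] box_step_h[OF z'(2) z(2) b(2)] h by metis
    next
      case o: True
      then have "b \<noteq> 0" using lat(1) by (simp add: lattice_def)
      moreover have "a = - int N \<or> a = int N + 1" "a' = - int N \<or> a' = int N + 1"
        using o True lat by (auto simp: outer_def lattice_def)
      ultimately show ?thesis using h hgt_outer b b' by (metis int_one_le_iff_zero_less order_le_less)
    qed
  qed
qed

text \<open>The boxes of the two bottom corners are cut in two by the end segments of the curve.\<close>

definition tri_left_above :: "complex set" where
  "tri_left_above = {z. - real N \<le> Re z \<and> Im z \<le> 1 / 2 \<and> Re z + real N \<le> Im z}"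
definition tri_left_below :: "complex set" where
  "tri_left_below = {z. 0 \<le> Im z \<and> Re z \<le> - real N + 1 / 2 \<and> Im z \<le> Re z + real N}"
definition tri_right_above :: "complex set" where
  "tri_right_above = {z. Re z \<le> real N + 1 \<and> Im z \<le> 1 / 2 \<and> real N + 1 - Re z \<le> Im z}"
definition tri_right_below :: "complex set" where
  "tri_right_below = {z. 0 \<le> Im z \<and> real N + 1 / 2 \<le> Re z \<and> Im z \<le> real N + 1 - Re z}"

lemmas tri_defs = tri_left_above_def tri_left_below_def tri_right_above_def tri_right_below_def

text \<open>Two closed sets covering the rectangle. As they meet only on the curve, no connected set
  off the curve can touch both.\<close>

definition above_set :: "complex set" where
  "above_set = (\<Union>p\<in>{p. lattice (fst p) (snd p) \<and> hgt (fst p) (snd p) = 1}. box (fst p) (snd p))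
     \<union> tri_left_above \<union> tri_right_above"
definition below_set :: "complex set" where
  "below_set = (\<Union>p\<in>{p. lattice (fst p) (snd p) \<and> hgt (fst p) (snd p) \<noteq> 1}. box (fst p) (snd p))
     \<union> tri_left_below \<union> tri_right_below"

lemma finite_lattice: "finite {p. lattice (fst p) (snd p) \<and> Q p}"
  by (rule finite_subset[of _ "{- int N..int N + 1} \<times> {0..2 * int n + 1}"]) (auto simp: lattice_def)

lemma closed_above_below: "closed above_set" "closed below_set"
proof -
  have "closed tri_left_above" "closed tri_left_below" "closed tri_right_above" "closed tri_right_below"
    unfolding tri_defs by (intro closed_Collect_conj closed_Collect_le continuous_intros)+
  moreover have "closed (\<Union>p\<in>{p. lattice (fst p) (snd p) \<and> Q p}. box (fst p) (snd p))" for Q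
    by (rule closed_UN[OF finite_lattice]) (simp add: closed_box)
  ultimately show "closed above_set" "closed below_set"
    unfolding above_set_def below_set_def by (simp_all only: closed_Un)
qed

text \<open>The nearest lattice point supplies a box; if it is a bottom corner, the point is on one
  side of the diagonal there.\<close>

lemma rect_cover: "rect n L \<subseteq> above_set \<union> below_set"
proof
  fix z assume "z \<in> rect n L"
  then have z: "- real N \<le> Re z" "Re z \<le> real N + 1" "0 \<le> Im z" "Im z \<le> 2 * real n + 1"
    by (simp_all add: rect_iff)
  define a where "a = \<lfloor>Re z + 1 / 2\<rfloor>"
  define b where "b = \<lfloor>Im z + 1 / 2\<rfloor>"
  have box: "z \<in> box a b" unfolding box_iff a_def b_def abs_le_iff by linarith
  have ab: "- int N \<le> a" "a \<le> int N + 1" "0 \<le> b" "b \<le> 2 * int n + 1"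
    unfolding a_def b_def using z by linarith+
  show "z \<in> above_set \<union> below_set"
  proof (cases "lattice a b")
    case True
    then show ?thesis using box unfolding above_set_def below_set_def by force
  next
    case False
    then have b0: "b = 0" and o: "a = - int N \<or> a = int N + 1" using ab by (auto simp: lattice_def outer_def)
    have im: "Im z \<le> 1 / 2" using box b0 unfolding box_iff abs_le_iff by simp
    from o show ?thesis
    proof
      assume "a = - int N"
      then have "Re z \<le> - real N + 1 / 2" using box unfolding box_iff abs_le_iff by simp
      then have "z \<in> tri_left_above \<or> z \<in> tri_left_below" using z im unfolding tri_defs by auto
      then show ?thesis unfolding above_set_def below_set_def by blast
    next
      assume "a = int N + 1"
      then have "real N + 1 / 2 \<le> Re z" using box unfolding box_iff abs_le_iff by simp
      then have "z \<in> tri_right_above \<or> z \<in> tri_right_below" using z im unfolding tri_defs by auto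
      then show ?thesis unfolding above_set_def below_set_def by blast
    qed
  qed
qed

lemma corner_centre: "Im z = 1 / 2 \<Longrightarrow> Re z = - real N + 1 / 2 \<or> Re z = real N + 1 / 2 \<Longrightarrow> z \<in> C"
  by (auto simp: curve_iff diag_left_def diag_right_def)

text \<open>The part of the corner box inside the rectangle has three neighbouring boxes: one meets
  it in its top side, one in its right side, one in the cell centre.\<close>

lemma box_near_left:
  assumes "z \<in> box a b" "lattice a b" "Re z \<le> - real N + 1 / 2" "0 \<le> Im z" "Im z \<le> 1 / 2" "- real N \<le> Re z"
  shows "a = - int N \<and> b = 1 \<and> Im z = 1 / 2 \<or> a = 1 - int N \<and> b = 0 \<and> Re z = - real N + 1 / 2 \<or>
    Im z = 1 / 2 \<and> Re z = - real N + 1 / 2"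
proof -
  have z: "Re z - of_int a \<le> 1 / 2" "of_int a - Re z \<le> 1 / 2" "Im z - of_int b \<le> 1 / 2" "of_int b - Im z \<le> 1 / 2"
    using assms(1) unfolding box_iff abs_le_iff by simp_all
  have "a < - int N + 2" "b < 2" using z assms by linarith+
  moreover have "- int N \<le> a" "0 \<le> b" "\<not> (a = - int N \<and> b = 0)" using assms(2) by (auto simp: lattice_def outer_def)
  ultimately consider "a = - int N" "b = 1" | "a = 1 - int N" "b = 0" | "a = 1 - int N" "b = 1" by linarith
  then show ?thesis using z assms by cases auto
qed

lemma box_near_right:
  assumes "z \<in> box a b" "lattice a b" "real N + 1 / 2 \<le> Re z" "0 \<le> Im z" "Im z \<le> 1 / 2" "Re z \<le> real N + 1"
  shows "a = int N + 1 \<and> b = 1 \<and> Im z = 1 / 2 \<or> a = int N \<and> b = 0 \<and> Re z = real N + 1 / 2 \<or>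
    Im z = 1 / 2 \<and> Re z = real N + 1 / 2"
proof -
  have z: "Re z - of_int a \<le> 1 / 2" "of_int a - Re z \<le> 1 / 2" "Im z - of_int b \<le> 1 / 2" "of_int b - Im z \<le> 1 / 2"
    using assms(1) unfolding box_iff abs_le_iff by simp_all
  have "int N - 1 < a" "b < 2" using z assms by linarith+
  moreover have "a \<le> int N + 1" "0 \<le> b" "\<not> (a = int N + 1 \<and> b = 0)" using assms(2) by (auto simp: lattice_def outer_def)
  ultimately consider "a = int N + 1" "b = 1" | "a = int N" "b = 0" | "a = int N" "b = 1" by linarith
  then show ?thesis using z assms by cases auto
qed

text \<open>The box above the corner has height 1, and the boxes beside it touch the upper triangle
  only in the cell centre, which is on the curve.\<close>

lemma tri_box_above:
  assumes "z \<in> tri_left_above \<or> z \<in> tri_right_above" "z \<in> box a b" "lattice a b" "hgt a b \<noteq> 1"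
  shows "z \<in> C"
  using assms(1)
proof
  assume t: "z \<in> tri_left_above"
  then show ?thesis
    using box_near_left[OF assms(2,3)] hgt_outer(1)[of 1] assms(4) corner_centre[of z] unfolding tri_defs by auto
next
  assume t: "z \<in> tri_right_above"
  then show ?thesis
    using box_near_right[OF assms(2,3)] hgt_outer(2)[of 1] assms(4) corner_centre[of z] unfolding tri_defs by auto
qed

lemma tri_box_below:
  assumes "z \<in> tri_left_below \<or> z \<in> tri_right_below" "z \<in> box a b" "lattice a b" "hgt a b = 1"
  shows "z \<in> C"
  using assms(1)
proof
  assume t: "z \<in> tri_left_below"
  then show ?thesis
    using box_near_left[OF assms(2,3)] hgt_bottom[of a] assms(4) corner_centre[of z] unfolding tri_defs by auto
next
  assume t: "z \<in> tri_right_below"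
  then show ?thesis
    using box_near_right[OF assms(2,3)] hgt_bottom[of a] assms(4) corner_centre[of z] unfolding tri_defs by auto
qed

lemma tri_tri:
  assumes "z \<in> tri_left_above \<or> z \<in> tri_right_above" "z \<in> tri_left_below \<or> z \<in> tri_right_below"
  shows "z \<in> C"
proof -
  have "real N \<ge> 1" using N by simp
  then show ?thesis
    using assms unfolding curve_iff tri_defs diag_left_def diag_right_def by auto
qed

lemma above_below_disjoint: "above_set \<inter> below_set \<subseteq> C"
proof
  fix z assume "z \<in> above_set \<inter> below_set"
  then have A: "(\<exists>a b. lattice a b \<and> hgt a b = 1 \<and> z \<in> box a b) \<or> z \<in> tri_left_above \<or> z \<in> tri_right_above"
    and B: "(\<exists>a b. lattice a b \<and> hgt a b \<noteq> 1 \<and> z \<in> box a b) \<or> z \<in> tri_left_below \<or> z \<in> tri_right_below"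
    unfolding above_set_def below_set_def by blast+
  show "z \<in> C"
    using A B box_separation[of z] tri_box_above[of z] tri_box_below[of z] tri_tri[of z] by metis
qed

lemma bottom_below: "bottom_side n L \<subseteq> below_set"
proof
  fix z assume "z \<in> bottom_side n L"
  then have z: "Im z = 0" "- real N \<le> Re z" "Re z \<le> real N + 1" by (simp_all add: bottom_side_iff)
  define a where "a = \<lfloor>Re z + 1 / 2\<rfloor>"
  have box: "z \<in> box a 0" unfolding box_iff a_def abs_le_iff using z by simp linarith
  have ab: "- int N \<le> a" "a \<le> int N + 1" unfolding a_def using z by linarith+
  show "z \<in> below_set"
  proof (cases "lattice a 0")
    case True
    then show ?thesis using box hgt_bottom[of a] unfolding below_set_def by force
  next
    case False
    then have "a = - int N \<or> a = int N + 1" using ab by (auto simp: lattice_def outer_def)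
    then have "z \<in> tri_left_below \<or> z \<in> tri_right_below"
      using z box unfolding box_iff abs_le_iff tri_defs by auto
    then show ?thesis unfolding below_set_def by blast
  qed
qed

lemma conn_connected:
  assumes "conn p q" "lattice (fst p) (snd p)"
  shows "connected_component (rect n L - C) (lattice_point p) (lattice_point q)"
  using assms
proof (induction rule: conn.induct)
  case (refl p)
  then show ?case using lattice_off_curve[of "fst p" "snd p"] by (simp add: connected_component_refl)
next
  case (right p a b)
  have "closed_segment (lattice_point (a, b)) (lattice_point (a + 1, b)) \<subseteq> rect n L - C"
    using off_curve_h[OF right(2,3,4)] closed_segment_lattice(1) by blast
  then show ?case using right segment_connects(1) connected_component_trans by metis
next
  case (left p a b)
  have "closed_segment (lattice_point (a, b)) (lattice_point (a + 1, b)) \<subseteq> rect n L - C"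
    using off_curve_h[OF left(2,3,4)] closed_segment_lattice(1) by blast
  then show ?case using left segment_connects(2) connected_component_trans by metis
next
  case (up p a b)
  have "closed_segment (lattice_point (a, b)) (lattice_point (a, b + 1)) \<subseteq> rect n L - C"
    using off_curve_v[OF up(2,3,4)] closed_segment_lattice(2) by blast
  then show ?case using up segment_connects(1) connected_component_trans by metis
next
  case (down p a b)
  have "closed_segment (lattice_point (a, b)) (lattice_point (a, b + 1)) \<subseteq> rect n L - C"
    using off_curve_v[OF down(2,3,4)] closed_segment_lattice(2) by blast
  then show ?case using down segment_connects(2) connected_component_trans by metis
qed

text \<open>At height 1 a connected set off the curve that reached the bottom would meet both closed
  sets; at height 0 a lattice walk leads to the bottom.\<close>

lemma lies_above_iff_hgt:
  assumes a: "\<not> outer a" and b: "0 \<le> b" "b \<le> 2 * int n + 1"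
  shows "of_bool (lies_above n L (a, b) xs) = hgt a b"
proof -
  have lat: "lattice a b" using assms by (auto simp: lattice_def outer_def)
  show ?thesis
    using hgt_cases[OF assms]
  proof
    assume h: "hgt a b = 1"
    have "\<not> connected_component (rect n L - C) (lattice_point (a, b)) q" if q: "q \<in> bottom_side n L - C" for q
    proof
      assume "connected_component (rect n L - C) (lattice_point (a, b)) q"
      then obtain K where K: "connected K" "K \<subseteq> rect n L - C" "lattice_point (a, b) \<in> K" "q \<in> K"
        unfolding connected_component_def by blast
      have "above_set \<inter> below_set \<inter> K = {}" using above_below_disjoint K(2) by blast
      moreover have "K \<subseteq> above_set \<union> below_set" using rect_cover K(2) by blast
      ultimately have "above_set \<inter> K = {} \<or> below_set \<inter> K = {}"
        by (rule connected_closedD[OF K(1) _ _ closed_above_below])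
      moreover have "lattice_point (a, b) \<in> box a b" by (simp add: box_iff lattice_point_def)
      then have "lattice_point (a, b) \<in> above_set" using lat h unfolding above_set_def by force
      moreover have "q \<in> below_set" using bottom_below q by blast
      ultimately show False using K(3,4) by blast
    qed
    then have "lies_above n L (a, b) xs"
      unfolding lies_above_def using lattice_off_curve[OF lat] by blast
    then show ?thesis using h by simp
  next
    assume "hgt a b = 0 \<and> (\<exists>a'. \<not> outer a' \<and> conn (a, b) (a', 0))"
    then obtain a' where h: "hgt a b = 0" and a': "\<not> outer a'" "conn (a, b) (a', 0)" by blast
    have "lattice a' 0" using a'(1) by (auto simp: lattice_def outer_def)
    then have "lattice_point (a', 0) \<in> rect n L - C" by (rule lattice_off_curve)
    moreover have "lattice_point (a', 0) \<in> bottom_side n L"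
      unfolding bottom_side_iff using a'(1) by (simp add: lattice_point_def outer_def)
    moreover have "connected_component (rect n L - C) (lattice_point (a, b)) (lattice_point (a', 0))"
      using conn_connected[OF a'(2)] lat by simp
    ultimately have "\<not> lies_above n L (a, b) xs" unfolding lies_above_def by blast
    then show ?thesis using h by simp
  qed
qed

end

section \<open>The probability of lying above the path\<close>

lemma corner_simps:
  "R1 n L = rect_set (n * L) n - {left_corner (n * L)}" "R2 n L = rect_set (n * L) n - {right_corner (n * L)}"
  "gamma_path n L T1 T2 = gpath (n * L) T1 T2"
  unfolding R1_def R2_def rect_cells_eq rect_set_def left_cell_def right_cell_def left_corner_def right_corner_def
    gamma_path_def gpath_def corner_path_def by (rule refl)+

lemma pair_pmf_of_set:
  assumes "finite A" "A \<noteq> {}" "finite B" "B \<noteq> {}"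
  shows "pair_pmf (pmf_of_set A) (pmf_of_set B) = pmf_of_set (A \<times> B)"
proof (rule pmf_eqI)
  fix z
  show "pmf (pair_pmf (pmf_of_set A) (pmf_of_set B)) z = pmf (pmf_of_set (A \<times> B)) z"
    using assms by (cases z) (simp add: pmf_pair indicator_def card_cartesian_product)
qed

lemma prob_tiling_pair_law:
  "measure_pmf.prob (tiling_pair_law n L) E
    = real (card (tiling_pairs (n * L) n \<inter> E)) / real (card (tiling_pairs (n * L) n))"
proof -
  have "tiling_pair_law n L = pmf_of_set (tiling_pairs (n * L) n)"
    unfolding tiling_pair_law_def corner_simps tiling_pairs_def
    by (rule pair_pmf_of_set) (simp_all add: finite_domino_tilings finite_rect_set corner_tilings_nonempty)
  then show ?thesis
    by (simp add: measure_pmf_of_set[OF tiling_pairs_nonempty finite_tiling_pairs])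
qed

lemma tiling_pair_lattice_curve:
  assumes "n * L > 0" "p \<in> tiling_pairs (n * L) n"
  shows "lattice_curve (n * L) n (gpath (n * L) (fst p) (snd p)) L"
proof -
  interpret tiling_pair "n * L" n "fst p" "snd p"
    using assms by unfold_locales (auto simp: tiling_pairs_def)
  show ?thesis
    by unfold_locales
      (use assms(1) G.path_basic G.path_mem edge_props(3) in \<open>simp_all\<close>)
qed

text \<open>Exact in every finite rectangle: the probability is a value of the explicit harmonic
  function, and limits enter only afterwards.\<close>

lemma prob_lies_above:
  assumes N: "n * L > 0" and a: "- int (n * L) < a" "a \<le> int (n * L)" and b: "0 \<le> b" "b \<le> 2 * int n + 1"
  shows "measure_pmf.prob (tiling_pair_law n L) {(T1, T2). lies_above n L (a, b) (gamma_path n L T1 T2)}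
    = strip_solution (n * L) (Suc n) (of_int ((a - 1 + int (n * L)) div 2)) (of_int ((b + 1) div 2))"
proof -
  define N where "N = n * L"
  let ?P = "tiling_pairs N n"
  let ?g = "\<lambda>p. gpath N (fst p) (snd p)"
  have fin: "finite ?P" "card ?P > 0"
    using finite_tiling_pairs tiling_pairs_nonempty by (simp_all add: card_gt_0_iff)
  have ind: "of_bool (lies_above n L (a, b) (?g p)) = (\<Sum>y\<in>{0..<b}. path_flow (?g p) (a - 1, y) (a, y))"
    if p: "p \<in> ?P" for p
  proof -
    interpret lattice_curve N n "?g p" L
      unfolding N_def by (rule tiling_pair_lattice_curve[OF N]) (use p in \<open>simp add: N_def\<close>)
    have "\<not> outer a" using a[folded N_def] by (simp add: outer_def)
    then show ?thesis using lies_above_iff_hgt[of a b] b unfolding hgt_def by simp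
  qed
  have "real (card (?P \<inter> {(T1, T2). lies_above n L (a, b) (gamma_path n L T1 T2)}))
      = (\<Sum>p\<in>?P. of_bool (lies_above n L (a, b) (?g p)))"
    using fin(1) unfolding corner_simps N_def[symmetric]
    by (simp add: of_bool_def sum.If_cases case_prod_unfold)
  also have "\<dots> = (\<Sum>p\<in>?P. \<Sum>y\<in>{0..<b}. path_flow (?g p) (a - 1, y) (a, y))"
    by (intro sum.cong refl ind)
  also have "\<dots> = (\<Sum>y\<in>{0..<b}. \<Sum>p\<in>?P. path_flow (?g p) (a - 1, y) (a, y))"
    by (rule sum.swap)
  also have "\<dots> = (\<Sum>y\<in>{0..<b}. real (card ?P) * ((if even_cell N (a - 1, y) then - 1 else 1) *
      (edge_prob (rect_set N n - {left_corner N}) (a - 1, y) (a, y)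
       - edge_prob (rect_set N n - {right_corner N}) (a - 1, y) (a, y))))"
    using N unfolding cell_sgn_def[symmetric] by (intro sum.cong refl sum_path_flow) (simp add: N_def)
  also have "\<dots> = real (card ?P) * strip_solution N (Suc n) (of_int ((a - 1 + int N) div 2)) (of_int ((b + 1) div 2))"
    unfolding sum_distrib_left[symmetric]
    using N a b by (subst mean_crossing_eq_strip_solution) (simp_all only: N_def)
  finally show ?thesis
    using fin(2) unfolding prob_tiling_pair_law N_def[symmetric] by simp
qed

lemma bounded_distance_limit:
  assumes "\<forall>\<^sub>F n in sequentially. \<bar>u n - real n * c\<bar> \<le> K"
  shows "(\<lambda>n. u n / real (Suc n)) \<longlonglongrightarrow> c"
proof -
  have "(\<lambda>n. (u n - real n * c) / real (Suc n)) \<longlonglongrightarrow> 0"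
  proof (rule Lim_null_comparison)
    show "\<forall>\<^sub>F n in sequentially. norm ((u n - real n * c) / real (Suc n)) \<le> K / real (Suc n)"
      using assms by eventually_elim (simp add: divide_right_mono)
    show "(\<lambda>n. K / real (Suc n)) \<longlonglongrightarrow> 0" by real_asymp
  qed
  moreover have "(\<lambda>n. real n * c / real (Suc n)) \<longlonglongrightarrow> c" by real_asymp
  ultimately have "(\<lambda>n. (u n - real n * c) / real (Suc n) + real n * c / real (Suc n)) \<longlonglongrightarrow> 0 + c"
    by (rule tendsto_add)
  then show ?thesis by (simp add: diff_divide_distrib del: of_nat_Suc)
qed

theorem proposition2:
  fixes w :: complex and w_n :: "nat \<Rightarrow> int \<times> int"
  assumes "0 < Im w" and "Im w < 1"
    and "integral_approximation w_n w"
  shows "\<exists>p :: nat \<Rightarrow> real.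
    (\<forall>\<^sub>F L in sequentially.
      (\<lambda>n. measure_pmf.prob (tiling_pair_law n L)
              {(T1, T2). lies_above n L (w_n n) (gamma_path n L T1 T2)}) \<longlonglongrightarrow> p L) \<and>
    p \<longlonglongrightarrow> Im w"
proof -
  define a where "a n = fst (w_n n)" for n
  define b where "b n = snd (w_n n)" for n
  obtain K where K: "\<And>n. dist (lattice_point (w_n n)) (2 * of_nat n * w) \<le> K"
    using assms(3) unfolding integral_approximation_def by blast
  have aK: "\<bar>of_int (a n) - 2 * real n * Re w\<bar> \<le> K" for n
    using K[of n] abs_Re_le_cmod[of "lattice_point (w_n n) - 2 * of_nat n * w"]
    by (simp add: dist_norm lattice_point_def a_def)
  have bK: "\<bar>of_int (b n) - 2 * real n * Im w\<bar> \<le> K" for n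
    using K[of n] abs_Im_le_cmod[of "lattice_point (w_n n) - 2 * of_nat n * w"]
    by (simp add: dist_norm lattice_point_def b_def)
  \<comment> \<open>The value at \<open>w\<close> of the harmonic function on the rectangle of
    height 1 and width \<open>real L\<close>, centred at real part 0, with boundary values 0 at the
    bottom and 1 elsewhere.\<close>
  define p where "p L = Im w + (\<Sum>k. limit_mode (real L / 2) (Re w) (Im w) k)" for L
  have lim: "(\<lambda>n. measure_pmf.prob (tiling_pair_law n L)
      {(T1, T2). lies_above n L (w_n n) (gamma_path n L T1 T2)}) \<longlonglongrightarrow> p L"
    if L: "2 * \<bar>Re w\<bar> < real L" for L
  proof -
    define x where "x n = real_of_int ((a n - 1 + int (n * L)) div 2)" for n
    define y where "y n = real_of_int ((b n + 1) div 2)" for n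
    have half: "2 * real_of_int (m div 2) \<le> of_int m" "of_int m \<le> 2 * real_of_int (m div 2) + 1" for m :: int
      by linarith+
    \<comment> \<open>Passing from cells to the grid halves the coordinates, so the scale
      \<open>2 * n\<close> becomes \<open>n\<close>; the rounding by \<open>div\<close> adds only a
      bounded error.\<close>
    have xb: "\<bar>(x n - (real (n * L) - 1) / 2) - real n * Re w\<bar> \<le> K / 2 + 1" for n
      using half[of "a n - 1 + int (n * L)"] aK[of n] unfolding x_def abs_le_iff
      by (simp add: field_simps)
    have yb: "\<bar>y n - real n * Im w\<bar> \<le> K / 2 + 1" for n
      using half[of "b n + 1"] bK[of n] unfolding y_def abs_le_iff
      by (simp add: field_simps)
    have "(\<lambda>n. strip_solution (n * L) (Suc n) (x n) (y n)) \<longlonglongrightarrow> p L"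
      unfolding p_def
    proof (rule strip_solution_limit)
      show "(\<lambda>n. (x n - (real (n * L) - 1) / 2) / real (Suc n)) \<longlonglongrightarrow> Re w"
        using xb by (intro bounded_distance_limit[of _ _ "K / 2 + 1"] always_eventually) blast
      show "(\<lambda>n. y n / real (Suc n)) \<longlonglongrightarrow> Im w"
        using yb by (intro bounded_distance_limit[of _ _ "K / 2 + 1"] always_eventually) blast
      show "(\<lambda>n. (real (n * L) + 1) / 2 / real (Suc n)) \<longlonglongrightarrow> real L / 2"
        by (rule bounded_distance_limit[of _ _ 1]) (simp add: field_simps)
      show "\<bar>Re w\<bar> < real L / 2" using L by simp
    qed
    moreover have "\<forall>\<^sub>F n in sequentially. strip_solution (n * L) (Suc n) (x n) (y n)
      = measure_pmf.prob (tiling_pair_law n L) {(T1, T2). lies_above n L (w_n n) (gamma_path n L T1 T2)}"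
    proof -
      \<comment> \<open>The margin between \<open>2 * n * w\<close> and the sides, bottom and top of
        the rectangle is at least \<open>n * d\<close>. Once it exceeds the approximation error
        \<open>K\<close>, the lattice point is admissible for
        \<open>prob_lies_above\<close>.\<close>
      define d where "d = min (real L - 2 * \<bar>Re w\<bar>) (min (2 * Im w) (2 * (1 - Im w)))"
      have d: "d > 0" "d \<le> real L - 2 * \<bar>Re w\<bar>" "d \<le> 2 * Im w" "d \<le> 2 * (1 - Im w)"
        using L assms(1,2) by (simp_all add: d_def)
      have "\<forall>\<^sub>F n in sequentially. K < real n * d" "\<forall>\<^sub>F n in sequentially. n > 0"
        using d(1) by real_asymp+
      then show ?thesis
      proof eventually_elim
        case (elim n)
        have "L > 0" using L by (cases "L = 0") auto
        then have N: "n * L > 0" using elim by simp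
        have *: "real n * d \<le> real n * (real L - 2 * \<bar>Re w\<bar>)" "real n * d \<le> real n * (2 * Im w)"
          "real n * d \<le> real n * (2 * (1 - Im w))" using d by (auto intro!: mult_left_mono)
        have "real n * Re w \<le> real n * \<bar>Re w\<bar>" "- (real n * Re w) \<le> real n * \<bar>Re w\<bar>"
          by (auto simp: abs_if mult_le_0_iff zero_le_mult_iff)
        then have "\<bar>real_of_int (a n)\<bar> < real n * real L"
          using aK[of n] *(1) elim(1) unfolding abs_less_iff abs_le_iff by (simp add: algebra_simps)
        then have "\<bar>real_of_int (a n)\<bar> < real_of_int (int (n * L))" by simp
        then have an: "- int (n * L) < a n" "a n \<le> int (n * L)" by linarith+
        have "0 \<le> real_of_int (b n)" "real_of_int (b n) \<le> 2 * real n"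
          using bK[of n] *(2,3) elim(1) unfolding abs_le_iff by (simp_all add: algebra_simps)
        then have bn: "0 \<le> b n" "b n \<le> 2 * int n + 1" by linarith+
        have "w_n n = (a n, b n)" by (simp add: a_def b_def)
        then show ?case unfolding x_def y_def prob_lies_above[OF N an bn, symmetric] by simp
      qed
    qed
    ultimately show ?thesis by (rule Lim_transform_eventually)
  qed
  have "\<forall>\<^sub>F L in sequentially. 2 * \<bar>Re w\<bar> < real L" by real_asymp
  then have "\<forall>\<^sub>F L in sequentially. (\<lambda>n. measure_pmf.prob (tiling_pair_law n L)
      {(T1, T2). lies_above n L (w_n n) (gamma_path n L T1 T2)}) \<longlonglongrightarrow> p L"
    by (rule eventually_mono) (rule lim)
  moreover have "p \<longlonglongrightarrow> Im w"
    using tendsto_add[OF tendsto_const limit_mode_sum_tendsto_0, of "Im w" "Re w" "Im w"] by (simp add: p_def[abs_def])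
  ultimately show ?thesis by blast
qed

end
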